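(* Let $F$ be a field of characteristic $0$, $V$ an $n$-dimensional $F$-vector space, $G\le\mathrm{GL}(V)$ a finite group generated by pseudo-reflections, $M$ an $r$-dimensional $F[G]$-module with $M^G=0$, and $\chi$ a one-dimensional character of $G$. Suppose $J_{M^*}$ divides $\Delta_\chi$. Then the $2^r$ elements \[ \{d_{i_1}^*\cdots d_{i_k}^*\Delta_\chi : 0\le k\le r,\ 1\le i_1<\cdots<i_k\le r\} \] form an $F$-basis of $\mathcal{H}(\mathrm{S}(V^* )\otimes\wedge M^* )^\chi$, and their images form a basis of $\big((\mathrm{S}(V^* )\otimes\wedge M^* )/\mathcal{J}_M^*\big)^\chi$.
   Context: A pseudo-reflection is $g\in\mathrm{GL}(V)$ with $\dim\ker(g-I)=n-1$. $G$ acts contragrediently on $V^*,M^*$ and diagonally on tensor products of symmetric algebras $\mathrm{S}(\cdot)$ and exterior algebras $\wedge(\cdot)$. $W^\chi=\{w: gw=\chi(g)w\ \forall g\}$. $\Delta_\chi$ is a homogeneous generator of $\mathrm{S}(V^* )^\chi$ as a (rank-one free) $\mathrm{S}(V^* )^G$-module. $(\mathrm{S}(V^* )\otimes M)^G$ is a free $\mathrm{S}(V^* )^G$-module with homogeneous basis $\omega_1^{M^*},\dots,\omega_r^{M^*}$; writing $\omega_i^{M^*}=\sum_j J_{ij}\otimes m_j$ for a basis $m_j$ of $M$, $J_{M^*}=\det(J_{ij})$. $(\mathrm{S}(V)\otimes M^* )^G$ is a free $\mathrm{S}(V)^G$-module with homogeneous basis $\tilde\omega_1^{M^*},\dots,\tilde\omega_r^{M^*}$.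 For $s\in\mathrm{S}(V)$, $\partial_s$ is the constant-coefficient differential operator on $\mathrm{S}(V^* )$ ($\partial_v$ for $v\in V$ is the derivation with $\partial_v\lambda=\lambda(v)$, extended multiplicatively); $\epsilon_\mu$ is left exterior multiplication by $\mu\in\wedge M^*$. If $\tilde\omega_i^{M^*}=\sum_j s_j\otimes\mu_j$, then $d_i^*:=\sum_j\partial_{s_j}\otimes\epsilon_{\mu_j}$ on $\mathrm{S}(V^* )\otimes\wedge M^*$. $\mathcal{J}_M\subset\mathrm{S}(V)\otimes\wedge M$ and $\mathcal{J}_M^*\subset\mathrm{S}(V^* )\otimes\wedge M^*$ are the ideals generated by homogeneous $G$-invariants of positive degree. The pairing $\mathrm{S}(V^* )\otimes\wedge M^*\times\mathrm{S}(V)\otimes\wedge M\to F$ is $\langle f\otimes\nu, s\otimes\ell\rangle=\langle f,s\rangle\langle\nu,\ell\rangle$ where $\langle\lambda_1\cdots\lambda_k,v_1\cdots v_l\rangle=\delta_{kl}\sum_{\sigma\in\mathfrak{S}_k}\prod_i\lambda_i(v_{\sigma(i)})$ and $\langle\xi_1\wedge\cdots\wedge\xi_k,m_1\wedge\cdots\wedge m_l\rangle=\delta_{kl}\det(\xi_i(m_j))$. The harmonics are $\mathcal{H}(\mathrm{S}(V^* )\otimes\wedge M^* )=\{\omega:\langle\omega,\xi\rangle=0\ \forall\xi\in\mathcal{J}_M\}$. *)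

theory Defs
  imports "HOL-Analysis.Analysis" "HOL-Library.Poly_Mapping" "HOL-Combinatorics.Permutations"
begin

type_synonym ('a, 'n) sqmat = "(('a, 'n) vec, 'n) vec"

text \<open>V = ('a, 'n) vec with standard basis e_i, dual basis x_i; M has basis m_j (j :: 'r),
  dual basis mu_j.  Matrices act on column vectors; g e_i = sum_j g$j$i e_j.
  Both S(V^*) and S(V) are represented as polynomials in CARD('n) variables
  (variables x_i resp. e_i), type ('n =>0 nat) =>0 'a.\<close>

type_synonym ('n, 'a) pol = "('n \<Rightarrow>\<^sub>0 nat) \<Rightarrow>\<^sub>0 'a"

definition pconst :: "'a::comm_ring_1 \<Rightarrow> ('n, 'a) pol" where
  "pconst c = Poly_Mapping.single 0 c"

definition pvar :: "'n \<Rightarrow> ('n, 'a::comm_ring_1) pol" where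
  "pvar i = Poly_Mapping.single (Poly_Mapping.single i 1) 1"

definition psubst :: "('n::finite \<Rightarrow> ('n, 'a::comm_ring_1) pol) \<Rightarrow> ('n, 'a) pol \<Rightarrow> ('n, 'a) pol" where
  "psubst \<sigma> f = (\<Sum>m\<in>Poly_Mapping.keys f. pconst (Poly_Mapping.lookup f m) * (\<Prod>i\<in>UNIV. (\<sigma> i) ^ (Poly_Mapping.lookup m i)))"

definition mdeg :: "('n::finite \<Rightarrow>\<^sub>0 nat) \<Rightarrow> nat" where
  "mdeg m = (\<Sum>i\<in>UNIV. Poly_Mapping.lookup m i)"

definition phomog :: "nat \<Rightarrow> ('n::finite, 'a::comm_ring_1) pol \<Rightarrow> bool" where
  "phomog d f \<longleftrightarrow> (\<forall>m\<in>Poly_Mapping.keys f. mdeg m = d)"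

text \<open>Action of g on S(V^*): (g f)(v) = f(g^{-1} v), i.e. x_i |-> sum_j (g^{-1})_{ij} x_j.\<close>
definition actSd :: "('a::field, 'n) sqmat \<Rightarrow> ('n::finite, 'a) pol \<Rightarrow> ('n, 'a) pol" where
  "actSd g f = psubst (\<lambda>i. \<Sum>j\<in>UNIV. pconst (matrix_inv g $ i $ j) * pvar j) f"

text \<open>Action of g on S(V): e_i |-> g e_i = sum_j g_{ji} e_j.\<close>
definition actS :: "('a::field, 'n) sqmat \<Rightarrow> ('n::finite, 'a) pol \<Rightarrow> ('n, 'a) pol" where
  "actS g f = psubst (\<lambda>i. \<Sum>j\<in>UNIV. pconst (g $ j $ i) * pvar j) f"

definition pseudo_reflection :: "('a::field, 'n::finite) sqmat \<Rightarrow> bool" where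
  "pseudo_reflection g \<longleftrightarrow> invertible g \<and> vec.dim {v. (g - mat 1) *v v = 0} = CARD('n) - 1"

inductive_set gen_group :: "(('a::field, 'n::finite) sqmat) set \<Rightarrow> (('a, 'n) sqmat) set"
  for R where
  one: "mat 1 \<in> gen_group R"
| gen: "r \<in> R \<Longrightarrow> r \<in> gen_group R"
| mult: "a \<in> gen_group R \<Longrightarrow> b \<in> gen_group R \<Longrightarrow> a ** b \<in> gen_group R"
| inv: "a \<in> gen_group R \<Longrightarrow> matrix_inv a \<in> gen_group R"

definition finite_pseudo_reflection_group :: "(('a::field, 'n::finite) sqmat) set \<Rightarrow> bool" where
  "finite_pseudo_reflection_group G \<longleftrightarrow> finite G \<and> (\<forall>g\<in>G. invertible g)
     \<and> G = gen_group {g\<in>G. pseudo_reflection g}"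

text \<open>An element of S(V^*) (x) M is F :: 'r => pol, meaning sum_j F j (x) m_j, where
  rho(g) m_j = sum_k rho(g)_{kj} m_k.\<close>
definition actSdM :: "(('a::field, 'n::finite) sqmat \<Rightarrow> ('a, 'r::finite) sqmat) \<Rightarrow> ('a, 'n) sqmat \<Rightarrow> ('r \<Rightarrow> ('n, 'a) pol) \<Rightarrow> 'r \<Rightarrow> ('n, 'a) pol" where
  "actSdM \<rho> g F = (\<lambda>k. \<Sum>j\<in>UNIV. pconst (\<rho> g $ k $ j) * actSd g (F j))"

text \<open>An element of S(V) (x) M^* is s :: 'r => pol, meaning sum_j s j (x) mu_j, where
  g mu_j = mu_j o rho(g)^{-1} = sum_k (rho(g)^{-1})_{jk} mu_k.\<close>
definition actSMd :: "(('a::field, 'n::finite) sqmat \<Rightarrow> ('a, 'r::finite) sqmat) \<Rightarrow> ('a, 'n) sqmat \<Rightarrow> ('r \<Rightarrow> ('n, 'a) pol) \<Rightarrow> 'r \<Rightarrow> ('n, 'a) pol" where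
  "actSMd \<rho> g F = (\<lambda>k. \<Sum>j\<in>UNIV. pconst (matrix_inv (\<rho> g) $ j $ k) * actS g (F j))"

text \<open>An element of S (x) \<And>W (W = M or M^*, with ordered basis w_j, j :: 'r) is
  F :: 'r set => pol, meaning sum_I F I (x) w_I, where w_I = w_{i1} ^ ... ^ w_{ik}
  for I = {i1 < ... < ik}.\<close>
type_synonym ('r, 'n, 'a) sext = "'r set \<Rightarrow> ('n, 'a) pol"

definition wsign :: "'r::linorder set \<Rightarrow> 'r set \<Rightarrow> 'a::comm_ring_1" where
  "wsign I J = (- 1) ^ card {(i, j). i \<in> I \<and> j \<in> J \<and> j < i}"

definition emult :: "('r::{finite,linorder}, 'n, 'a::comm_ring_1) sext \<Rightarrow> ('r, 'n, 'a) sext \<Rightarrow> ('r, 'n, 'a) sext" where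
  "emult F H = (\<lambda>K. \<Sum>I\<in>UNIV. \<Sum>J\<in>UNIV. if I \<inter> J = {} \<and> I \<union> J = K
      then pconst (wsign I J) * F I * H J else 0)"

definition eone :: "('r, 'n, 'a::comm_ring_1) sext" where
  "eone = (\<lambda>K. if K = {} then 1 else 0)"

definition eadd :: "('r, 'n, 'a::comm_ring_1) sext \<Rightarrow> ('r, 'n, 'a) sext \<Rightarrow> ('r, 'n, 'a) sext" where
  "eadd F H = (\<lambda>K. F K + H K)"

definition ezero :: "('r, 'n, 'a::comm_ring_1) sext" where
  "ezero = (\<lambda>K. 0)"

definition esum :: "('i \<Rightarrow> ('r, 'n, 'a::comm_ring_1) sext) \<Rightarrow> 'i set \<Rightarrow> ('r, 'n, 'a) sext" where
  "esum f A = (\<lambda>K. \<Sum>i\<in>A. f i K)"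

definition escale :: "'a::comm_ring_1 \<Rightarrow> ('r, 'n, 'a) sext \<Rightarrow> ('r, 'n, 'a) sext" where
  "escale c F = (\<lambda>K. pconst c * F K)"

definition eminus :: "('r, 'n, 'a::comm_ring_1) sext \<Rightarrow> ('r, 'n, 'a) sext \<Rightarrow> ('r, 'n, 'a) sext" where
  "eminus F H = (\<lambda>K. F K - H K)"

definition embS :: "('n, 'a::comm_ring_1) pol \<Rightarrow> ('r, 'n, 'a) sext" where
  "embS f = (\<lambda>K. if K = {} then f else 0)"

definition elin :: "('r \<Rightarrow> 'a::comm_ring_1) \<Rightarrow> ('r, 'n, 'a) sext" where
  "elin c = (\<lambda>K. if card K = 1 then pconst (c (the_elem K)) else 0)"

definition ewedge_list :: "('r::{finite,linorder}, 'n, 'a::comm_ring_1) sext list \<Rightarrow> ('r, 'n, 'a) sext" where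
  "ewedge_list xs = foldr emult xs eone"

text \<open>Diagonal action on S (x) \<And>W: polynomial part acted on by \<sigma>, and w_i |-> sum_k A i k w_k,
  extended multiplicatively on the exterior algebra.\<close>
definition eact :: "('r::{finite,linorder} \<Rightarrow> 'r \<Rightarrow> 'a::comm_ring_1) \<Rightarrow> (('n, 'a) pol \<Rightarrow> ('n, 'a) pol)
    \<Rightarrow> ('r, 'n, 'a) sext \<Rightarrow> ('r, 'n, 'a) sext" where
  "eact A \<sigma> F = esum (\<lambda>I. emult (embS (\<sigma> (F I)))
       (ewedge_list (map (\<lambda>i. elin (A i)) (sorted_list_of_set I)))) UNIV"

definition actVd :: "(('a::field, 'n::finite) sqmat \<Rightarrow> ('a, 'r::{finite,linorder}) sqmat) \<Rightarrow> ('a, 'n) sqmat \<Rightarrow> ('r, 'n, 'a) sext \<Rightarrow> ('r, 'n, 'a) sext" where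
  "actVd \<rho> g = eact (\<lambda>i k. matrix_inv (\<rho> g) $ i $ k) (actSd g)"

definition actV :: "(('a::field, 'n::finite) sqmat \<Rightarrow> ('a, 'r::{finite,linorder}) sqmat) \<Rightarrow> ('a, 'n) sqmat \<Rightarrow> ('r, 'n, 'a) sext \<Rightarrow> ('r, 'n, 'a) sext" where
  "actV \<rho> g = eact (\<lambda>j k. \<rho> g $ k $ j) (actS g)"

definition ehomog :: "nat \<Rightarrow> ('r::finite, 'n::finite, 'a::comm_ring_1) sext \<Rightarrow> bool" where
  "ehomog d F \<longleftrightarrow> (\<forall>I. \<forall>m\<in>Poly_Mapping.keys (F I). mdeg m + card I = d)"

inductive_set ideal_gen :: "('r::{finite,linorder}, 'n, 'a::comm_ring_1) sext set \<Rightarrow> ('r, 'n, 'a) sext set"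
  for P where
  base: "x \<in> P \<Longrightarrow> x \<in> ideal_gen P"
| zero: "ezero \<in> ideal_gen P"
| add: "x \<in> ideal_gen P \<Longrightarrow> y \<in> ideal_gen P \<Longrightarrow> eadd x y \<in> ideal_gen P"
| lmult: "x \<in> ideal_gen P \<Longrightarrow> emult a x \<in> ideal_gen P"
| rmult: "x \<in> ideal_gen P \<Longrightarrow> emult x a \<in> ideal_gen P"

definition inv_ideal :: "(('a::field, 'n::finite) sqmat) set
    \<Rightarrow> (('a, 'n) sqmat \<Rightarrow> ('r::{finite,linorder}, 'n, 'a) sext \<Rightarrow> ('r, 'n, 'a) sext) \<Rightarrow> ('r, 'n, 'a) sext set" where
  "inv_ideal G act = ideal_gen {\<xi>. (\<exists>d>0. ehomog d \<xi>) \<and> (\<forall>g\<in>G. act g \<xi> = \<xi>)}"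

definition mlist :: "('n::{finite,linorder} \<Rightarrow>\<^sub>0 nat) \<Rightarrow> 'n list" where
  "mlist a = concat (map (\<lambda>i. replicate (Poly_Mapping.lookup a i) i) (sorted_list_of_set UNIV))"

text \<open><lambda>_1...\<lambda>_k, v_1...v_l> = \<delta>_kl sum_\<sigma> prod_i \<lambda>_i(v_\<sigma>(i)), for \<lambda>'s among the x_i and
  v's among the e_i, so each product is 0 or 1.\<close>
definition pair_mon :: "('n::{finite,linorder} \<Rightarrow>\<^sub>0 nat) \<Rightarrow> ('n \<Rightarrow>\<^sub>0 nat) \<Rightarrow> 'a::comm_ring_1" where
  "pair_mon a b = (if length (mlist a) = length (mlist b)
     then (\<Sum>\<sigma>\<in>{\<sigma>. \<sigma> permutes {..<length (mlist a)}}.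
             \<Prod>i<length (mlist a). if mlist a ! i = mlist b ! (\<sigma> i) then 1 else 0)
     else 0)"

text \<open>Pairing of S(V^*) (x) \<And>M^* with S(V) (x) \<And>M; <mu_I, m_K> = det(mu_i(m_k)) = \<delta>_IK.\<close>
definition epair :: "('r::finite, 'n::{finite,linorder}, 'a::comm_ring_1) sext \<Rightarrow> ('r, 'n, 'a) sext \<Rightarrow> 'a" where
  "epair F X = (\<Sum>I\<in>UNIV. \<Sum>a\<in>Poly_Mapping.keys (F I). \<Sum>b\<in>Poly_Mapping.keys (X I).
       Poly_Mapping.lookup (F I) a * Poly_Mapping.lookup (X I) b * pair_mon a b)"

definition harmonics :: "('r::{finite,linorder}, 'n::{finite,linorder}, 'a::field) sext set \<Rightarrow> ('r, 'n, 'a) sext set" where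
  "harmonics J = {\<omega>. \<forall>\<xi>\<in>J. epair \<omega> \<xi> = 0}"

definition pderiv_var :: "'n \<Rightarrow> ('n, 'a::comm_ring_1) pol \<Rightarrow> ('n, 'a) pol" where
  "pderiv_var i f = (\<Sum>m\<in>Poly_Mapping.keys f. Poly_Mapping.single (m - Poly_Mapping.single i 1)
        (of_nat (Poly_Mapping.lookup m i) * Poly_Mapping.lookup f m))"

text \<open>\<partial>_s for s in S(V): \<partial>_{e_i} = \<partial>/\<partial>x_i, extended multiplicatively and linearly.\<close>
definition dmon :: "('n::{finite,linorder} \<Rightarrow>\<^sub>0 nat) \<Rightarrow> ('n, 'a::comm_ring_1) pol \<Rightarrow> ('n, 'a) pol" where
  "dmon m = foldr (\<lambda>i h. (pderiv_var i ^^ Poly_Mapping.lookup m i) \<circ> h) (sorted_list_of_set UNIV) id"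

definition dop :: "('n::{finite,linorder}, 'a::comm_ring_1) pol \<Rightarrow> ('n, 'a) pol \<Rightarrow> ('n, 'a) pol" where
  "dop s f = (\<Sum>m\<in>Poly_Mapping.keys s. pconst (Poly_Mapping.lookup s m) * dmon m f)"

text \<open>d^* for tilde-omega = sum_j s_j (x) mu_j : sum_j \<partial>_{s_j} (x) \<epsilon>_{mu_j}.\<close>
definition dstar :: "('r::{finite,linorder} \<Rightarrow> ('n::{finite,linorder}, 'a::comm_ring_1) pol) \<Rightarrow> ('r, 'n, 'a) sext \<Rightarrow> ('r, 'n, 'a) sext" where
  "dstar s F = esum (\<lambda>j. emult (elin (\<lambda>k. if k = j then 1 else 0)) (\<lambda>K. dop (s j) (F K))) UNIV"

definition dstar_seq :: "('r::{finite,linorder} \<Rightarrow> 'r \<Rightarrow> ('n::{finite,linorder}, 'a::comm_ring_1) pol) \<Rightarrow> 'r set \<Rightarrow> ('r, 'n, 'a) sext \<Rightarrow> ('r, 'n, 'a) sext" where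
  "dstar_seq tw I = foldr (\<lambda>i h. dstar (tw i) \<circ> h) (sorted_list_of_set I) id"

definition pdet :: "('r::finite \<Rightarrow> 'r \<Rightarrow> ('n, 'a::comm_ring_1) pol) \<Rightarrow> ('n, 'a) pol" where
  "pdet J = (\<Sum>p\<in>{p. p permutes (UNIV :: 'r set)}. of_int (sign p) * (\<Prod>i\<in>UNIV. J i (p i)))"

end

theory Submission
  imports Defs "HOL-Library.Function_Algebras" "HOL-Computational_Algebra.Fraction_Field"
begin

text \<open>
  Write A for the polynomial forms, J for their ideal generated by invariants, H for the harmonics, d_i for
  the given operators and d_I for their products. An operator d_i anticommutes with contraction
  by an odd letter up to a differential operator
  coming from an invariant, and a contraction of an invariant of positive degree against d_i has again
  positive degree because M has no invariants. Since \<open>\<Delta>\<close> has least degree among the semiinvariants, all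
  d_I \<open>\<Delta>\<close> are harmonic.

  If J_{M^*} divides \<open>\<Delta>\<close>, the \<open>\<chi>\<close>-semiinvariants of A are spanned over the invariants by \<open>2^r\<close> forms, namely the
  contractions of \<open>\<Delta> / J_{M^*}\<close> times the top form with the basic invariants. So \<open>(A/J)^\<chi>\<close> has dimension at
  most \<open>2^r\<close>, and it remains to see that H and J intersect trivially and that the d_I \<open>\<Delta>\<close> are independent. For
  the latter it suffices that the product of all d_i does not annihilate \<open>\<Delta>\<close>.

  Over the complex numbers both facts follow from a positive definite invariant Hermitian form. Over F,
  embed V and M into permutation modules \<open>F[G]^k\<close>: there invariants have rational spanning sets, the
  pairing becomes the standard one, and a vector in the span of rational vectors that is orthogonal to
  these vectors vanishes. Applied to J this gives that H and J intersect trivially; applied to \<open>\<Delta>\<close>, which is a product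
  of r invariants with \<open>\<Delta> / J_{M^*}\<close>, it yields r invariants in the dual algebra whose product acts on \<open>\<Delta>\<close>
  without annihilating it, and these invariants are combinations of the given ones.
\<close>

subsection \<open>Rational Gram matrices\<close>

text \<open>The obstacle is positivity: F carries neither an order nor a conjugation, and V and M
  need not be defined over the rationals. What is rational is the combinatorics of translation. A
  letter (a, g) stands for the translate by g of the a-th basis vector; the group permutes these
  letters, and comparing letters by equality gives an integral pairing. A form f is replaced by the
  function W |-> <f, W> on words in such letters. This is the embedding into the symmetric and
  exterior powers of a permutation module, which is never built as a module. Field data enter only
  through the matrix \<open>\<kappa>\<close> pairing dual letters with letters, and this matrix does
  not change when both letters are translated by the same element. So a translated word is rewritten
  in permutation letters with coefficients independent of the translation, and averaging over the
  group commutes with the rewriting. Labels record which letters of a word move together: those of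
  the invariant factor of an element of the ideal, or those of each of the r invariant factors of
  \<open>\<Delta>\<close> separately. Parity signs let even and odd variables be treated at
  once.\<close>

lemma vector_space_fun:
  fixes scale :: "'a::field \<Rightarrow> 'b::ab_group_add \<Rightarrow> 'b"
  assumes "vector_space scale"
  shows "vector_space (\<lambda>c f x. scale c (f x))"
  using assms by (auto simp: vector_space_def fun_eq_iff)

lemma sum_fun_apply: "(\<Sum>i\<in>A. f i) x = (\<Sum>i\<in>A. f i x)"
  for f :: "'i \<Rightarrow> 'w \<Rightarrow> 'b::comm_monoid_add"
  by (induction A rule: infinite_finite_induct) auto

definition lin :: "('a \<Rightarrow> 't::ab_group_add \<Rightarrow> 't) \<Rightarrow> ('a \<Rightarrow> 's::ab_group_add \<Rightarrow> 's) \<Rightarrow> ('t \<Rightarrow> 's) \<Rightarrow> bool" where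
  "lin s s' f \<longleftrightarrow> (\<forall>x y. f (x + y) = f x + f y) \<and> (\<forall>c x. f (s c x) = s' c (f x))"

lemma lin_add: "lin s s' f \<Longrightarrow> f (x + y) = f x + f y"
  and lin_scale: "lin s s' f \<Longrightarrow> f (s c x) = s' c (f x)"
  by (auto simp: lin_def)

lemma lin_zero: "lin s s' f \<Longrightarrow> f 0 = 0"
  using lin_add[of s s' f 0 0] by simp

lemma lin_minus: "lin s s' f \<Longrightarrow> f (- x) = - f x"
  using lin_add[of s s' f x "- x"] lin_zero[of s s' f] by (simp add: eq_neg_iff_add_eq_0 add.commute)

lemma lin_diff: "lin s s' f \<Longrightarrow> f (x - y) = f x - f y"
  using lin_add[of s s' f x "- y"] lin_minus[of s s' f y] by simp

lemma lin_sum: "lin s s' f \<Longrightarrow> f (sum h A) = (\<Sum>i\<in>A. f (h i))"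
  by (induction A rule: infinite_finite_induct) (auto simp: lin_add lin_zero)

lemma lin_comp: "lin s s' f \<Longrightarrow> lin s' s'' g \<Longrightarrow> lin s s'' (\<lambda>x. g (f x))"
  by (auto simp: lin_def)

lemma lin_foldr: "(\<And>a. a \<in> set xs \<Longrightarrow> lin s s (f a)) \<Longrightarrow> lin s s (foldr f xs)"
  by (induction xs) (auto simp: lin_def)

lemma (in vector_space) lin_sum_fun: "(\<And>i. i \<in> A \<Longrightarrow> lin s' scale (f i)) \<Longrightarrow> lin s' scale (\<lambda>x. \<Sum>i\<in>A. f i x)"
  by (auto simp: lin_def sum.distrib scale_sum_right)

lemma (in vector_space) lin_scale_fun: "lin s' scale f \<Longrightarrow> lin s' scale (\<lambda>x. scale c (f x))"
  unfolding lin_def using scale_right_distrib scale_left_commute by metis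

interpretation fs: vector_space "\<lambda>c (f::'w \<Rightarrow> 'a::field) x. c * f x"
  by (rule vector_space_fun) (auto simp: vector_space_def algebra_simps)

text \<open>The order is borrowed from the rationals: the sum is the image of a rational sum of
  squares under the injection \<open>of_rat\<close>.\<close>

lemma sum_squares_Rats:
  fixes q :: "'w \<Rightarrow> 'a::field_char_0"
  assumes "finite X" "\<forall>x\<in>X. q x \<in> \<rat>" "(\<Sum>x\<in>X. q x * q x) = 0" "x \<in> X"
  shows "q x = 0"
proof -
  have "\<forall>x\<in>X. \<exists>r. q x = of_rat r" using assms(2) by (auto elim: Rats_cases)
  then obtain r where r: "\<And>x. x \<in> X \<Longrightarrow> q x = of_rat (r x)" using bchoice by metis
  have "of_rat (\<Sum>x\<in>X. r x * r x) = (\<Sum>x\<in>X. q x * q x)"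
    by (simp add: of_rat_sum of_rat_mult r)
  then have "(\<Sum>x\<in>X. r x * r x) = 0" using assms(3) by simp
  then have "r x * r x = 0" using assms(1,4)
    by (subst (asm) sum_nonneg_eq_0_iff) auto
  then show ?thesis using r[OF assms(4)] by simp
qed

text \<open>This is the only place where positivity enters: the standard form is anisotropic on
  rational vectors, hence nondegenerate on every subspace spanned by rational vectors.\<close>

lemma orthogonal_rational_span:
  fixes \<phi> :: "'w \<Rightarrow> 'a::field_char_0"
  assumes X: "finite X"
  shows "\<lbrakk>\<forall>q\<in>set qs. \<forall>x\<in>X. q x \<in> \<rat>; \<phi> \<in> fs.span (set qs);
    \<forall>q\<in>set qs. (\<Sum>x\<in>X. \<phi> x * q x) = 0\<rbrakk> \<Longrightarrow> \<forall>x\<in>X. \<phi> x = 0"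
proof (induction "length qs" arbitrary: qs \<phi>)
  case 0
  then show ?case by (auto simp: fs.span_empty)
next
  case (Suc n)
  then obtain q qs1 where qs: "qs = q # qs1" "length qs1 = n" by (cases qs) auto
  define ip where "ip f g = (\<Sum>x\<in>X. f x * g x)" for f g :: "'w \<Rightarrow> 'a"
  obtain c where c: "\<phi> - (\<lambda>x. c * q x) \<in> fs.span (set qs1)"
    using Suc.prems(2) unfolding qs by (auto simp: fs.span_breakdown_eq)
  define s where "s = \<phi> - (\<lambda>x. c * q x)"
  have s: "s \<in> fs.span (set qs1)" and phi: "\<phi> x = s x + c * q x" for x
    using c by (auto simp: s_def)
  have orth: "ip \<phi> q' = 0" if "q' \<in> set qs" for q'
    using Suc.prems(3) that by (auto simp: ip_def)
  have qrat: "q x \<in> \<rat>" if "x \<in> X" for x using Suc.prems(1) that by (auto simp: qs)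
  show ?case
  proof (cases "ip q q = 0")
    case True
    then have q0: "q x = 0" if "x \<in> X" for x
      using sum_squares_Rats[OF X, of q x] qrat that True unfolding ip_def by blast
    have "ip s q' = 0" if "q' \<in> set qs1" for q'
    proof -
      have "ip s q' = ip \<phi> q'" unfolding ip_def
        by (rule sum.cong) (auto simp: phi q0)
      then show ?thesis using orth that by (simp add: qs)
    qed
    then have "\<forall>x\<in>X. s x = 0"
      using Suc.prems(1) s Suc.hyps(1)[of qs1 s] qs by (auto simp: ip_def)
    then show ?thesis by (auto simp: phi q0)
  next
    case False
    \<comment> \<open>Gram-Schmidt: \<open>P\<close> projects along \<open>q\<close>. On rational
      vectors its coefficients are quotients of rationals, so the projected list is again rational
      and the induction hypothesis applies to it.\<close>
    define P where "P f = (\<lambda>x. f x - ip f q / ip q q * q x)" for f :: "'w \<Rightarrow> 'a"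
    have Pspan: "P f \<in> fs.span (set (map P qs1))" if "f \<in> fs.span (set qs1)" for f
      using that
    proof (induction rule: fs.span_induct_alt)
      case base
      have "P 0 = 0" by (auto simp: P_def ip_def fun_eq_iff)
      then show ?case by (simp only: fs.span_zero)
    next
      case (step k x y)
      have "P ((\<lambda>z. k * x z) + y) = (\<lambda>z. k * P x z) + P y"
        by (auto simp: P_def ip_def fun_eq_iff sum.distrib algebra_simps
            add_divide_distrib sum_distrib_left)
      moreover have "(\<lambda>z. k * P x z) + P y \<in> fs.span (set (map P qs1))"
        by (rule fs.span_add[OF fs.span_scale[OF fs.span_base]]) (use step in auto)
      ultimately show ?case by metis
    qed
    have ipP: "ip (P f) q = 0" for f
      using False by (simp add: P_def ip_def left_diff_distrib sum_subtractf mult.assoc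
          sum_distrib_left[symmetric] sum_divide_distrib[symmetric])
    \<comment> \<open>The \<open>q\<close>-component of \<phi> relative to the orthogonal splitting;
      it vanishes because \<phi> is orthogonal to \<open>q\<close>.\<close>
    define d where "d = c + ip s q / ip q q"
    have phi': "\<phi> x = P s x + d * q x" for x by (simp add: phi P_def d_def algebra_simps)
    have "ip \<phi> q = ip (P s) q + d * ip q q"
      by (simp add: ip_def phi' algebra_simps sum.distrib sum_distrib_left)
    then have "d = 0" using ipP orth[of q] False by (simp add: qs)
    then have phiP: "\<phi> = P s" by (auto simp: phi')
    have iprat: "ip f g \<in> \<rat>" if "\<forall>x\<in>X. f x \<in> \<rat>" "\<forall>x\<in>X. g x \<in> \<rat>" for f g
      unfolding ip_def using that by (intro Rats_sum Rats_mult) auto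
    show ?thesis
    proof (rule Suc.hyps(1)[of "map P qs1"])
      show "n = length (map P qs1)" by (simp add: qs)
      show "\<forall>q'\<in>set (map P qs1). \<forall>x\<in>X. q' x \<in> \<rat>"
        using Suc.prems(1) iprat qrat unfolding P_def qs
        by (auto intro!: Rats_diff Rats_mult Rats_divide)
      show "\<phi> \<in> fs.span (set (map P qs1))" using Pspan[OF s] by (simp add: phiP)
      show "\<forall>q'\<in>set (map P qs1). (\<Sum>x\<in>X. \<phi> x * q' x) = 0"
      proof
        fix q' assume "q' \<in> set (map P qs1)"
        then obtain f where f: "f \<in> set qs1" "q' = P f" by auto
        have "(\<Sum>x\<in>X. \<phi> x * q' x) = ip \<phi> f - ip f q / ip q q * ip \<phi> q"
          unfolding f P_def ip_def[of \<phi>]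
          by (simp add: right_diff_distrib sum_subtractf sum_distrib_left mult.left_commute)
        then show "(\<Sum>x\<in>X. \<phi> x * q' x) = 0" using orth f by (simp add: qs)
      qed
    qed
  qed
qed

subsection \<open>Words in even and odd letters and contragredient actions\<close>

definition ssgn :: "('x \<Rightarrow> bool) \<Rightarrow> 'x \<Rightarrow> 'x \<Rightarrow> 'a::comm_ring_1" where
  "ssgn od a b = (if od a \<and> od b then - 1 else 1)"

text \<open>Canonical commutation relations for even letters and anticommutation relations for odd
  ones, with \<open>z\<close> and \<open>D\<close> adjoint under \<open>B\<close> and \<Omega> as
  vacuum. \<open>L g\<close> and \<open>Li g\<close> are the matrices of g on the letters and on the
  dual letters; all that is required of them is that they respect parity and that their pairing is
  unchanged under simultaneous left translation (\<open>LiL\<close>).\<close>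

locale super_fock = vector_space scale
  for scale :: "'a::field_char_0 \<Rightarrow> 't::ab_group_add \<Rightarrow> 't" +
  fixes od :: "'x::finite \<Rightarrow> bool"
    and z D :: "'x \<Rightarrow> 't \<Rightarrow> 't"
    and B :: "'t \<Rightarrow> 't \<Rightarrow> 'a"
    and \<Omega> :: 't
    and G :: "'g set" and mul :: "'g \<Rightarrow> 'g \<Rightarrow> 'g"
    and L Li :: "'g \<Rightarrow> 'x \<Rightarrow> 'x \<Rightarrow> 'a"
  assumes lin_z: "lin scale scale (z a)"
    and lin_D: "lin scale scale (D a)"
    and B_lin1: "lin scale (*) (\<lambda>x. B x y)"
    and B_lin2: "lin scale (*) (B x)"
    and zz: "z a (z b X) = scale (ssgn od a b) (z b (z a X))"
    and Dz: "D a (z b X) = scale (if a = b then 1 else 0) X + scale (ssgn od a b) (z b (D a X))"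
    and D_vac: "D a \<Omega> = 0"
    and adj1: "B (z a X) Y = B X (D a Y)"
    and adj2: "B X (z a Y) = B (D a X) Y"
    and B_vac: "B \<Omega> \<Omega> = 1"
    and finite_G: "finite G"
    and mul_G: "g \<in> G \<Longrightarrow> h \<in> G \<Longrightarrow> mul g h \<in> G"
    and inj_mul: "g \<in> G \<Longrightarrow> inj_on (mul g) G"
    and L_par: "L g a b \<noteq> 0 \<Longrightarrow> od a = od b"
    and Li_par: "Li g a b \<noteq> 0 \<Longrightarrow> od a = od b"
    and LiL: "k \<in> G \<Longrightarrow> g \<in> G \<Longrightarrow> h \<in> G \<Longrightarrow>
      (\<Sum>c\<in>UNIV. Li (mul k g) a c * L (mul k h) c b) = (\<Sum>c\<in>UNIV. Li g a c * L h c b)"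
begin

text \<open>For the letter (a, g), \<open>Zl\<close> multiplies by g times the a-th basis vector (a
  column of \<open>L g\<close>) and \<open>Yl\<close> by g times the a-th dual vector (a row of
  \<open>Li g\<close>). Then \<open>DYl\<close> is the adjoint of \<open>Yl\<close>, and \<kappa> is
  the pairing of translated dual vectors with translated vectors.\<close>

definition Zl :: "'x \<times> 'g \<Rightarrow> 't \<Rightarrow> 't" where
  "Zl v X = (\<Sum>b\<in>UNIV. scale (L (snd v) b (fst v)) (z b X))"
definition Yl :: "'x \<times> 'g \<Rightarrow> 't \<Rightarrow> 't" where
  "Yl v X = (\<Sum>b\<in>UNIV. scale (Li (snd v) (fst v) b) (z b X))"
definition DYl :: "'x \<times> 'g \<Rightarrow> 't \<Rightarrow> 't" where
  "DYl v X = (\<Sum>b\<in>UNIV. scale (Li (snd v) (fst v) b) (D b X))"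
definition \<kappa> :: "'x \<times> 'g \<Rightarrow> 'x \<times> 'g \<Rightarrow> 'a" where
  "\<kappa> v w = (\<Sum>c\<in>UNIV. Li (snd v) (fst v) c * L (snd w) c (fst w))"
definition sg :: "'x \<times> 'g \<Rightarrow> 'x \<times> 'g \<Rightarrow> 'a" where
  "sg v w = ssgn od (fst v) (fst w)"
definition A :: "('x \<times> 'g) set" where "A = UNIV \<times> G"

abbreviation "Zw \<equiv> foldr Zl"
abbreviation "Yw \<equiv> foldr Yl"
abbreviation \<delta> :: "'x \<times> 'g \<Rightarrow> 'x \<times> 'g \<Rightarrow> 'a" where "\<delta> v w \<equiv> if v = w then 1 else 0"

lemma finite_A: "finite A" by (auto simp: A_def finite_G)

lemma lin_Zl: "lin scale scale (Zl v)" and lin_Yl: "lin scale scale (Yl v)"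
  unfolding Zl_def[abs_def] Yl_def[abs_def]
  by (intro lin_sum_fun lin_scale_fun lin_z lin_D)+

lemma lin_Zw: "lin scale scale (Zw V)" and lin_Yw: "lin scale scale (Yw V)"
  by (intro lin_foldr lin_Zl lin_Yl)+

lemma \<kappa>_par: "\<kappa> v w \<noteq> 0 \<Longrightarrow> od (fst v) = od (fst w)"
  unfolding \<kappa>_def using L_par Li_par by (metis (no_types, lifting) mult_eq_0_iff sum.neutral)

lemma Zl_Zl: "Zl v (Zl w X) = scale (sg v w) (Zl w (Zl v X))"
proof -
  have "Zl v (Zl w X) = (\<Sum>b\<in>UNIV. \<Sum>c\<in>UNIV.
      scale (L (snd v) b (fst v) * L (snd w) c (fst w)) (z b (z c X)))"
    by (simp add: Zl_def lin_sum[OF lin_z] lin_scale[OF lin_z] scale_sum_right)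
  also have "\<dots> = (\<Sum>b\<in>UNIV. \<Sum>c\<in>UNIV.
      scale (sg v w * (L (snd v) b (fst v) * L (snd w) c (fst w))) (z c (z b X)))"
  proof (intro sum.cong refl)
    fix b c
    show "scale (L (snd v) b (fst v) * L (snd w) c (fst w)) (z b (z c X))
      = scale (sg v w * (L (snd v) b (fst v) * L (snd w) c (fst w))) (z c (z b X))"
    proof (cases "L (snd v) b (fst v) = 0 \<or> L (snd w) c (fst w) = 0")
      case False
      then have "ssgn od b c = sg v w" using L_par unfolding sg_def ssgn_def by metis
      then show ?thesis by (simp add: zz[of b c] mult.commute)
    qed auto
  qed
  also have "\<dots> = scale (sg v w) (Zl w (Zl v X))"
    by (subst sum.swap)
      (simp add: Zl_def lin_sum[OF lin_z] lin_scale[OF lin_z] scale_sum_right mult.commute mult.left_commute)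
  finally show ?thesis .
qed

text \<open>The relation \<open>Dz\<close> survives translation because \<open>L\<close> and
  \<open>Li\<close> do not mix parities: one sign serves all terms of the two sums.\<close>

lemma DYl_Zl: "DYl v (Zl w X) = scale (\<kappa> v w) X + scale (sg v w) (Zl w (DYl v X))"
proof -
  have "DYl v (Zl w X) = (\<Sum>b\<in>UNIV. \<Sum>c\<in>UNIV.
      scale (Li (snd v) (fst v) b * L (snd w) c (fst w)) (D b (z c X)))"
    by (simp add: Zl_def DYl_def lin_sum[OF lin_D] lin_scale[OF lin_D] scale_sum_right)
  also have "\<dots> = (\<Sum>b\<in>UNIV. \<Sum>c\<in>UNIV.
      scale (Li (snd v) (fst v) b * L (snd w) c (fst w) * (if b = c then 1 else 0)) X
    + scale (sg v w * (Li (snd v) (fst v) b * L (snd w) c (fst w))) (z c (D b X)))"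
  proof (intro sum.cong refl)
    fix b c
    show "scale (Li (snd v) (fst v) b * L (snd w) c (fst w)) (D b (z c X))
      = scale (Li (snd v) (fst v) b * L (snd w) c (fst w) * (if b = c then 1 else 0)) X
       + scale (sg v w * (Li (snd v) (fst v) b * L (snd w) c (fst w))) (z c (D b X))"
    proof (cases "Li (snd v) (fst v) b = 0 \<or> L (snd w) c (fst w) = 0")
      case False
      then have "ssgn od b c = sg v w" using L_par Li_par unfolding sg_def ssgn_def by metis
      then show ?thesis by (simp add: Dz[of b c] mult.commute scale_right_distrib)
    qed auto
  qed
  also have "\<dots> = (\<Sum>b\<in>UNIV. \<Sum>c\<in>UNIV.
      scale (Li (snd v) (fst v) b * L (snd w) c (fst w) * (if b = c then 1 else 0)) X)
    + (\<Sum>c\<in>UNIV. \<Sum>b\<in>UNIV.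
      scale (sg v w * (Li (snd v) (fst v) b * L (snd w) c (fst w))) (z c (D b X)))"
    by (simp only: sum.distrib) (subst (2) sum.swap, rule refl)
  also have "(\<Sum>b\<in>UNIV. \<Sum>c\<in>UNIV.
      scale (Li (snd v) (fst v) b * L (snd w) c (fst w) * (if b = c then 1 else 0)) X) = scale (\<kappa> v w) X"
    by (simp add: \<kappa>_def scale_sum_left if_distrib if_distribR cong: if_cong)
  also have "(\<Sum>c\<in>UNIV. \<Sum>b\<in>UNIV.
      scale (sg v w * (Li (snd v) (fst v) b * L (snd w) c (fst w))) (z c (D b X)))
     = scale (sg v w) (Zl w (DYl v X))"
    by (simp add: Zl_def DYl_def lin_sum[OF lin_z] lin_scale[OF lin_z] scale_sum_right mult.commute mult.left_commute)
  finally show ?thesis .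
qed

text \<open>\<open>perm\<close> is a super-permanent, computed by iterated signed contraction.\<close>

primrec contr :: "('x \<times> 'g \<Rightarrow> 'x \<times> 'g \<Rightarrow> 'a) \<Rightarrow> 'x \<times> 'g \<Rightarrow> ('x \<times> 'g) list \<Rightarrow> (('x \<times> 'g) list \<Rightarrow> 'a) \<Rightarrow> 'a" where
  "contr k v [] h = 0"
| "contr k v (w # W) h = k v w * h W + sg v w * contr k v W (\<lambda>R. h (w # R))"

primrec perm :: "('x \<times> 'g \<Rightarrow> 'x \<times> 'g \<Rightarrow> 'a) \<Rightarrow> ('x \<times> 'g) list \<Rightarrow> ('x \<times> 'g) list \<Rightarrow> 'a" where
  "perm k [] W = (if W = [] then 1 else 0)"
| "perm k (v # V) W = contr k v W (perm k V)"

text \<open>The functional \<phi> is arbitrary so that the letters already passed by the annihilator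
  can be absorbed into it during the induction.\<close>

lemma contr_DYl:
  "lin scale (*) \<phi> \<Longrightarrow> \<phi> (DYl v (Zw W \<Omega>)) = contr \<kappa> v W (\<lambda>R. \<phi> (Zw R \<Omega>))"
proof (induction W arbitrary: \<phi>)
  case Nil
  then show ?case by (simp add: DYl_def D_vac lin_zero)
next
  case (Cons w W)
  have "\<phi> (DYl v (Zw (w # W) \<Omega>)) = \<kappa> v w * \<phi> (Zw W \<Omega>) + sg v w * \<phi> (Zl w (DYl v (Zw W \<Omega>)))"
    by (simp add: DYl_Zl lin_add[OF Cons.prems] lin_scale[OF Cons.prems])
  also have "\<phi> (Zl w (DYl v (Zw W \<Omega>))) = contr \<kappa> v W (\<lambda>R. \<phi> (Zl w (Zw R \<Omega>)))"
    by (rule Cons.IH) (rule lin_comp[OF lin_Zl Cons.prems])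
  finally show ?case by simp
qed

lemma B_Yl: "B (Yl v X) Y = B X (DYl v Y)"
  by (simp add: Yl_def DYl_def lin_sum[OF B_lin1] lin_sum[OF B_lin2] lin_scale[OF B_lin1]
      lin_scale[OF B_lin2] adj1)

lemma B_vac_Zl: "B \<Omega> (Zl w X) = 0"
  by (simp add: Zl_def lin_sum[OF B_lin2] lin_scale[OF B_lin2] adj2 D_vac lin_zero[OF B_lin1])

text \<open>Wick's theorem: move the letters of \<open>V\<close> to the other side as annihilators
  and push each one through \<open>W\<close> until it reaches the vacuum.\<close>

lemma B_Yw_Zw: "B (Yw V \<Omega>) (Zw W \<Omega>) = perm \<kappa> V W"
proof (induction V arbitrary: W)
  case Nil
  then show ?case by (cases W) (auto simp: B_vac B_vac_Zl)
next
  case (Cons v V)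
  have "B (Yw (v # V) \<Omega>) (Zw W \<Omega>) = B (Yw V \<Omega>) (DYl v (Zw W \<Omega>))"
    by (simp add: B_Yl)
  also have "\<dots> = contr \<kappa> v W (\<lambda>R. B (Yw V \<Omega>) (Zw R \<Omega>))"
    by (rule contr_DYl[OF B_lin2])
  finally show ?case by (simp add: Cons.IH)
qed

lemma contr_cong: "(\<And>R. set R \<subseteq> set W \<Longrightarrow> h R = h' R) \<Longrightarrow> contr k v W h = contr k v W h'"
proof (induction W arbitrary: h h')
  case (Cons w W)
  have "h W = h' W" by (rule Cons.prems) auto
  moreover have "contr k v W (\<lambda>R. h (w # R)) = contr k v W (\<lambda>R. h' (w # R))"
    by (rule Cons.IH) (rule Cons.prems, auto)
  ultimately show ?case by simp
qed auto

text \<open>Contraction is linear in the row of \<kappa> belonging to \<open>v\<close>, and that row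
  is a combination of rows of the identity matrix on \<open>A\<close>. The signs agree since
  \<kappa> vanishes between letters of different parity.\<close>

lemma contr_expand:
  "set W \<subseteq> A \<Longrightarrow> contr \<kappa> v W h = (\<Sum>c\<in>A. \<kappa> v c * contr \<delta> c W h)"
proof (induction W arbitrary: h)
  case (Cons w W)
  have eq: "\<kappa> v c * (sg c w * x) = sg v w * (\<kappa> v c * x)" for c x
    using \<kappa>_par[of v c] by (cases "\<kappa> v c = 0") (auto simp: sg_def ssgn_def)
  have "(\<Sum>c\<in>A. \<kappa> v c * contr \<delta> c (w # W) h) =
    (\<Sum>c\<in>A. \<kappa> v c * (\<delta> c w * h W)) + sg v w * (\<Sum>c\<in>A. \<kappa> v c * contr \<delta> c W (\<lambda>R. h (w # R)))"
    by (simp add: distrib_left sum.distrib eq sum_distrib_left)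
  also have "(\<Sum>c\<in>A. \<kappa> v c * (\<delta> c w * h W)) = (\<Sum>c\<in>A. if c = w then \<kappa> v w * h W else 0)"
    by (rule sum.cong) auto
  also have "\<dots> = \<kappa> v w * h W" using Cons.prems finite_A by (simp add: sum.delta)
  finally show ?case using Cons by simp
qed auto

text \<open>Letters with different labels are translated independently; \<open>pat\<close> is the information on a word
  that survives the expansion of its letters in other letters.\<close>

definition act :: "('l \<Rightarrow> 'g) \<Rightarrow> ('x \<times> 'g) \<times> 'l \<Rightarrow> 'x \<times> 'g" where
  "act \<gamma> v = (fst (fst v), mul (\<gamma> (snd v)) (snd (fst v)))"
definition pat :: "(('x \<times> 'g) \<times> 'l) list \<Rightarrow> (bool \<times> 'l) list" where
  "pat V = map (\<lambda>v. (od (fst (fst v)), snd v)) V"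
definition labelled :: "(('x \<times> 'g) \<times> 'l) list \<Rightarrow> bool" where
  "labelled V \<longleftrightarrow> fst ` set V \<subseteq> A"

text \<open>Multilinear expansion of a word, letter by letter, into permutation letters with the
  same labels.\<close>

primrec lsum :: "(('x \<times> 'g) \<times> 'l) list \<Rightarrow> ((('x \<times> 'g) \<times> 'l) list \<Rightarrow> 'a) \<Rightarrow> 'a" where
  "lsum [] h = h []"
| "lsum (v # V) h = (\<Sum>c\<in>A. \<kappa> (fst v) c * lsum V (\<lambda>C. h ((c, snd v) # C)))"

lemma lsum_add: "lsum V (\<lambda>C. f C + g C) = lsum V f + lsum V g"
  by (induction V arbitrary: f g) (auto simp: sum.distrib distrib_left)
lemma lsum_mult: "lsum V (\<lambda>C. a * g C) = a * lsum V g"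
  by (induction V arbitrary: g) (auto simp: sum_distrib_left mult.left_commute)
lemma lsum_zero: "lsum V (\<lambda>C. 0) = 0"
  by (induction V) auto
lemma lsum_sum: "lsum V (\<lambda>C. \<Sum>i\<in>I. f i C) = (\<Sum>i\<in>I. lsum V (f i))"
  by (induction I rule: infinite_finite_induct) (auto simp: lsum_zero lsum_add)

lemma contr_lsum: "contr k v W (\<lambda>R. lsum V (\<lambda>C. H C R)) = lsum V (\<lambda>C. contr k v W (H C))"
  by (induction W arbitrary: H) (auto simp: lsum_zero lsum_add lsum_mult)

lemma \<kappa>_act: "\<gamma> l \<in> G \<Longrightarrow> v \<in> A \<Longrightarrow> c \<in> A \<Longrightarrow> \<kappa> (act \<gamma> (v, l)) (act \<gamma> (c, l)) = \<kappa> v c"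
  by (auto simp: \<kappa>_def act_def A_def LiL)

lemma bij_act: assumes "\<gamma> l \<in> G" shows "bij_betw (\<lambda>c. act \<gamma> (c, l)) A A"
proof -
  have "inj_on (\<lambda>c. act \<gamma> (c, l)) A"
    using inj_mul[OF assms] by (auto simp: inj_on_def act_def A_def)
  moreover have "(\<lambda>c. act \<gamma> (c, l)) ` A \<subseteq> A" using mul_G[OF assms] by (auto simp: act_def A_def)
  ultimately show ?thesis unfolding bij_betw_def using finite_A by (simp add: endo_inj_surj)
qed

text \<open>Translation by \<gamma> permutes \<open>A\<close> and preserves \<kappa>. Reindexing the
  expansion of a translated letter therefore moves \<gamma> out of the coefficients and into the
  words \<open>C\<close>.\<close>

lemma perm_expand:
  assumes "\<And>l. \<gamma> l \<in> G"
  shows "labelled V \<Longrightarrow> set W \<subseteq> A \<Longrightarrow>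
    perm \<kappa> (map (act \<gamma>) V) W = lsum V (\<lambda>C. perm \<delta> (map (act \<gamma>) C) W)"
proof (induction V arbitrary: W)
  case (Cons v V)
  have v: "fst v \<in> A" "labelled V" using Cons.prems by (auto simp: labelled_def)
  have "perm \<kappa> (map (act \<gamma>) (v # V)) W = contr \<kappa> (act \<gamma> v) W (perm \<kappa> (map (act \<gamma>) V))"
    by simp
  also have "\<dots> = contr \<kappa> (act \<gamma> v) W (\<lambda>R. lsum V (\<lambda>C. perm \<delta> (map (act \<gamma>) C) R))"
    by (rule contr_cong) (use Cons v in auto)
  also have "\<dots> = lsum V (\<lambda>C. contr \<kappa> (act \<gamma> v) W (perm \<delta> (map (act \<gamma>) C)))"
    by (rule contr_lsum)
  also have "\<dots> = lsum V (\<lambda>C. \<Sum>c\<in>A. \<kappa> (fst v) c * contr \<delta> (act \<gamma> (c, snd v)) W (perm \<delta> (map (act \<gamma>) C)))"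
  proof (rule arg_cong[where f = "lsum V"], rule ext)
    fix C
    let ?h = "\<lambda>c. contr \<delta> c W (perm \<delta> (map (act \<gamma>) C))"
    have "contr \<kappa> (act \<gamma> v) W (perm \<delta> (map (act \<gamma>) C)) = (\<Sum>c\<in>A. \<kappa> (act \<gamma> v) c * ?h c)"
      by (rule contr_expand[OF Cons.prems(2)])
    also have "\<dots> = (\<Sum>c\<in>A. \<kappa> (act \<gamma> (fst v, snd v)) (act \<gamma> (c, snd v)) * ?h (act \<gamma> (c, snd v)))"
      by (subst sum.reindex_bij_betw[OF bij_act[of \<gamma> "snd v", OF assms], symmetric]) simp
    also have "\<dots> = (\<Sum>c\<in>A. \<kappa> (fst v) c * ?h (act \<gamma> (c, snd v)))"
      by (intro sum.cong refl) (simp only: \<kappa>_act assms v)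
    finally show "contr \<kappa> (act \<gamma> v) W (perm \<delta> (map (act \<gamma>) C))
      = (\<Sum>c\<in>A. \<kappa> (fst v) c * ?h (act \<gamma> (c, snd v)))" .
  qed
  also have "\<dots> = lsum (v # V) (\<lambda>C. perm \<delta> (map (act \<gamma>) C) W)"
    by (simp add: lsum_sum lsum_mult)
  finally show ?case .
qed auto

text \<open>Only words with the pattern of \<open>V\<close> occur with nonzero coefficient: labels
  are copied and \<kappa> respects parity.\<close>

lemma lsum_in_span:
  "(\<And>C. labelled C \<Longrightarrow> pat C = pat V \<Longrightarrow> H C \<in> fs.span S) \<Longrightarrow> labelled V \<Longrightarrow>
    (\<lambda>W::'w. lsum V (\<lambda>C. H C W)) \<in> fs.span S"
proof (induction V arbitrary: H)
  case Nil
  then show ?case by (simp add: labelled_def)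
next
  case (Cons v V)
  have "(\<lambda>W. \<kappa> (fst v) c * lsum V (\<lambda>C. H ((c, snd v) # C) W)) \<in> fs.span S" if "c \<in> A" for c
  proof (cases "\<kappa> (fst v) c = 0")
    case True
    have "(\<lambda>W. 0) \<in> fs.span S" using fs.span_zero[of S] by (simp add: zero_fun_def)
    then show ?thesis using True by simp
  next
    case False
    then have "od (fst c) = od (fst (fst v))" using \<kappa>_par by metis
    then show ?thesis using that Cons.prems
      by (intro fs.span_scale Cons.IH) (auto simp: labelled_def pat_def)
  qed
  then have "(\<Sum>c\<in>A. (\<lambda>W. \<kappa> (fst v) c * lsum V (\<lambda>C. H ((c, snd v) # C) W))) \<in> fs.span S"
    by (rule fs.span_sum)
  moreover have "(\<Sum>c\<in>A. (\<lambda>W. \<kappa> (fst v) c * lsum V (\<lambda>C. H ((c, snd v) # C) W)))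
     = (\<lambda>W. lsum (v # V) (\<lambda>C. H C W))"
    by (rule ext) (simp add: sum_fun_apply)
  ultimately show ?case by simp
qed

section \<open>Summation over all words of permutation letters\<close>

primrec wsum :: "nat \<Rightarrow> (('x \<times> 'g) list \<Rightarrow> 'a) \<Rightarrow> 'a" where
  "wsum 0 h = h []"
| "wsum (Suc n) h = (\<Sum>c\<in>A. wsum n (\<lambda>W. h (c # W)))"

lemma wsum_add: "wsum n (\<lambda>W. f W + g W) = wsum n f + wsum n g"
  by (induction n arbitrary: f g) (auto simp: sum.distrib)
lemma wsum_mult: "wsum n (\<lambda>W. a * g W) = a * wsum n g"
  by (induction n arbitrary: g) (auto simp: sum_distrib_left)
lemma wsum_eq: "wsum n h = (\<Sum>W | set W \<subseteq> A \<and> length W = n. h W)"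
proof (induction n arbitrary: h)
  case 0
  have "{W. set W \<subseteq> A \<and> length W = 0} = {[]}" by auto
  then show ?case by simp
next
  case (Suc n)
  have eq: "{W. set W \<subseteq> A \<and> length W = Suc n} =
      (\<lambda>(c, W). c # W) ` (A \<times> {W. set W \<subseteq> A \<and> length W = n})"
    by (auto simp: length_Suc_conv image_iff)
  have "inj_on (\<lambda>(c, W). c # W) (A \<times> {W. set W \<subseteq> A \<and> length W = n})"
    by (auto simp: inj_on_def)
  then show ?case unfolding eq
    by (simp add: sum.reindex Suc sum.cartesian_product case_prod_unfold)
qed

text \<open>The letter \<open>a\<close> may be met at any of the \<open>Suc n\<close> places of
  \<open>W\<close>. Bringing it to the front of the operator word costs exactly the sign recorded by
  \<open>contr\<close>, so all places give equal sums.\<close>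

lemma wsum_contr:
  "lin scale (*) \<phi> \<Longrightarrow> a \<in> A \<Longrightarrow> wsum (Suc n) (\<lambda>W. contr \<delta> a W h * \<phi> (Zw W \<Omega>))
    = of_nat (Suc n) * wsum n (\<lambda>W. h W * \<phi> (Zl a (Zw W \<Omega>)))"
proof (induction n arbitrary: h \<phi>)
  case 0
  have "wsum (Suc 0) (\<lambda>W. contr \<delta> a W h * \<phi> (Zw W \<Omega>)) = (\<Sum>c\<in>A. if c = a then h [] * \<phi> (Zl a \<Omega>) else 0)"
    by (auto intro!: sum.cong)
  then show ?case using 0 finite_A by (simp add: sum.delta)
next
  case (Suc n)
  note lin = Suc.prems(1)
  have eq: "wsum (Suc n) (\<lambda>W. contr \<delta> a (c # W) h * \<phi> (Zw (c # W) \<Omega>))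
     = (if c = a then wsum (Suc n) (\<lambda>W. h W * \<phi> (Zl a (Zw W \<Omega>))) else 0)
     + of_nat (Suc n) * wsum n (\<lambda>W. h (c # W) * \<phi> (Zl a (Zw (c # W) \<Omega>)))" for c
  proof -
    have "wsum (Suc n) (\<lambda>W. contr \<delta> a (c # W) h * \<phi> (Zw (c # W) \<Omega>))
     = wsum (Suc n) (\<lambda>W. (if c = a then 1 else 0) * (h W * \<phi> (Zl a (Zw W \<Omega>)))
       + sg a c * (contr \<delta> a W (\<lambda>R. h (c # R)) * \<phi> (Zl c (Zw W \<Omega>))))"
      by (rule arg_cong[where f = "wsum (Suc n)"], rule ext) (auto simp: algebra_simps)
    also have "\<dots> = (if c = a then wsum (Suc n) (\<lambda>W. h W * \<phi> (Zl a (Zw W \<Omega>))) else 0)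
       + sg a c * wsum (Suc n) (\<lambda>W. contr \<delta> a W (\<lambda>R. h (c # R)) * \<phi> (Zl c (Zw W \<Omega>)))"
      unfolding wsum_add wsum_mult by simp
    also have "wsum (Suc n) (\<lambda>W. contr \<delta> a W (\<lambda>R. h (c # R)) * \<phi> (Zl c (Zw W \<Omega>)))
       = of_nat (Suc n) * wsum n (\<lambda>W. h (c # W) * \<phi> (Zl c (Zl a (Zw W \<Omega>))))"
      by (rule Suc.IH[OF lin_comp[OF lin_Zl lin] Suc.prems(2)])
    also have "sg a c * (of_nat (Suc n) * wsum n (\<lambda>W. h (c # W) * \<phi> (Zl c (Zl a (Zw W \<Omega>)))))
      = of_nat (Suc n) * wsum n (\<lambda>W. h (c # W) * \<phi> (Zl a (Zw (c # W) \<Omega>)))"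
      by (simp add: Zl_Zl[of a c] lin_scale[OF lin] wsum_mult[symmetric] mult.left_commute)
    finally show ?thesis .
  qed
  have "wsum (Suc (Suc n)) (\<lambda>W. contr \<delta> a W h * \<phi> (Zw W \<Omega>))
    = (\<Sum>c\<in>A. wsum (Suc n) (\<lambda>W. contr \<delta> a (c # W) h * \<phi> (Zw (c # W) \<Omega>)))"
    by (simp only: wsum.simps)
  also have "\<dots> = wsum (Suc n) (\<lambda>W. h W * \<phi> (Zl a (Zw W \<Omega>)))
      + of_nat (Suc n) * wsum (Suc n) (\<lambda>W. h W * \<phi> (Zl a (Zw W \<Omega>)))"
    unfolding eq sum.distrib sum_distrib_left[symmetric] using finite_A Suc.prems(2)
    by (simp add: sum.delta)
  finally show ?case by (simp add: algebra_simps)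
qed

text \<open>For the standard pairing only rearrangements of \<open>C\<close> have a nonzero
  super-permanent, and supercommutation turns each of the matchings back into \<open>C\<close>. So
  pairing with \<open>perm \<delta> C\<close> is evaluation at \<open>C\<close> up to a
  factorial.\<close>

lemma wsum_perm:
  "lin scale (*) \<phi> \<Longrightarrow> set C \<subseteq> A \<Longrightarrow>
    wsum (length C) (\<lambda>W. perm \<delta> C W * \<phi> (Zw W \<Omega>)) = fact (length C) * \<phi> (Zw C \<Omega>)"
proof (induction C arbitrary: \<phi>)
  case (Cons a C)
  have "wsum (length (a # C)) (\<lambda>W. perm \<delta> (a # C) W * \<phi> (Zw W \<Omega>))
    = of_nat (Suc (length C)) * wsum (length C) (\<lambda>W. perm \<delta> C W * \<phi> (Zl a (Zw W \<Omega>)))"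
    using wsum_contr[OF Cons.prems(1), of a "length C" "perm \<delta> C"] Cons.prems(2) by simp
  also have "\<dots> = of_nat (Suc (length C)) * (fact (length C) * \<phi> (Zl a (Zw C \<Omega>)))"
    by (subst Cons.IH) (use Cons.prems lin_comp[OF lin_Zl Cons.prems(1)] in auto)
  finally show ?case by (simp add: algebra_simps)
qed auto

lemma contr_length: "(\<And>R. Suc (length R) = length W \<Longrightarrow> h R = 0) \<Longrightarrow> contr k v W h = 0"
  by (induction W arbitrary: h) auto

lemma perm_length: "length V \<noteq> length W \<Longrightarrow> perm k V W = 0"
proof (induction V arbitrary: W)
  case (Cons v V)
  then show ?case by (auto intro!: contr_length)
qed auto

lemma contr_Rats: "(\<And>R. h R \<in> \<rat>) \<Longrightarrow> contr \<delta> v W h \<in> \<rat>"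
  by (induction W arbitrary: h) (auto simp: sg_def ssgn_def intro!: Rats_add Rats_mult)

lemma perm_Rats: "perm \<delta> V W \<in> \<rat>"
  by (induction V arbitrary: W) (auto intro: contr_Rats)

lemma sum_perm_words:
  assumes "set C \<subseteq> A"
  shows "(\<Sum>W | set W \<subseteq> A \<and> length W \<le> N. B f (Zw W \<Omega>) * perm \<delta> C W) =
    (if length C \<le> N then fact (length C) * B f (Zw C \<Omega>) else 0)"
proof (cases "length C \<le> N")
  case True
  have "(\<Sum>W | set W \<subseteq> A \<and> length W \<le> N. B f (Zw W \<Omega>) * perm \<delta> C W)
    = (\<Sum>W | set W \<subseteq> A \<and> length W = length C. B f (Zw W \<Omega>) * perm \<delta> C W)"
    by (rule sum.mono_neutral_right[OF finite_lists_length_le[OF finite_A]])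
      (use True in auto, metis perm_length)
  also have "\<dots> = wsum (length C) (\<lambda>W. perm \<delta> C W * B f (Zw W \<Omega>))"
    by (simp add: wsum_eq mult.commute)
  also have "\<dots> = fact (length C) * B f (Zw C \<Omega>)"
    by (rule wsum_perm[OF B_lin2 assms])
  finally show ?thesis using True by simp
next
  case False
  then have "(\<Sum>W | set W \<subseteq> A \<and> length W \<le> N. B f (Zw W \<Omega>) * perm \<delta> C W) = 0"
    by (intro sum.neutral) (auto simp: perm_length)
  then show ?thesis using False by simp
qed

text \<open>The letter (a, g) expands into the letters (c, g k) with coefficients that do not depend
  on g. Hence the left half of the pairing with f is a combination of the rational
  super-permanents summed over \<open>\<Gamma>\<close>, and f is orthogonal to each of these.\<close>

theorem orthogonal_to_dual_family:
  fixes \<Gamma> :: "('l \<Rightarrow> 'g) set" and P :: "(bool \<times> 'l) list set"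
  assumes \<Gamma>: "finite \<Gamma>" "\<Gamma> \<noteq> {}" "\<And>\<gamma> l. \<gamma> \<in> \<Gamma> \<Longrightarrow> \<gamma> l \<in> G"
    and F: "F \<in> module.span (\<lambda>c F \<gamma>. scale c (F \<gamma>))
      {\<lambda>\<gamma>. Yw (map (act \<gamma>) V) \<Omega> | V. labelled V \<and> pat V \<in> P}"
    and f: "\<And>\<gamma>. \<gamma> \<in> \<Gamma> \<Longrightarrow> F \<gamma> = f"
    and orth: "\<And>C. labelled C \<Longrightarrow> pat C \<in> P \<Longrightarrow> (\<Sum>\<gamma>\<in>\<Gamma>. B f (Zw (map (act \<gamma>) C) \<Omega>)) = 0"
    and W: "set W \<subseteq> A"
  shows "B f (Zw W \<Omega>) = 0"
proof -
  interpret ft: vector_space "\<lambda>c (F :: ('l \<Rightarrow> 'g) \<Rightarrow> 't) \<gamma>. scale c (F \<gamma>)"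
    by (rule vector_space_fun) (rule vector_space_axioms)
  define q where "q C W = (\<Sum>\<gamma>\<in>\<Gamma>. perm \<delta> (map (act \<gamma>) C) W)" for C W
  define Q where "Q = {q C | C. labelled C \<and> pat C \<in> P}"
  have "\<exists>\<psi>\<in>fs.span Q. \<forall>W. set W \<subseteq> A \<longrightarrow> (\<Sum>\<gamma>\<in>\<Gamma>. B (F \<gamma>) (Zw W \<Omega>)) = \<psi> W"
    using F
  proof (induction rule: ft.span_induct_alt)
    case base
    show ?case by (intro bexI[of _ 0]) (auto simp: fs.span_zero lin_zero[OF B_lin1])
  next
    case (step c x y)
    then obtain V where V: "x = (\<lambda>\<gamma>. Yw (map (act \<gamma>) V) \<Omega>)" "labelled V" "pat V \<in> P" by blast
    from step.IH obtain \<psi> where psi: "\<psi> \<in> fs.span Q"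
      "\<And>W. set W \<subseteq> A \<Longrightarrow> (\<Sum>\<gamma>\<in>\<Gamma>. B (y \<gamma>) (Zw W \<Omega>)) = \<psi> W" by blast
    define \<theta> where "\<theta> = (\<lambda>W. lsum V (\<lambda>C. q C W))"
    have "\<theta> \<in> fs.span Q" unfolding \<theta>_def
      by (rule lsum_in_span) (use V in \<open>auto simp: Q_def intro!: fs.span_base\<close>)
    then have in_span: "(\<lambda>W. c * \<theta> W) + \<psi> \<in> fs.span Q"
      by (intro fs.span_add psi fs.span_scale)
    have "(\<Sum>\<gamma>\<in>\<Gamma>. B (x \<gamma>) (Zw W \<Omega>)) = \<theta> W" if "set W \<subseteq> A" for W
    proof -
      have "(\<Sum>\<gamma>\<in>\<Gamma>. B (x \<gamma>) (Zw W \<Omega>)) = (\<Sum>\<gamma>\<in>\<Gamma>. lsum V (\<lambda>C. perm \<delta> (map (act \<gamma>) C) W))"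
        unfolding V(1) B_Yw_Zw by (intro sum.cong refl perm_expand V(2) that \<Gamma>(3))
      then show ?thesis by (simp add: \<theta>_def q_def lsum_sum)
    qed
    then have "\<forall>W. set W \<subseteq> A \<longrightarrow>
        (\<Sum>\<gamma>\<in>\<Gamma>. B (((\<lambda>\<gamma>. scale c (x \<gamma>)) + y) \<gamma>) (Zw W \<Omega>)) = ((\<lambda>W. c * \<theta> W) + \<psi>) W"
      using psi(2) by (simp add: lin_add[OF B_lin1] lin_scale[OF B_lin1] sum.distrib sum_distrib_left[symmetric])
    then show ?case using in_span by blast
  qed
  then obtain \<psi> where psi: "\<psi> \<in> fs.span Q"
    "\<And>W. set W \<subseteq> A \<Longrightarrow> of_nat (card \<Gamma>) * B f (Zw W \<Omega>) = \<psi> W"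
    by (auto simp: f)
  obtain T r where T: "finite T" "T \<subseteq> Q" "\<psi> = (\<Sum>a\<in>T. (\<lambda>W. r a * a W))"
    using psi(1) unfolding fs.span_explicit by blast
  obtain qs where qs: "set qs = T" using finite_list[OF T(1)] by blast
  \<comment> \<open>A finite set of words containing \<open>W\<close>. Cutting off longer words is
    harmless: a longer \<open>C\<close> has super-permanent 0 on the whole set.\<close>
  let ?X = "{V. set V \<subseteq> A \<and> length V \<le> length W}"
  have "\<forall>x\<in>?X. \<psi> x = 0"
  proof (rule orthogonal_rational_span[of ?X qs])
    show "finite ?X" by (rule finite_lists_length_le[OF finite_A])
    show "\<forall>q\<in>set qs. \<forall>x\<in>?X. q x \<in> \<rat>"
      using T(2) unfolding qs Q_def q_def by (auto intro!: Rats_sum perm_Rats)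
    show "\<psi> \<in> fs.span (set qs)" unfolding T(3) qs
      by (intro fs.span_sum fs.span_scale fs.span_base)
    show "\<forall>q\<in>set qs. (\<Sum>x\<in>?X. \<psi> x * q x) = 0"
    proof
      fix q' assume "q' \<in> set qs"
      then obtain C where C: "q' = q C" "labelled C" "pat C \<in> P" using T(2) qs by (auto simp: Q_def)
      have inA: "set (map (act \<gamma>) C) \<subseteq> A" if "\<gamma> \<in> \<Gamma>" for \<gamma>
      proof
        fix w assume "w \<in> set (map (act \<gamma>) C)"
        then obtain v where "v \<in> set C" "w = act \<gamma> v" by auto
        moreover from this C(2) have "fst v \<in> A" by (auto simp: labelled_def)
        ultimately show "w \<in> A" using mul_G[OF \<Gamma>(3)[OF that]] by (cases v) (auto simp: act_def A_def)
      qed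
      have "(\<Sum>x\<in>?X. \<psi> x * q' x) = of_nat (card \<Gamma>) * (\<Sum>x\<in>?X. \<Sum>\<gamma>\<in>\<Gamma>. B f (Zw x \<Omega>) * perm \<delta> (map (act \<gamma>) C) x)"
        unfolding sum_distrib_left C(1) q_def
        by (intro sum.cong refl) (simp add: psi(2)[symmetric] mult.assoc)
      also have "\<dots> = of_nat (card \<Gamma>) * (\<Sum>\<gamma>\<in>\<Gamma>. \<Sum>x\<in>?X. B f (Zw x \<Omega>) * perm \<delta> (map (act \<gamma>) C) x)"
        by (subst sum.swap) simp
      \<comment> \<open>Translation preserves the length of \<open>C\<close>, so the factorial is
        common to all \<gamma> and \<open>orth\<close> applies to what remains.\<close>
      also have "(\<Sum>\<gamma>\<in>\<Gamma>. \<Sum>x\<in>?X. B f (Zw x \<Omega>) * perm \<delta> (map (act \<gamma>) C) x)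
        = (\<Sum>\<gamma>\<in>\<Gamma>. (if length C \<le> length W then fact (length C) else 0) * B f (Zw (map (act \<gamma>) C) \<Omega>))"
        by (rule sum.cong[OF refl]) (subst sum_perm_words[OF inA], auto)
      also have "\<dots> = 0" unfolding sum_distrib_left[symmetric] by (simp add: orth C)
      finally show "(\<Sum>x\<in>?X. \<psi> x * q' x) = 0" by simp
    qed
  qed
  then have "of_nat (card \<Gamma>) * B f (Zw W \<Omega>) = 0" using psi(2)[OF W] W by simp
  then show ?thesis using \<Gamma>(1,2) by simp
qed

end

subsection \<open>Polynomials, differential operators and the pairing\<close>

abbreviation "lookup \<equiv> Poly_Mapping.lookup"
abbreviation "keys \<equiv> Poly_Mapping.keys"
abbreviation "single \<equiv> Poly_Mapping.single"

lemma pconst_0 [simp]: "pconst 0 = 0" and pconst_1 [simp]: "pconst 1 = 1"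
  and pconst_add: "pconst (a + b) = pconst a + pconst b"
  and pconst_mult: "pconst (a * b) = pconst a * pconst b"
  and pconst_minus: "pconst (- a) = - pconst a"
  by (auto simp: pconst_def single_add mult_single single_uminus)

lemma pconst_sum: "pconst (sum f A) = (\<Sum>i\<in>A. pconst (f i))"
  by (induction A rule: infinite_finite_induct) (auto simp: pconst_add)

lemma pol_sum_single: "f = (\<Sum>m\<in>keys f. single m (lookup f m))"
  for f :: "'k \<Rightarrow>\<^sub>0 'b::comm_monoid_add"
  by (rule poly_mapping_eqI)
    (auto simp: lookup_sum lookup_single when_def in_keys_iff sum.delta)

lemma pol_monom_induct [case_names monom add]:
  fixes f :: "'k \<Rightarrow>\<^sub>0 'b::comm_monoid_add"
  assumes "\<And>m c. P (single m c)" "\<And>f g. P f \<Longrightarrow> P g \<Longrightarrow> P (f + g)"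
  shows "P f"
proof -
  have "P 0" using assms(1)[of _ 0] by simp
  have "P (\<Sum>m\<in>A. single m (lookup f m))" if "finite A" for A
    using that by (induction A rule: finite_induct) (auto intro: assms \<open>P 0\<close>)
  then show ?thesis by (subst pol_sum_single) simp
qed

lemma monom_split:
  "lookup m i > 0 \<Longrightarrow> m = single i 1 + (m - single i 1)"
  for m :: "'n \<Rightarrow>\<^sub>0 nat"
  by (rule poly_mapping_eqI) (auto simp: lookup_add lookup_minus lookup_single when_def)

lemma mdeg_add: "mdeg (a + b) = mdeg a + mdeg b"
  by (simp add: mdeg_def lookup_add sum.distrib)

lemma mdeg_single [simp]: "mdeg (single i k) = k"
  by (simp add: mdeg_def lookup_single when_def)

lemma mdeg_0 [simp]: "mdeg 0 = 0"
  by (simp add: mdeg_def)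

lemma mdeg_eq_0: "mdeg m = 0 \<longleftrightarrow> m = 0"
  by (auto simp: mdeg_def intro: poly_mapping_eqI)

text \<open>Reduces the multiplicative identities below to constants and to multiplication by a
  single variable.\<close>

lemma pol_induct [case_names const add var]:
  fixes f :: "('n::finite, 'a::comm_ring_1) pol"
  assumes "\<And>c. P (pconst c)" "\<And>f g. P f \<Longrightarrow> P g \<Longrightarrow> P (f + g)" "\<And>i f. P f \<Longrightarrow> P (pvar i * f)"
  shows "P f"
proof (induction f rule: pol_monom_induct)
  case (monom m c)
  then show ?case
  proof (induction "mdeg m" arbitrary: m)
    case 0
    then show ?case using assms(1)[of c] by (simp add: mdeg_eq_0 pconst_def)
  next
    case (Suc k)
    have "\<exists>i. lookup m i > 0" by (rule ccontr) (use Suc.hyps(2) in \<open>simp add: mdeg_def\<close>)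
    then obtain i where i: "lookup m i > 0" ..
    then have eq: "m = single i 1 + (m - single i 1)" by (rule monom_split)
    then have "mdeg m = 1 + mdeg (m - single i 1)" by (metis mdeg_add mdeg_single)
    then have "P (single (m - single i 1) c)" using Suc by simp
    then have "P (pvar i * single (m - single i 1) c)" by (rule assms(3))
    then show ?case using eq by (simp add: pvar_def mult_single)
  qed
qed (rule assms(2))

lemma keys_sum_add:
  fixes f g :: "'k \<Rightarrow>\<^sub>0 'b::comm_ring_1" and h :: "'k \<Rightarrow> 'b \<Rightarrow> 'c::comm_monoid_add"
  assumes "\<And>k. h k 0 = 0" "\<And>k a b. h k (a + b) = h k a + h k b"
  shows "(\<Sum>k\<in>keys (f + g). h k (lookup (f + g) k)) =
    (\<Sum>k\<in>keys f. h k (lookup f k)) + (\<Sum>k\<in>keys g. h k (lookup g k))"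
  by (rule setsum_keys_plus_distrib[of h]) (simp_all add: assms)

lemma psubst_add: "psubst \<sigma> (f + g) = psubst \<sigma> f + psubst \<sigma> g"
  unfolding psubst_def by (rule keys_sum_add) (auto simp: pconst_add algebra_simps)

lemma psubst_single: "psubst \<sigma> (single m c) = pconst c * (\<Prod>i\<in>UNIV. \<sigma> i ^ lookup m i)"
  by (cases "c = 0") (auto simp: psubst_def)

lemma psubst_pvar_mult:
  fixes \<sigma> :: "'n::finite \<Rightarrow> ('n, 'a::comm_ring_1) pol"
  shows "psubst \<sigma> (pvar j * f) = \<sigma> j * psubst \<sigma> f"
proof (induction f rule: pol_monom_induct)
  case (monom m c)
  have "(\<Prod>i\<in>UNIV. \<sigma> i ^ lookup (single j 1 :: 'n \<Rightarrow>\<^sub>0 nat) i) = (\<Prod>i\<in>UNIV. if i = j then \<sigma> j else 1)"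
    by (rule prod.cong) (auto simp: lookup_single when_def)
  then have "(\<Prod>i\<in>UNIV. \<sigma> i ^ lookup (single j 1 :: 'n \<Rightarrow>\<^sub>0 nat) i) = \<sigma> j"
    by simp
  then show ?case
    by (simp add: pvar_def mult_single psubst_single lookup_add power_add prod.distrib mult_ac)
qed (auto simp: distrib_left psubst_add)

lemma psubst_pconst [simp]: "psubst \<sigma> (pconst c) = pconst c"
  using psubst_single[of \<sigma> 0 c] by (simp add: pconst_def)

lemma psubst_zero [simp]: "psubst \<sigma> 0 = 0"
  using psubst_pconst[of \<sigma> 0] by simp

lemma psubst_one [simp]: "psubst \<sigma> 1 = 1"
  using psubst_pconst[of \<sigma> 1] by simp

lemma pconst_mult_single: "pconst c * single m d = single m (c * d)"
  by (simp add: pconst_def mult_single)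

lemma psubst_pconst_mult: "psubst \<sigma> (pconst c * f) = pconst c * psubst \<sigma> f"
  by (induction f rule: pol_monom_induct)
    (auto simp: pconst_mult_single psubst_single pconst_mult mult_ac distrib_left psubst_add)

lemma psubst_mult: "psubst \<sigma> (f * g) = psubst \<sigma> f * psubst \<sigma> g"
  by (induction f rule: pol_induct)
    (auto simp: psubst_pconst_mult distrib_right psubst_add mult.assoc psubst_pvar_mult)

lemma psubst_pvar [simp]: "psubst \<sigma> (pvar j) = \<sigma> j"
  using psubst_pvar_mult[of \<sigma> j 1] by simp

lemma pderiv_var_add: "pderiv_var i (f + g) = pderiv_var i f + pderiv_var i g"
  unfolding pderiv_var_def by (rule keys_sum_add) (auto simp: single_add algebra_simps)

lemma pderiv_var_single:
  "pderiv_var i (single m c) = single (m - single i 1) (of_nat (lookup m i) * c)"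
  by (cases "c = 0") (auto simp: pderiv_var_def)

lemma pderiv_var_pconst [simp]: "pderiv_var i (pconst c) = 0"
  by (simp add: pconst_def pderiv_var_single)

lemma pderiv_var_pconst_mult: "pderiv_var i (pconst c * f) = pconst c * pderiv_var i f"
  by (induction f rule: pol_monom_induct)
    (auto simp: pconst_mult_single pderiv_var_single mult_ac distrib_left pderiv_var_add)

lemma pderiv_var_pvar_mult:
  "pderiv_var i (pvar j * f) = (if i = j then f else 0) + pvar j * pderiv_var i f"
proof (induction f rule: pol_monom_induct)
  case (monom m c)
  show ?case
  proof (cases "i = j")
    case True
    have "single j (Suc 0) + m - single j (Suc 0) = m" by simp
    moreover have "lookup m j > 0 \<Longrightarrow> single j (Suc 0) + (m - single j (Suc 0)) = m"
      using monom_split[of m j] by simp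
    ultimately show ?thesis using True
      by (cases "lookup m j = 0")
        (auto simp: pvar_def mult_single pderiv_var_single lookup_add single_add[symmetric] algebra_simps)
  next
    case False
    then have "lookup m i > 0 \<Longrightarrow> single j (Suc 0) + m - single i (Suc 0) = single j (Suc 0) + (m - single i (Suc 0))"
      by (intro poly_mapping_eqI) (auto simp: lookup_add lookup_minus lookup_single when_def)
    then show ?thesis using False
      by (cases "lookup m i = 0")
        (auto simp: pvar_def mult_single pderiv_var_single lookup_add lookup_single)
  qed
qed (auto simp: distrib_left pderiv_var_add)

lemma pderiv_var_zero [simp]: "pderiv_var i 0 = 0"
  using pderiv_var_pconst[of i 0] by simp

lemma pderiv_var_commute:
  fixes f :: "('n::finite, 'a::comm_ring_1) pol"
  shows "pderiv_var i (pderiv_var j f) = pderiv_var j (pderiv_var i f)"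
  by (induction f rule: pol_induct) (auto simp: pderiv_var_add pderiv_var_pvar_mult)

lemma dmon_add_single: "dmon (single j 1 + m) f = pderiv_var j (dmon m f)"
proof -
  let ?F = "\<lambda>m. foldr (\<lambda>i h. (pderiv_var i ^^ lookup m i) \<circ> h)"
  have pw: "(pderiv_var i ^^ k) (pderiv_var j g) = pderiv_var j ((pderiv_var i ^^ k) g)" for i k and g :: "('a, 'b) pol"
    by (induction k) (auto simp: pderiv_var_commute[of i j])
  have "?F (single j 1 + m) xs id f = (if j \<in> set xs then pderiv_var j (?F m xs id f) else ?F m xs id f)"
    if "distinct xs" for xs
    using that by (induction xs) (auto simp: lookup_add lookup_single when_def pw)
  from this[of "sorted_list_of_set UNIV"] show ?thesis by (simp add: dmon_def)
qed

lemma dmon_0 [simp]: "dmon 0 f = f"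
proof -
  have "foldr (\<lambda>i h. (pderiv_var i ^^ lookup 0 i) \<circ> h) xs id f = f" for xs
    by (induction xs) auto
  then show ?thesis by (simp add: dmon_def)
qed

section \<open>Differential operators with constant coefficients\<close>

lemma dop_add: "dop (s + t) f = dop s f + dop t f"
  unfolding dop_def by (rule keys_sum_add) (auto simp: pconst_add algebra_simps)

lemma dop_single: "dop (single m c) f = pconst c * dmon m f"
  by (cases "c = 0") (auto simp: dop_def)

lemma dop_pconst: "dop (pconst c) f = pconst c * f"
  by (simp add: pconst_def dop_single)

lemma dop_pvar_mult: "dop (pvar i * s) f = pderiv_var i (dop s f)"
proof (induction s rule: pol_monom_induct)
  case (monom m c)
  show ?case by (simp add: pvar_def mult_single dop_single dmon_add_single[of i, simplified] pderiv_var_pconst_mult)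
qed (auto simp: distrib_left dop_add pderiv_var_add)

lemma dop_zero [simp]: "dop 0 f = 0"
  using dop_pconst[of 0 f] by simp

lemma dop_pconst_mult: "dop (pconst c * s) f = pconst c * dop s f"
  by (induction s rule: pol_monom_induct)
    (auto simp: pconst_mult_single dop_single pconst_mult mult_ac distrib_left dop_add)

lemma dop_mult: "dop (s * t) f = dop s (dop t f)"
  by (induction s rule: pol_induct)
    (auto simp: dop_pconst dop_pconst_mult distrib_right dop_add mult.assoc dop_pvar_mult)

lemma dop_add_right: "dop s (f + g) = dop s f + dop s g"
  by (induction s rule: pol_induct)
    (auto simp: dop_pconst dop_add dop_pvar_mult pderiv_var_add distrib_left add_ac)

lemma dop_pconst_mult_right: "dop s (pconst c * f) = pconst c * dop s f"
  by (induction s rule: pol_induct)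
    (auto simp: dop_pconst dop_add dop_pvar_mult pderiv_var_pconst_mult distrib_left mult.left_commute)

lemma dop_pvar: "dop (pvar i) f = pderiv_var i f"
  using dop_pvar_mult[of i 1 f] dop_pconst[of 1 f] by simp

text \<open>A permutation of \<open>insert a S\<close> is a permutation of \<open>S\<close> followed
  by the transposition of \<open>a\<close> with its image \<open>b\<close>. It preserves
  \<open>f\<close> iff the first one does and \<open>b\<close> lies in the fibre of
  \<open>a\<close>, so adjoining \<open>a\<close> multiplies the count by the new size of that
  fibre.\<close>

lemma card_permutes_fibers:
  assumes "finite X" "finite T" "f ` X \<subseteq> T"
  shows "card {\<sigma>. \<sigma> permutes X \<and> (\<forall>x\<in>X. f (\<sigma> x) = f x)} = (\<Prod>v\<in>T. fact (card {x\<in>X. f x = v}))"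
  using assms(1,3)
proof (induction X rule: finite_induct)
  case empty
  have "{\<sigma>. \<sigma> permutes {} \<and> (\<forall>x\<in>{}. f (\<sigma> x) = f x)} = {id}" by auto
  then show ?case by simp
next
  case (insert a S)
  let ?P = "\<lambda>X. {\<sigma>. \<sigma> permutes X \<and> (\<forall>x\<in>X. f (\<sigma> x) = f x)}"
  let ?b = "{b \<in> insert a S. f b = f a}"
  have tr: "f (Transposition.transpose a b x) = f x" if "f b = f a" for b x
    using that by (auto simp: Transposition.transpose_def)
  have eq: "?P (insert a S) = (\<lambda>(b, p). Transposition.transpose a b \<circ> p) ` (?b \<times> ?P S)" (is "?l = ?r")
  proof
    show "?l \<subseteq> ?r"
    proof
      fix \<sigma> assume \<sigma>: "\<sigma> \<in> ?l"
      then have "\<sigma> \<in> {p. p permutes insert a S}" by simp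
      then obtain b p where bp: "\<sigma> = Transposition.transpose a b \<circ> p" "b \<in> insert a S" "p permutes S"
        unfolding permutes_insert by auto
      have "p a = a" using bp(3) insert.hyps by (simp add: permutes_not_in)
      then have "\<sigma> a = b" by (simp add: bp)
      then have fb: "f b = f a" using \<sigma> by auto
      then have "f (p x) = f x" if "x \<in> S" for x
        using \<sigma> that tr[OF fb, of "p x"] by (auto simp: bp(1))
      then show "\<sigma> \<in> ?r" using bp fb by auto
    qed
    show "?r \<subseteq> ?l"
    proof
      fix \<sigma> assume "\<sigma> \<in> ?r"
      then obtain b p where bp: "\<sigma> = Transposition.transpose a b \<circ> p" "b \<in> insert a S" "f b = f a" "p permutes S"
        "\<forall>x\<in>S. f (p x) = f x" by auto
      have "p a = a" using bp(4) insert.hyps by (simp add: permutes_not_in)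
      moreover have "\<sigma> \<in> {p. p permutes insert a S}" unfolding permutes_insert using bp by auto
      ultimately show "\<sigma> \<in> ?l" using bp tr[OF bp(3)] by (auto simp: bp(1))
    qed
  qed
  have inj: "inj_on (\<lambda>(b, p). Transposition.transpose a b \<circ> p) (?b \<times> ?P S)"
  proof (rule inj_onI, clarify)
    fix b p c q assume *: "Transposition.transpose a b \<circ> p = Transposition.transpose a c \<circ> q" "p permutes S" "q permutes S"
    have "p a = a" "q a = a" using *(2,3) insert.hyps by (auto simp: permutes_not_in)
    then have "b = c" using fun_cong[OF *(1), of a] by simp
    moreover have "p = q"
    proof
      fix x show "p x = q x" using arg_cong[OF fun_cong[OF *(1), of x], of "Transposition.transpose a b"] \<open>b = c\<close>
        by simp
    qed
    ultimately show "b = c \<and> p = q" by simp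
  qed
  have fa: "f a \<in> T" using insert.prems by auto
  have b: "?b = insert a {x\<in>S. f x = f a}" by auto
  have cb: "card ?b = Suc (card {x\<in>S. f x = f a})" unfolding b using insert.hyps by simp
  have fib: "{x \<in> insert a S. f x = v} = (if v = f a then insert a {x\<in>S. f x = v} else {x\<in>S. f x = v})" for v
    by auto
  have rest: "(\<Prod>v\<in>T - {f a}. fact (card {x\<in>insert a S. f x = v})) =
      (\<Prod>v\<in>T - {f a}. fact (card {x\<in>S. f x = v}))"
    unfolding fib by (rule prod.cong) auto
  have "card (?P (insert a S)) = card ?b * card (?P S)"
    unfolding eq card_image[OF inj] card_cartesian_product ..
  also have "card (?P S) = (\<Prod>v\<in>T. fact (card {x\<in>S. f x = v}))"
    using insert by auto
  also have "\<dots> = fact (card {x\<in>S. f x = f a}) * (\<Prod>v\<in>T - {f a}. fact (card {x\<in>S. f x = v}))"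
    by (rule prod.remove[OF assms(2) fa])
  also have "card ?b * \<dots> = fact (card ?b) * (\<Prod>v\<in>T - {f a}. fact (card {x\<in>insert a S. f x = v}))"
    unfolding cb rest by (simp only: fact_Suc mult.assoc of_nat_id)
  also have "\<dots> = (\<Prod>v\<in>T. fact (card {x\<in>insert a S. f x = v}))"
    by (rule prod.remove[OF assms(2) fa, symmetric])
  finally show ?case .
qed

lemma count_mlist: "card {i. i < length (mlist a) \<and> mlist a ! i = v} = lookup a v"
proof -
  have "length (filter ((=) v) (concat (map (\<lambda>i. replicate (lookup a i) i) xs))) = (if v \<in> set xs then lookup a v else 0)"
    if "distinct xs" for xs
    using that by (induction xs) (auto simp: filter_replicate)
  from this[of "sorted_list_of_set UNIV"] have "length (filter ((=) v) (mlist a)) = lookup a v"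
    by (simp add: mlist_def)
  then show ?thesis by (simp add: length_filter_conv_card eq_commute[of v])
qed

lemma prod_indicator:
  "(\<Prod>i<l::nat. if P i then 1 else 0) = (if \<forall>i<l. P i then 1 else 0 :: 'a::comm_ring_1)"
  by (induction l) (auto simp: less_Suc_eq)

text \<open>A permutation contributes iff it matches equal entries of the two lists. This forces
  equal multiplicities, and then the contributing permutations are those that preserve the fibres of
  the list.\<close>

lemma pair_mon_eq:
  "(pair_mon a b :: 'a::field_char_0) = (if a = b then \<Prod>i\<in>UNIV. fact (lookup a i) else 0)"
proof (cases "length (mlist a) = length (mlist b)")
  case True
  let ?l = "length (mlist a)"
  let ?S = "{\<sigma>. \<sigma> permutes {..<?l} \<and> (\<forall>i<?l. mlist a ! i = mlist b ! \<sigma> i)}"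
  have "finite {\<sigma>. \<sigma> permutes {..<?l}}" by (rule finite_permutations) simp
  have "(pair_mon a b :: 'a) = (\<Sum>\<sigma>\<in>{\<sigma>. \<sigma> permutes {..<?l}}. if \<forall>i<?l. mlist a ! i = mlist b ! \<sigma> i then 1 else 0)"
    unfolding pair_mon_def if_P[OF True] prod_indicator ..
  also have "\<dots> = of_nat (card ?S)"
    unfolding sum.If_cases[OF \<open>finite _\<close>] Collect_conj_eq[symmetric] Int_def[symmetric]
    by (simp add: Collect_conj_eq)
  finally have eq: "(pair_mon a b :: 'a) = of_nat (card ?S)" .
  show ?thesis
  proof (cases "a = b")
    case True
    have "?S = {\<sigma>. \<sigma> permutes {..<?l} \<and> (\<forall>i\<in>{..<?l}. (!) (mlist a) (\<sigma> i) = mlist a ! i)}"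
      using True by auto
    then have "card ?S = (\<Prod>v\<in>UNIV. fact (card {i\<in>{..<?l}. mlist a ! i = v}))"
      using card_permutes_fibers[of "{..<?l}" UNIV "(!) (mlist a)"] by simp
    then show ?thesis unfolding eq using True by (simp add: count_mlist)
  next
    case False
    have "?S = {}"
    proof safe
      fix \<sigma> assume \<sigma>: "\<sigma> permutes {..<?l}" "\<forall>i<?l. mlist a ! i = mlist b ! \<sigma> i"
      have "a = b"
      proof (rule poly_mapping_eqI)
        fix v
        have "bij_betw \<sigma> {i. i < ?l \<and> mlist a ! i = v} {i. i < length (mlist b) \<and> mlist b ! i = v}"
          unfolding bij_betw_def
        proof
          show "inj_on \<sigma> {i. i < ?l \<and> mlist a ! i = v}"
            using permutes_inj[OF \<sigma>(1)] by (auto simp: inj_on_def)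
          show "\<sigma> ` {i. i < ?l \<and> mlist a ! i = v} = {i. i < length (mlist b) \<and> mlist b ! i = v}"
          proof safe
            fix i assume i: "i < ?l"
            show "\<sigma> i < length (mlist b)" using permutes_in_image[OF \<sigma>(1), of i] i True by simp
            show "mlist b ! \<sigma> i = mlist a ! i" using \<sigma>(2) i by simp
          next
            fix j assume j: "j < length (mlist b)"
            then have "j \<in> \<sigma> ` {..<?l}" using permutes_image[OF \<sigma>(1)] True by simp
            then obtain i where i: "i < ?l" "j = \<sigma> i" by auto
            then show "j \<in> \<sigma> ` {i. i < ?l \<and> mlist a ! i = mlist b ! j}"
            using \<sigma>(2) by (intro image_eqI[where x = i]) simp_all
          qed
        qed
        from bij_betw_same_card[OF this] show "lookup a v = lookup b v" by (simp only: count_mlist)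
      qed
      then show "\<sigma> \<in> {}" using False by simp
    qed
    then show ?thesis unfolding eq using False by (simp only: card.empty if_False of_nat_0)
  qed
next
  case False
  then show ?thesis by (auto simp: pair_mon_def)
qed

section \<open>The pairing of polynomials\<close>

definition ppair :: "('n::{finite,linorder}, 'a::comm_ring_1) pol \<Rightarrow> ('n, 'a) pol \<Rightarrow> 'a" where
  "ppair f s = (\<Sum>a\<in>keys f. \<Sum>b\<in>keys s. lookup f a * lookup s b * pair_mon a b)"

lemma ppair_add_left: "ppair (f + g) s = ppair f s + ppair g s"
  unfolding ppair_def by (rule keys_sum_add) (auto simp: algebra_simps sum.distrib)

lemma ppair_swap: "ppair f s = ppair s (f :: ('n::{finite,linorder}, 'a::field_char_0) pol)"
  unfolding ppair_def by (subst sum.swap) (auto simp: pair_mon_eq intro!: sum.cong)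

lemma ppair_add_right: "ppair s (f + g) = ppair s f + ppair s (g :: ('n::{finite,linorder}, 'a::field_char_0) pol)"
  by (simp add: ppair_swap[of s] ppair_add_left)

lemma ppair_single: "ppair (single a c) (single b d) = c * d * pair_mon a b"
  by (auto simp: ppair_def)

lemma ppair_0 [simp]: "ppair 0 s = 0" "ppair s 0 = 0"
  by (auto simp: ppair_def)

lemma ppair_pconst_left: "ppair (pconst c * f) s = c * ppair f (s :: ('n::{finite,linorder}, 'a::field_char_0) pol)"
proof (induction f rule: pol_monom_induct)
  case (monom m d)
  show ?case by (induction s rule: pol_monom_induct)
    (auto simp: pconst_mult_single ppair_single ppair_add_right algebra_simps)
qed (auto simp: distrib_left ppair_add_left)

lemma ppair_pconst_right: "ppair f (pconst c * s) = c * ppair f (s :: ('n::{finite,linorder}, 'a::field_char_0) pol)"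
  by (simp add: ppair_swap[of f] ppair_pconst_left)

text \<open>On monomials this is the factorial recursion: raising the exponent of variable
  \<open>i\<close> multiplies the weight by the factor that differentiation produces.\<close>

lemma ppair_pvar: "ppair (pvar i * f) s = ppair f (pderiv_var i (s :: ('n::{finite,linorder}, 'a::field_char_0) pol))"
proof (induction f rule: pol_monom_induct)
  case (monom a c)
  show ?case
  proof (induction s rule: pol_monom_induct)
    case (monom b d)
    have fact_eq: "(\<Prod>j\<in>UNIV. fact (lookup (single i (Suc 0) + a) j)) = of_nat (Suc (lookup a i)) * (\<Prod>j\<in>UNIV. fact (lookup a j) :: 'a)"
    proof -
      have "(\<Prod>j\<in>UNIV. fact (lookup (single i (Suc 0) + a) j) :: 'a)
         = (\<Prod>j\<in>UNIV. (if j = i then of_nat (Suc (lookup a i)) else 1) * fact (lookup a j))"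
        by (rule prod.cong) (auto simp: lookup_add lookup_single)
      then show ?thesis by (simp add: prod.distrib)
    qed
    have iff: "a = b - single i (Suc 0) \<longleftrightarrow> b = single i (Suc 0) + a" if "lookup b i > 0"
      using monom_split[OF that] by auto
    show ?case
    proof (cases "lookup b i = 0")
      case True
      then have "b \<noteq> single i (Suc 0) + a" by (auto simp: lookup_add)
      then show ?thesis using True
        by (auto simp: pvar_def mult_single pderiv_var_single ppair_single pair_mon_eq)
    next
      case False
      moreover have "lookup (single i (Suc 0) + a) i = Suc (lookup a i)"
        by (simp add: lookup_add)
      ultimately show ?thesis using iff
        by (auto simp: pvar_def mult_single pderiv_var_single ppair_single pair_mon_eq fact_eq)
    qed
  qed (auto simp: pderiv_var_add ppair_add_right)
qed (auto simp: distrib_left ppair_add_left)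

lemma ppair_nondegenerate:
  fixes f :: "('n::{finite,linorder}, 'a::field_char_0) pol"
  assumes "\<And>m. ppair f (single m 1) = 0"
  shows "f = 0"
proof (rule poly_mapping_eqI)
  fix m
  have "ppair f (single m 1) = (\<Sum>a\<in>keys f. if a = m then lookup f m * (\<Prod>i\<in>UNIV. fact (lookup m i)) else 0)"
    unfolding ppair_def by (rule sum.cong) (auto simp: pair_mon_eq)
  also have "\<dots> = lookup f m * (\<Prod>i\<in>UNIV. fact (lookup m i))"
    by (simp add: sum.delta in_keys_iff)
  finally show "lookup f m = lookup 0 m" using assms by simp
qed

subsection \<open>Anticommuting operators\<close>

text \<open>The sign (-1)^n on a bare abelian group, so that the same rules serve polynomials, forms
  and scalars.\<close>

definition nsg :: "nat \<Rightarrow> 'b::ab_group_add \<Rightarrow> 'b" where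
  "nsg n x = (if even n then x else - x)"

lemma nsg_add: "nsg n (x + y) = nsg n x + nsg n y"
  and nsg_nsg: "nsg m (nsg n x) = nsg (m + n) x"
  and nsg_Suc: "nsg (Suc n) x = - nsg n x"
  and nsg_0 [simp]: "nsg 0 x = x"
  and nsg_zero [simp]: "nsg n 0 = 0"
  by (auto simp: nsg_def)

lemma nsg_minus: "nsg n (- x) = - nsg n x"
  by (auto simp: nsg_def)

lemma nsg_sum: "nsg n (\<Sum>i\<in>A. f i) = (\<Sum>i\<in>A. nsg n (f i))"
  by (auto simp: nsg_def sum_negf)

lemma nsg_mult: "nsg n (x * y) = x * nsg n (y :: 'b::comm_ring_1)"
  by (auto simp: nsg_def)

lemma nsg_mult2: "nsg n x * y = nsg n (x * y :: 'b::comm_ring_1)"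
  by (auto simp: nsg_def)

lemma nsg_lin: "lin s s' f \<Longrightarrow> f (nsg n x) = nsg n (f x)"
  by (auto simp: nsg_def lin_minus)

lemma nsg_eq_0: "nsg n x = 0 \<longleftrightarrow> x = 0"
  by (auto simp: nsg_def)

text \<open>Covers exterior multiplications, contractions and their combinations with polynomial or
  differential coefficients. \<open>sq0\<close> is separate because \<open>anti\<close> with equal
  indices only says that twice the square vanishes, and the group may not allow division by
  2.\<close>

locale anticomm =
  fixes s :: "'a \<Rightarrow> 't::ab_group_add \<Rightarrow> 't" and d :: "'i \<Rightarrow> 't \<Rightarrow> 't"
  assumes lin_d: "lin s s (d i)"
    and anti: "d i (d j X) = - d j (d i X)"
    and sq0: "d i (d i X) = 0"
begin

lemma foldr_lin: "lin s s (foldr d xs)"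
  by (rule lin_foldr[OF lin_d])

lemma move: "d j (foldr d xs X) = nsg (length xs) (foldr d xs (d j X))"
  by (induction xs) (auto simp: anti[of j] nsg_Suc nsg_lin[OF lin_d])

lemma dup: "j \<in> set xs \<Longrightarrow> d j (foldr d xs X) = 0"
  by (induction xs) (auto simp: sq0 anti[of j] lin_zero[OF lin_d])

lemma not_distinct: "\<not> distinct xs \<Longrightarrow> foldr d xs X = 0"
  by (induction xs) (auto simp: dup lin_zero[OF lin_d])


text \<open>The exponent depends on the two lists only; it is fixed before \<open>X\<close>, so one
  sign serves for all forms.\<close>

lemma perm_sign:
  assumes "mset xs = mset ys"
  shows "\<exists>n. \<forall>X. foldr d xs X = nsg n (foldr d ys X)"
  using assms
proof (induction xs arbitrary: ys)
  case Nil
  then show ?case by (intro exI[of _ 0]) auto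
next
  case (Cons x xs)
  then have "x \<in> set ys" by (metis list.set_intros(1) mset_eq_setD)
  then obtain us vs where ys: "ys = us @ x # vs" by (meson split_list)
  then have "mset xs = mset (us @ vs)" using Cons.prems by simp
  then obtain n where n: "\<And>X. foldr d xs X = nsg n (foldr d (us @ vs) X)" using Cons.IH by blast
  have "foldr d (x # xs) X = nsg (n + length us) (foldr d ys X)" for X
    by (simp add: n nsg_lin[OF lin_d] ys move nsg_nsg)
  then show ?case by blast
qed

lemma swap: "foldr d (us @ a # vs @ b # ws) X = - foldr d (us @ b # vs @ a # ws) X"
proof -
  have "d a (foldr d vs (d b Y)) = - d b (foldr d vs (d a Y))" for Y
    by (simp add: move anti[of a b] lin_minus[OF foldr_lin]) (auto simp: nsg_def)
  then show ?thesis by (simp add: lin_minus[OF foldr_lin])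
qed

text \<open>In a list without repetition, renaming \<open>a\<close> and \<open>b\<close> into each
  other is the same as exchanging their two positions. This yields the sign of a permutation in the
  determinant.\<close>

lemma swap_transpose:
  assumes "distinct xs" "a \<in> set xs" "b \<in> set xs" "a \<noteq> b"
  shows "foldr d (map (Transposition.transpose a b) xs) X = - foldr d xs X"
proof -
  have *: "foldr d (map (Transposition.transpose a b) xs) X = - foldr d xs X"
    if "xs = us @ a # vs @ b # ws" "distinct xs" for us vs ws a b
  proof -
    have "map (Transposition.transpose a b) ys = ys" if "a \<notin> set ys" "b \<notin> set ys" for ys
      using that by (induction ys) (auto simp: Transposition.transpose_def)
    then have "map (Transposition.transpose a b) xs = us @ b # vs @ a # ws"
      using that by auto
    then show ?thesis using swap[of us b vs a ws X] that(1) by simp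
  qed
  obtain us vs where us: "xs = us @ a # vs" using assms(2) by (meson split_list)
  show ?thesis
  proof (cases "b \<in> set vs")
    case True
    then obtain p q where "vs = p @ b # q" by (meson split_list)
    then show ?thesis using * us assms by blast
  next
    case False
    then have "b \<in> set us" using us assms by auto
    then obtain p q where "us = p @ b # q" by (meson split_list)
    then have "xs = p @ b # q @ a # vs" using us by simp
    from *[OF this assms(1)] show ?thesis by (simp only: transpose_commute)
  qed
qed

end

text \<open>On its way from the front to its place the operator \<open>d j\<close> crosses exactly
  the initial run of smaller indices.\<close>

lemma anticomm_insort:
  fixes d :: "'i::linorder \<Rightarrow> 't::ab_group_add \<Rightarrow> 't"
  assumes "anticomm s d"
  shows "foldr d (insort j xs) X = nsg (length (takeWhile (\<lambda>x. \<not> j \<le> x) xs)) (d j (foldr d xs X))"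
proof -
  interpret anticomm s d by fact
  show ?thesis
    by (induction xs) (auto simp: anti[of j] nsg_Suc nsg_minus nsg_lin[OF lin_d])
qed

subsection \<open>Operators on polynomial forms\<close>

text \<open>The functions \<open>'r set \<Rightarrow> pol\<close> serve at the same time for polynomial forms on V and on its
  dual; multiplication by a variable is adjoint to a partial derivative and exterior
  multiplication is adjoint to contraction.\<close>

definition nb :: "'r::linorder \<Rightarrow> 'r set \<Rightarrow> nat" where
  "nb j K = card {k\<in>K. k < j}"
definition ext :: "'r::{finite,linorder} \<Rightarrow> ('r, 'n, 'a::comm_ring_1) sext \<Rightarrow> ('r, 'n, 'a) sext" where
  "ext j F = (\<lambda>K. if j \<in> K then nsg (nb j K) (F (K - {j})) else 0)"
definition ctr :: "'r::{finite,linorder} \<Rightarrow> ('r, 'n, 'a::comm_ring_1) sext \<Rightarrow> ('r, 'n, 'a) sext" where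
  "ctr j F = (\<lambda>K. if j \<in> K then 0 else nsg (nb j K) (F (insert j K)))"
definition pm :: "('n, 'a::comm_ring_1) pol \<Rightarrow> ('r, 'n, 'a) sext \<Rightarrow> ('r, 'n, 'a) sext" where
  "pm f F = (\<lambda>K. f * F K)"
definition pd :: "'n \<Rightarrow> ('r, 'n, 'a::comm_ring_1) sext \<Rightarrow> ('r, 'n, 'a) sext" where
  "pd i F = (\<lambda>K. pderiv_var i (F K))"
definition pD :: "('n::{finite,linorder}, 'a::comm_ring_1) pol \<Rightarrow> ('r, 'n, 'a) sext \<Rightarrow> ('r, 'n, 'a) sext" where
  "pD s F = (\<lambda>K. dop s (F K))"
definition basis :: "'r set \<Rightarrow> ('r, 'n, 'a::comm_ring_1) sext" where
  "basis I = (\<lambda>K. if K = I then 1 else 0)"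

interpretation es: vector_space "escale :: 'a::field \<Rightarrow> ('r, 'n, 'a) sext \<Rightarrow> _"
  by unfold_locales (auto simp: escale_def fun_eq_iff algebra_simps pconst_add pconst_mult)

lemma eadd_plus: "eadd F H = F + H" and ezero_zero: "ezero = 0" and eminus_minus: "eminus F H = F - H"
  by (auto simp: eadd_def ezero_def eminus_def fun_eq_iff)

lemma esum_sum: "esum f A = sum f A"
  by (auto simp: esum_def sum_fun_apply fun_eq_iff)

lemma eone_basis: "eone = basis {}"
  by (simp add: eone_def basis_def)

lemma nb_insert: "nb i (insert j K) = nb i K + (if j < i \<and> j \<notin> K then 1 else 0)"
  for K :: "'r::{finite,linorder} set"
proof (cases "j < i \<and> j \<notin> K")
  case True
  then have "{k \<in> insert j K. k < i} = insert j {k\<in>K. k < i}" by auto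
  then show ?thesis using True by (simp add: nb_def)
next
  case False
  then have "{k \<in> insert j K. k < i} = {k\<in>K. k < i}" by auto
  then show ?thesis using False by (auto simp: nb_def)
qed

lemma nb_remove: "j \<in> K \<Longrightarrow> nb i K = nb i (K - {j}) + (if j < i then 1 else 0)"
  for K :: "'r::{finite,linorder} set"
  using nb_insert[of i j "K - {j}"] by (simp add: insert_absorb)

lemma lin_ext: "lin escale escale (ext j)"
  and lin_ctr: "lin escale escale (ctr j)"
  and lin_pm: "lin escale escale (pm f)"
  and lin_pd: "lin escale escale (pd i :: ('r, 'n::finite, 'a::comm_ring_1) sext \<Rightarrow> _)"
  and lin_pD: "lin escale escale (pD s)"
  by (auto simp: lin_def fun_eq_iff ext_def ctr_def pm_def pd_def pD_def nsg_add distrib_left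
      escale_def nsg_mult mult.left_commute pderiv_var_add pderiv_var_pconst_mult dop_add_right
      dop_pconst_mult_right)

lemma ext_ext: "ext i (ext j F) = - ext j (ext i F)"
proof
  fix K
  show "ext i (ext j F) K = (- ext j (ext i F)) K"
  proof (cases "i \<in> K \<and> j \<in> K \<and> i \<noteq> j")
    case True
    have n: "nb i K = nb i (K - {j}) + (if j < i then 1 else 0)" "nb j K = nb j (K - {i}) + (if i < j then 1 else 0)"
      by (rule nb_remove, use True in simp)+
    \<comment> \<open>Of two distinct indices exactly one is the smaller, so just one of the two
      counts is shifted by removing the other index, and the total exponents differ by one.\<close>
    have sgn: "nsg (nb i K + nb j (K - {i})) x = - nsg (nb j K + nb i (K - {j})) x" for x :: "('b, 'c) pol"
      unfolding n using True by (cases i j rule: linorder_cases) (auto simp: nsg_def)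
    have eq: "K - {i} - {j} = K - {j} - {i}" by auto
    have "ext i (ext j F) K = nsg (nb i K + nb j (K - {i})) (F (K - {i} - {j}))"
      using True by (auto simp: ext_def nsg_nsg)
    also have "\<dots> = - ext j (ext i F) K"
      unfolding sgn eq using True by (auto simp: ext_def nsg_nsg)
    finally show ?thesis by simp
  qed (auto simp: ext_def)
qed

lemma ext_sq: "ext i (ext i F) = 0"
  by (auto simp: ext_def fun_eq_iff)

lemma ctr_ctr: "ctr i (ctr j F) = - ctr j (ctr i F)"
proof
  fix K
  show "ctr i (ctr j F) K = (- ctr j (ctr i F)) K"
  proof (cases "i \<notin> K \<and> j \<notin> K \<and> i \<noteq> j")
    case True
    then show ?thesis
      by (cases "i < j") (auto simp: ctr_def nsg_nsg nsg_minus nsg_Suc nb_insert insert_commute add.commute)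
  qed (auto simp: ctr_def)
qed

lemma ctr_sq: "ctr i (ctr i F) = 0"
  by (auto simp: ctr_def fun_eq_iff)

lemma ctr_ext: "ctr i (ext j F) = (if i = j then F else 0) - ext j (ctr i F)"
proof
  fix K
  show "ctr i (ext j F) K = ((if i = j then F else 0) - ext j (ctr i F)) K"
  proof (cases "i = j")
    case True
    show ?thesis
    proof (cases "j \<in> K")
      case True
      moreover have "nb j K = nb j (K - {j})" using nb_remove[OF True, of j] by simp
      ultimately show ?thesis using \<open>i = j\<close>
        by (simp add: ctr_def ext_def nsg_nsg insert_absorb) (simp add: nsg_def)
    next
      case False
      then show ?thesis using \<open>i = j\<close>
        by (simp add: ctr_def ext_def nsg_nsg nb_insert) (simp add: nsg_def)
    qed
  next
    case False
    show ?thesis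
    proof (cases "i \<notin> K \<and> j \<in> K")
      case True
      have n: "nb i K = nb i (K - {j}) + (if j < i then 1 else 0)" by (rule nb_remove) (use True in simp)
      have sgn: "nsg (nb i K + nb j (insert i K)) x = - nsg (nb j K + nb i (K - {j})) x" for x :: "('b, 'c) pol"
        unfolding n nb_insert using True False by (cases i j rule: linorder_cases) (auto simp: nsg_def)
      have eq: "insert i K - {j} = insert i (K - {j})" using False by auto
      have "ctr i (ext j F) K = nsg (nb i K + nb j (insert i K)) (F (insert i K - {j}))"
        using True False by (simp add: ctr_def ext_def nsg_nsg)
      also have "\<dots> = - ext j (ctr i F) K"
        unfolding sgn eq using True by (simp add: ctr_def ext_def nsg_nsg)
      finally show ?thesis using False by simp
    qed (use False in \<open>auto simp: ctr_def ext_def\<close>)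
  qed
qed

lemma ext_ctr: "ext i (ctr j F) = (if i = j then F else 0) - ctr j (ext i F)"
  using ctr_ext[of j i F] by auto

interpretation exts: anticomm escale "ext :: 'r::{finite,linorder} \<Rightarrow> ('r, 'n, 'a::comm_ring_1) sext \<Rightarrow> _"
  by unfold_locales (rule lin_ext ext_ext ext_sq)+
interpretation ctrs: anticomm escale "ctr :: 'r::{finite,linorder} \<Rightarrow> ('r, 'n, 'a::comm_ring_1) sext \<Rightarrow> _"
  by unfold_locales (rule lin_ctr ctr_ctr ctr_sq)+

lemma pm_ext: "pm f (ext j F) = ext j (pm f F)" and pm_ctr: "pm f (ctr j F) = ctr j (pm f F)"
  by (auto simp: pm_def ext_def ctr_def fun_eq_iff nsg_mult)

lemma pm_pm: "pm f (pm h F) = pm (f * h) F" and pm_one [simp]: "pm 1 F = F"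
  and pm_add_left: "pm (f + h) F = pm f F + pm h F" and pm_pconst: "pm (pconst c) F = escale c F"
  and pm_zero [simp]: "pm 0 F = 0"
  by (auto simp: pm_def fun_eq_iff mult.assoc distrib_right escale_def)

lemma pm_sum_left: "pm (sum f A) F = (\<Sum>i\<in>A. pm (f i) F)"
  by (induction A rule: infinite_finite_induct) (auto simp: pm_add_left)

lemma nsg_lin_fun: "(\<And>x y. f (x + y) = f x + f y) \<Longrightarrow> f (nsg n x) = nsg n (f x)"
  for f :: "'b::ab_group_add \<Rightarrow> 'c::ab_group_add"
proof -
  assume f: "\<And>x y. f (x + y) = f x + f y"
  have "f 0 = 0" using f[of 0 0] by simp
  then have "f (- x) = - f x" using f[of x "- x"] by (simp add: eq_neg_iff_add_eq_0 add.commute)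
  then show "f (nsg n x) = nsg n (f x)" by (simp add: nsg_def)
qed

lemma pderiv_var_nsg: "pderiv_var i (nsg n f) = nsg n (pderiv_var i f)"
  by (rule nsg_lin_fun) (rule pderiv_var_add)

lemma dop_0_right [simp]: "dop s 0 = 0"
  using dop_pconst_mult_right[of s 0 0] by simp

lemma dop_nsg: "dop s (nsg n f) = nsg n (dop s f)"
  by (rule nsg_lin_fun) (rule dop_add_right)

lemma pd_ext: "pd i (ext j F) = ext j (pd i F)" and pd_ctr: "pd i (ctr j F) = ctr j (pd i F)"
  for F :: "('r::{finite,linorder}, 'n::finite, 'a::comm_ring_1) sext"
  by (auto simp: pd_def ext_def ctr_def fun_eq_iff pderiv_var_nsg)

lemma pD_ext: "pD s (ext j F) = ext j (pD s F)" and pD_ctr: "pD s (ctr j F) = ctr j (pD s F)"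
  by (auto simp: pD_def ext_def ctr_def fun_eq_iff dop_nsg)

lemma pD_mult: "pD (s * t) F = pD s (pD t F)" and pD_add: "pD (s + t) F = pD s F + pD t F"
  and pD_pconst: "pD (pconst c) F = escale c F" and pD_pvar: "pD (pvar i) F = pd i F"
  and pD_one [simp]: "pD 1 F = F" and pD_zero [simp]: "pD 0 F = 0"
  using dop_pconst[of 1]
  by (auto simp: pD_def fun_eq_iff dop_mult dop_add dop_pconst escale_def dop_pvar pd_def)

lemma pD_commute: "pD s (pD t F) = pD t (pD s F)"
  by (metis pD_mult mult.commute)

lemma pd_pm: "pd i (pm (pvar j) F) = (if i = j then F else 0) + pm (pvar j) (pd i F)"
  for F :: "('r, 'n::finite, 'a::comm_ring_1) sext"
  by (auto simp: pd_def pm_def fun_eq_iff pderiv_var_pvar_mult)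

lemma sext_sum_basis: "F = (\<Sum>I\<in>UNIV. pm (F I) (basis I))"
  for F :: "('r::finite, 'n, 'a::comm_ring_1) sext"
  by (auto simp: fun_eq_iff sum_fun_apply pm_def basis_def if_distrib cong: if_cong)

lemma ext_basis: "ext j (basis I) = (if j \<in> I then 0 else nsg (nb j I) (basis (insert j I)))"
proof
  fix K
  show "ext j (basis I) K = (if j \<in> I then 0 else nsg (nb j I) (basis (insert j I))) K"
  proof (cases "j \<in> K \<and> K - {j} = I")
    case True
    then have "K = insert j I" "j \<notin> I" by auto
    then show ?thesis using nb_insert[of j j I] by (simp add: ext_def basis_def) (auto simp: nsg_def)
  next
    case False
    then have "K = insert j I \<Longrightarrow> j \<in> I" by auto
    then show ?thesis using False by (auto simp: ext_def basis_def nsg_def)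
  qed
qed

lemma sext_induct [case_names const add ext]:
  fixes F :: "('r::{finite,linorder}, 'n, 'a::comm_ring_1) sext"
  assumes const: "\<And>f. P (pm f eone)" and add: "\<And>F H. P F \<Longrightarrow> P H \<Longrightarrow> P (F + H)"
    and ext: "\<And>j F. P F \<Longrightarrow> P (ext j F)"
  shows "P F"
proof -
  have basis: "P (pm f (basis I))" for f I
    using finite[of I]
  proof (induction I rule: finite_linorder_min_induct)
    case empty
    then show ?case using const by (simp add: eone_basis)
  next
    \<comment> \<open>\<open>b\<close> lies below all of \<open>A\<close>, so multiplying by its
      letter from the left inserts it without a sign.\<close>
    case (insert b A)
    then have "nb b A = 0" "b \<notin> A" by (auto simp: nb_def)
    then have "pm f (basis (insert b A)) = ext b (pm f (basis A))"
      by (simp add: pm_ext[symmetric] ext_basis)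
    then show ?case using insert ext by simp
  qed
  have "P 0" using const[of 0] by simp
  have "P (\<Sum>I\<in>A. pm (F I) (basis I))" if "finite A" for A
    using that
  proof (induction A rule: finite_induct)
    case (insert I A)
    then show ?case unfolding sum.insert[OF insert.hyps] by (intro add basis)
  qed (simp only: sum.empty \<open>P 0\<close>)
  then show ?thesis by (subst sext_sum_basis) simp
qed

text \<open>There are two Fock space structures. The creation operators \<open>zl\<close> with annihilation operators
  \<open>dl\<close> have the vacuum 1; for \<open>zt\<close> and \<open>dt\<close> the odd letters act by contraction, and the vacuum is the
  top form \<open>basis UNIV\<close>.\<close>

definition odd_letter :: "'n + 'r \<Rightarrow> bool" where
  "odd_letter a = (case a of Inl _ \<Rightarrow> False | Inr _ \<Rightarrow> True)"
definition zl :: "'n + 'r \<Rightarrow> ('r::{finite,linorder}, 'n, 'a::comm_ring_1) sext \<Rightarrow> ('r, 'n, 'a) sext" where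
  "zl a = (case a of Inl i \<Rightarrow> pm (pvar i) | Inr j \<Rightarrow> ext j)"
definition dl :: "'n + 'r \<Rightarrow> ('r::{finite,linorder}, 'n, 'a::comm_ring_1) sext \<Rightarrow> ('r, 'n, 'a) sext" where
  "dl a = (case a of Inl i \<Rightarrow> pd i | Inr j \<Rightarrow> ctr j)"
definition zt :: "'n + 'r \<Rightarrow> ('r::{finite,linorder}, 'n, 'a::comm_ring_1) sext \<Rightarrow> ('r, 'n, 'a) sext" where
  "zt a = (case a of Inl i \<Rightarrow> pm (pvar i) | Inr j \<Rightarrow> ctr j)"
definition dt :: "'n + 'r \<Rightarrow> ('r::{finite,linorder}, 'n, 'a::comm_ring_1) sext \<Rightarrow> ('r, 'n, 'a) sext" where
  "dt a = (case a of Inl i \<Rightarrow> pd i | Inr j \<Rightarrow> ext j)"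

lemma odd_letter_simps [simp]: "odd_letter (Inl i) = False" "odd_letter (Inr j) = True"
  by (auto simp: odd_letter_def)

lemma letter_simps [simp]:
  "zl (Inl i) = pm (pvar i)" "zl (Inr j) = ext j" "dl (Inl i) = pd i" "dl (Inr j) = ctr j"
  "zt (Inl i) = pm (pvar i)" "zt (Inr j) = ctr j" "dt (Inl i) = pd i" "dt (Inr j) = ext j"
  by (auto simp: zl_def dl_def zt_def dt_def)

lemma letter_induct [case_names const add letter]:
  fixes F :: "('r::{finite,linorder}, 'n::finite, 'a::comm_ring_1) sext"
  assumes "\<And>c. P (escale c eone)" "\<And>F H. P F \<Longrightarrow> P H \<Longrightarrow> P (F + H)" "\<And>a F. P F \<Longrightarrow> P (zl a F)"
  shows "P F"
proof (induction F rule: sext_induct)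
  case (const f)
  show ?case
  proof (induction f rule: pol_induct)
    case (const c)
    then show ?case using assms(1) by (simp add: pm_pconst)
  next
    case (add f g)
    then show ?case unfolding pm_add_left by (rule assms(2))
  next
    case (var i f)
    then show ?case using assms(3)[of _ "Inl i"] by (simp add: pm_pm[symmetric])
  qed
next
  case (ext j F)
  then show ?case using assms(3)[of _ "Inr j"] by simp
qed (rule assms(2))

lemma lin_letter: "lin escale escale (zl a :: ('r::{finite,linorder}, 'n::finite, 'a::comm_ring_1) sext \<Rightarrow> _)"
  "lin escale escale (dl a :: ('r::{finite,linorder}, 'n::finite, 'a::comm_ring_1) sext \<Rightarrow> _)"
  "lin escale escale (zt a :: ('r::{finite,linorder}, 'n::finite, 'a::comm_ring_1) sext \<Rightarrow> _)"
  "lin escale escale (dt a :: ('r::{finite,linorder}, 'n::finite, 'a::comm_ring_1) sext \<Rightarrow> _)"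
  by (cases a; simp add: lin_pm lin_ext lin_ctr lin_pd)+

lemma escale_m1: "escale (- 1) F = - F"
  by (auto simp: escale_def pconst_minus)

lemma escale_one [simp]: "escale 1 F = F" and escale_zero [simp]: "escale 0 F = 0"
  and escale_0_right [simp]: "escale c 0 = 0"
  by (auto simp: escale_def)

lemma zl_zl: "zl a (zl b F) = escale (ssgn odd_letter a b) (zl b (zl a F))"
proof (cases a; cases b)
  fix i j assume "a = Inr i" "b = Inr j"
  then show ?thesis using ext_ext[of i j F] by (simp add: ssgn_def escale_m1)
qed (simp_all add: ssgn_def pm_pm pm_ext mult.commute)

lemma zt_zt: "zt a (zt b F) = escale (ssgn odd_letter a b) (zt b (zt a F))"
proof (cases a; cases b)
  fix i j assume "a = Inr i" "b = Inr j"
  then show ?thesis using ctr_ctr[of i j F] by (simp add: ssgn_def escale_m1)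
qed (simp_all add: ssgn_def pm_pm pm_ctr mult.commute)

lemma dl_zl: "dl a (zl b F) = escale (if a = b then 1 else 0) F + escale (ssgn odd_letter a b) (zl b (dl a F))"
  for F :: "('r::{finite,linorder}, 'n::finite, 'a::comm_ring_1) sext"
proof (cases a; cases b)
  fix i j assume "a = Inr i" "b = Inr j"
  then show ?thesis using ctr_ext[of i j F] by (simp add: ssgn_def escale_m1)
qed (simp_all add: ssgn_def pd_pm pm_ctr pd_ext)

lemma dt_zt: "dt a (zt b F) = escale (if a = b then 1 else 0) F + escale (ssgn odd_letter a b) (zt b (dt a F))"
  for F :: "('r::{finite,linorder}, 'n::finite, 'a::comm_ring_1) sext"
proof (cases a; cases b)
  fix i j assume "a = Inr i" "b = Inr j"
  then show ?thesis using ext_ctr[of i j F] by (simp add: ssgn_def escale_m1)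
qed (simp_all add: ssgn_def pd_pm pm_ext pd_ctr)

lemma dl_one: "dl a eone = (0 :: ('r::{finite,linorder}, 'n::finite, 'a::comm_ring_1) sext)"
  using pderiv_var_pconst[of _ "1::'a"] by (cases a) (auto simp: eone_def pd_def ctr_def fun_eq_iff)

lemma dt_top: "dt a (basis UNIV) = (0 :: ('r::{finite,linorder}, 'n::finite, 'a::comm_ring_1) sext)"
  using pderiv_var_pconst[of _ "1::'a"] by (cases a) (auto simp: basis_def pd_def ext_def fun_eq_iff)

lemma epair_ppair: "epair F X = (\<Sum>I\<in>UNIV. ppair (F I) (X I))"
  by (simp add: epair_def ppair_def)

lemma lin_epair: "lin escale (*) (\<lambda>F. epair F X)" "lin escale (*) (epair F)"
  for F X :: "('r::finite, 'n::{finite,linorder}, 'a::field_char_0) sext"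
  by (auto simp: lin_def epair_ppair ppair_add_left ppair_add_right sum.distrib escale_def
      ppair_pconst_left ppair_pconst_right sum_distrib_left)

lemma epair_swap: "epair F X = epair X F"
  for F X :: "('r::finite, 'n::{finite,linorder}, 'a::field_char_0) sext"
  unfolding epair_ppair by (intro sum.cong refl ppair_swap)

lemma epair_pm_pvar: "epair (pm (pvar i) F) X = epair F (pd i X)"
  for F X :: "('r::finite, 'n::{finite,linorder}, 'a::field_char_0) sext"
  by (simp add: epair_ppair pm_def pd_def ppair_pvar)

lemma epair_ext: "epair (ext j F) X = epair F (ctr j X)"
  for F X :: "('r::{finite,linorder}, 'n::{finite,linorder}, 'a::field_char_0) sext"
proof -
  have pn: "ppair (nsg n f) s = nsg n (ppair f s)" "ppair f (nsg n s) = nsg n (ppair f s)"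
    for n and f s :: "('n, 'a) pol"
    by (rule nsg_lin_fun, rule ppair_add_left, rule nsg_lin_fun, rule ppair_add_right)
  have "epair (ext j F) X = (\<Sum>I\<in>UNIV. if j \<in> I then nsg (nb j I) (ppair (F (I - {j})) (X I)) else 0)"
    unfolding epair_ppair by (intro sum.cong refl) (auto simp: ext_def pn)
  also have "\<dots> = (\<Sum>I | j \<in> I. nsg (nb j I) (ppair (F (I - {j})) (X I)))"
    by (simp add: sum.If_cases)
  also have "\<dots> = (\<Sum>I | j \<notin> I. nsg (nb j I) (ppair (F I) (X (insert j I))))"
    by (rule sum.reindex_bij_witness[where i = "insert j" and j = "\<lambda>I. I - {j}"])
      (auto simp: nb_insert insert_absorb nb_remove[of j _ j])
  also have "\<dots> = (\<Sum>I\<in>UNIV. if j \<in> I then 0 else nsg (nb j I) (ppair (F I) (X (insert j I))))"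
    by (simp add: sum.If_cases Compl_eq)
  also have "\<dots> = epair F (ctr j X)"
    unfolding epair_ppair by (intro sum.cong refl) (auto simp: ctr_def pn)
  finally show ?thesis .
qed

lemma epair_zl: "epair (zl a F) X = epair F (dl a X)"
  for F X :: "('r::{finite,linorder}, 'n::{finite,linorder}, 'a::field_char_0) sext"
  by (cases a) (simp_all add: epair_pm_pvar epair_ext)

lemma epair_zt: "epair (zt a F) X = epair F (dt a X)"
  for F X :: "('r::{finite,linorder}, 'n::{finite,linorder}, 'a::field_char_0) sext"
proof (cases a)
  case (Inr j)
  have "epair (ctr j F) X = epair X (ctr j F)" by (rule epair_swap)
  also have "\<dots> = epair (ext j X) F" by (rule epair_ext[symmetric])
  also have "\<dots> = epair F (ext j X)" by (rule epair_swap)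
  finally show ?thesis using Inr by simp
qed (simp add: epair_pm_pvar)

lemma epair_nondegenerate:
  fixes F :: "('r::finite, 'n::{finite,linorder}, 'a::field_char_0) sext"
  assumes "\<And>X. epair F X = 0"
  shows "F = 0"
proof
  fix I
  have "ppair (F I) s = 0" for s
  proof -
    have "epair F (pm s (basis I)) = (\<Sum>J\<in>UNIV. if J = I then ppair (F I) s else 0)"
      unfolding epair_ppair by (intro sum.cong refl) (auto simp: pm_def basis_def)
    then show ?thesis using assms by simp
  qed
  then show "F I = 0 I" using ppair_nondegenerate by (simp add: zero_fun_def) blast
qed

subsection \<open>Exterior products and the diagonal action in terms of letters\<close>

definition ws :: "'r::{finite,linorder} set \<Rightarrow> 'r set \<Rightarrow> nat" where
  "ws I J = card {(i, j). i \<in> I \<and> j \<in> J \<and> j < i}"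

lemma ws_insert: "j \<notin> I \<Longrightarrow> ws (insert j I) J = nb j J + ws I J"
proof -
  assume j: "j \<notin> I"
  have "{(i, k). i \<in> insert j I \<and> k \<in> J \<and> k < i} =
      Pair j ` {k \<in> J. k < j} \<union> {(i, k). i \<in> I \<and> k \<in> J \<and> k < i}" by auto
  then have "ws (insert j I) J = card (Pair j ` {k \<in> J. k < j}) + ws I J"
    unfolding ws_def using j by (simp, subst card_Un_disjoint) auto
  then show ?thesis by (simp add: nb_def card_image inj_on_def)
qed

lemma nb_Un: "I \<inter> J = {} \<Longrightarrow> nb j (I \<union> J) = nb j I + nb j J"
  for I J :: "'r::{finite,linorder} set"
proof -
  assume "I \<inter> J = {}"
  moreover have "{k \<in> I \<union> J. k < j} = {k \<in> I. k < j} \<union> {k \<in> J. k < j}" by auto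
  ultimately show ?thesis unfolding nb_def by (simp, subst card_Un_disjoint) auto
qed

lemma emult_eq:
  fixes F H :: "('r::{finite,linorder}, 'n, 'a::comm_ring_1) sext"
  shows "emult F H K = (\<Sum>I\<in>Pow K. nsg (ws I (K - I)) (F I * H (K - I)))"
proof -
  have "emult F H K = (\<Sum>I\<in>UNIV. if I \<subseteq> K then nsg (ws I (K - I)) (F I * H (K - I)) else 0)"
    unfolding emult_def
  proof (rule sum.cong[OF refl])
    fix I :: "'r set"
    have "(\<Sum>J\<in>UNIV. if I \<inter> J = {} \<and> I \<union> J = K then pconst (wsign I J) * F I * H J else 0)
      = (\<Sum>J\<in>UNIV. if J = K - I then (if I \<subseteq> K then nsg (ws I (K - I)) (F I * H (K - I)) else 0) else 0)"
    proof (rule sum.cong[OF refl])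
      fix J
      have *: "I \<inter> J = {} \<and> I \<union> J = K \<longleftrightarrow> I \<subseteq> K \<and> J = K - I" by auto
      have **: "pconst (wsign I J) * F I * H J = nsg (ws I J) (F I * H J)"
        by (auto simp: wsign_def ws_def nsg_def pconst_minus)
      show "(if I \<inter> J = {} \<and> I \<union> J = K then pconst (wsign I J) * F I * H J else 0)
        = (if J = K - I then (if I \<subseteq> K then nsg (ws I (K - I)) (F I * H (K - I)) else 0) else 0)"
        unfolding * ** by auto
    qed
    then show "(\<Sum>J\<in>UNIV. if I \<inter> J = {} \<and> I \<union> J = K then pconst (wsign I J) * F I * H J else 0)
      = (if I \<subseteq> K then nsg (ws I (K - I)) (F I * H (K - I)) else 0)" by simp
  qed
  then show ?thesis by (simp add: sum.If_cases Pow_def)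
qed

text \<open>The crossings of \<open>j\<close> with \<open>K\<close> split into those with
  \<open>I\<close> and those with \<open>K - I\<close>; the second group is what \<open>j\<close>
  adds to the shuffle sign.\<close>

lemma emult_ext: "emult (ext j F) H = ext j (emult F H)"
proof
  fix K
  show "emult (ext j F) H K = ext j (emult F H) K"
  proof (cases "j \<in> K")
    case False
    then show ?thesis unfolding emult_eq by (auto simp: ext_def intro!: sum.neutral)
  next
    case True
    have "emult (ext j F) H K = (\<Sum>I\<in>{I\<in>Pow K. j \<in> I}. nsg (ws I (K - I)) (nsg (nb j I) (F (I - {j})) * H (K - I)))"
      unfolding emult_eq by (rule sum.mono_neutral_cong_right) (auto simp: ext_def)
    also have "\<dots> = (\<Sum>I\<in>Pow (K - {j}). nsg (nb j K) (nsg (ws I (K - {j} - I)) (F I * H (K - {j} - I))))"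
    proof (rule sum.reindex_bij_witness[where i = "insert j" and j = "\<lambda>I. I - {j}"])
      fix I assume I: "I \<in> {I\<in>Pow K. j \<in> I}"
      then have *: "K - I = K - {j} - (I - {j})" "I = insert j (I - {j})" by auto
      have "nb j K = nb j I + nb j (K - I)"
        using nb_Un[of I "K - I" j] I by (simp add: Un_absorb1)
      moreover have "ws I (K - I) = nb j (K - I) + ws (I - {j}) (K - I)"
        using ws_insert[of j "I - {j}" "K - I"] *(2) by simp
      ultimately show "nsg (nb j K) (nsg (ws (I - {j}) (K - {j} - (I - {j}))) (F (I - {j}) * H (K - {j} - (I - {j}))))
         = nsg (ws I (K - I)) (nsg (nb j I) (F (I - {j})) * H (K - I))"
        unfolding *(1)[symmetric] by (simp add: nsg_mult2 nsg_nsg add_ac)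
    qed (use True in auto)
    also have "\<dots> = ext j (emult F H) K"
      using True by (simp add: ext_def emult_eq nsg_sum)
    finally show ?thesis .
  qed
qed

lemma emult_pm: "emult (pm f F) H = pm f (emult F H)"
  by (auto simp: fun_eq_iff emult_eq pm_def sum_distrib_left mult.assoc nsg_mult)

lemma emult_add_left: "emult (F + F') H = emult F H + emult F' H"
  and emult_add_right: "emult F (H + H') = emult F H + emult F H'"
  by (auto simp: fun_eq_iff emult_eq distrib_left distrib_right nsg_add sum.distrib)

lemma emult_escale_left: "emult (escale c F) H = escale c (emult F H)"
  using emult_pm[of "pconst c" F H] by (simp add: pm_pconst)

lemma emult_escale_right: "emult F (escale c H) = escale c (emult F H)"
  by (auto simp: fun_eq_iff emult_eq escale_def sum_distrib_left mult.left_commute nsg_mult)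

lemma lin_emult: "lin escale escale (\<lambda>F. emult F H)" "lin escale escale (emult F)"
  by (auto simp: lin_def emult_add_left emult_add_right emult_escale_left emult_escale_right)

lemma emult_eone: "emult eone H = H"
proof
  fix K
  have "emult eone H K = (\<Sum>I\<in>Pow K. if I = {} then H K else 0)"
    unfolding emult_eq by (rule sum.cong) (auto simp: eone_def ws_def)
  then show "emult eone H K = H K" by simp
qed

lemma emult_zl: "emult (zl a F) H = zl a (emult F H)"
  by (cases a) (simp_all add: emult_pm emult_ext)

lemma embS_pm: "embS f = pm f eone"
  by (auto simp: embS_def pm_def eone_def fun_eq_iff)

definition lext :: "('r::{finite,linorder} \<Rightarrow> 'a::comm_ring_1) \<Rightarrow> ('r, 'n, 'a) sext \<Rightarrow> ('r, 'n, 'a) sext" where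
  "lext c X = (\<Sum>k\<in>UNIV. escale (c k) (ext k X))"

lemma lin_sum_escale:
  assumes "\<And>k. k \<in> A \<Longrightarrow> lin escale escale (f k :: ('r, 'n, 'a::comm_ring_1) sext \<Rightarrow> ('r, 'n, 'a) sext)"
  shows "lin escale escale (\<lambda>X. \<Sum>k\<in>A. escale (c k) (f k X))"
proof -
  have "escale c (X + Y) = escale c X + escale c Y" "escale c (escale d X) = escale d (escale c X)"
    for c d and X Y :: "('r, 'n, 'a) sext"
    by (auto simp: escale_def fun_eq_iff distrib_left mult.left_commute)
  moreover have "escale c (sum h A) = (\<Sum>k\<in>A. escale c (h k))" for c and h :: "_ \<Rightarrow> ('r, 'n, 'a) sext"
    by (auto simp: escale_def fun_eq_iff sum_fun_apply sum_distrib_left)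
  ultimately show ?thesis using assms by (simp add: lin_def sum.distrib)
qed

lemma escale_sum: "escale c (sum h A) = (\<Sum>k\<in>A. escale c (h k))"
  and escale_add: "escale c (X + Y) = escale c X + escale c Y"
  and escale_escale: "escale c (escale d X) = escale (c * d) X"
  and escale_minus: "escale c (- X) = - escale c X"
  by (auto simp: escale_def fun_eq_iff sum_fun_apply sum_distrib_left distrib_left pconst_mult mult.assoc)

lemma lext_lext: "lext c (lext d X) = - lext d (lext c X)"
proof -
  have "lext c (lext d X) = (\<Sum>k\<in>UNIV. \<Sum>l\<in>UNIV. escale (c k * d l) (ext k (ext l X)))"
    by (simp add: lext_def lin_sum[OF lin_ext] lin_scale[OF lin_ext] escale_sum escale_escale)
  also have "\<dots> = (\<Sum>k\<in>UNIV. \<Sum>l\<in>UNIV. - escale (d l * c k) (ext l (ext k X)))"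
    by (intro sum.cong refl) (subst ext_ext, simp add: escale_minus mult.commute)
  also have "\<dots> = - lext d (lext c X)"
    by (subst sum.swap)
      (simp add: lext_def lin_sum[OF lin_ext] lin_scale[OF lin_ext] escale_sum escale_escale sum_negf)
  finally show ?thesis .
qed

lemma lext_sq: "lext c (lext c X) = 0"
  for X :: "('r::{finite,linorder}, 'n, 'a::field_char_0) sext"
proof -
  have "lext c (lext c X) + lext c (lext c X) = 0"
    using lext_lext[of c c X] by (metis add.right_inverse)
  then have "escale 2 (lext c (lext c X)) = 0"
    by (simp add: es.scale_left_distrib[of 1 1, simplified])
  then show ?thesis by (simp only: es.scale_eq_0_iff) simp
qed

lemma lin_lext: "lin escale escale (lext c)"
  unfolding lext_def[abs_def] by (rule lin_sum_escale) (rule lin_ext)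

lemma anticomm_lext: "anticomm escale (\<lambda>i. lext (A i) :: ('r::{finite,linorder}, 'n, 'a::field_char_0) sext \<Rightarrow> _)"
  by unfold_locales (rule lin_lext lext_lext lext_sq)+

lemma ext_eone: "ext j eone = basis {j}"
  by (simp add: eone_basis ext_basis nb_def)

lemma elin_lext: "elin c = lext c eone"
proof
  fix K
  have "lext c eone K = (\<Sum>k\<in>UNIV. if K = {k} then pconst (c k) else 0)"
    unfolding lext_def sum_fun_apply ext_eone by (rule sum.cong) (auto simp: escale_def basis_def)
  also have "\<dots> = elin c K"
  proof (cases "\<exists>k. K = {k}")
    case True
    then obtain k where "K = {k}" ..
    moreover from this have "(\<Sum>l\<in>UNIV. if K = {l} then pconst (c l) else 0) = (\<Sum>l\<in>UNIV. if l = k then pconst (c k) else 0)"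
      by (intro sum.cong) auto
    ultimately show ?thesis by (simp add: elin_def)
  next
    case False
    then show ?thesis by (auto simp: elin_def card_1_singleton_iff)
  qed
  finally show "elin c K = lext c eone K" by (rule sym)
qed

lemma emult_elin: "emult (elin c) H = lext c H"
  by (simp add: elin_lext lext_def lin_sum[OF lin_emult(1)] emult_escale_left emult_ext emult_eone)

lemma ewedge_elin: "ewedge_list (map (\<lambda>i. elin (A i)) xs) = foldr (\<lambda>i. lext (A i)) xs eone"
  unfolding ewedge_list_def by (induction xs) (auto simp: emult_elin)

lemma eact_eq: "eact A \<sigma> F = (\<Sum>I\<in>UNIV. pm (\<sigma> (F I)) (foldr (\<lambda>i. lext (A i)) (sorted_list_of_set I) eone))"
  by (simp add: eact_def esum_sum embS_pm emult_pm emult_eone ewedge_elin)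

lemma eact_add: "eact A (psubst \<tau>) (F + H) = eact A (psubst \<tau>) F + eact A (psubst \<tau>) H"
  by (simp add: eact_eq psubst_add pm_add_left sum.distrib)

lemma pm_sum_right: "pm f (sum h A) = (\<Sum>i\<in>A. pm f (h i))"
  by (rule lin_sum[OF lin_pm])

lemma eact_pm: "eact A (psubst \<tau>) (pm f F) = pm (psubst \<tau> f) (eact A (psubst \<tau>) F)"
  by (simp add: eact_eq psubst_mult pm_pm[symmetric] pm_sum_right) (simp add: pm_def psubst_mult pm_pm mult.assoc)

lemma lin_eact: "lin escale escale (eact A (psubst \<tau>))"
  using eact_pm[of A \<tau> "pconst _"] by (auto simp: lin_def eact_add pm_pconst)

lemma eact_basis: "eact A (psubst \<tau>) (basis I) = foldr (\<lambda>i. lext (A i)) (sorted_list_of_set I) eone"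
proof -
  have "eact A (psubst \<tau>) (basis I) = (\<Sum>J\<in>UNIV. if J = I then foldr (\<lambda>i. lext (A i)) (sorted_list_of_set I) eone else 0)"
    unfolding eact_eq by (rule sum.cong) (auto simp: basis_def)
  then show ?thesis by simp
qed

lemma length_takeWhile_sorted:
  "length (takeWhile (\<lambda>x. \<not> j \<le> x) (sorted_list_of_set I)) = nb j I" for I :: "'r::{finite,linorder} set"
proof -
  have *: "takeWhile (\<lambda>x. \<not> j \<le> x) xs = filter (\<lambda>x. \<not> j \<le> x) xs" if "sorted xs" for xs :: "'r list"
    using that
  proof (induction xs)
    case (Cons x xs)
    then show ?case by (auto simp: filter_empty_conv eq_commute[of "[]"] intro: order_trans)
  qed simp
  have "set (filter (\<lambda>x. \<not> j \<le> x) (sorted_list_of_set I)) = {k\<in>I. k < j}" by auto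
  moreover have "distinct (filter (\<lambda>x. \<not> j \<le> x) (sorted_list_of_set I))" by simp
  ultimately show ?thesis unfolding nb_def by (simp add: * distinct_card[symmetric])
qed

text \<open>On basis forms the action is an ordered product of linear forms. A repeated index kills
  both sides; a new one must be sorted in, and the crossings are the same before and after applying
  the action.\<close>

lemma eact_ext:
  fixes F :: "('r::{finite,linorder}, 'n::finite, 'a::field_char_0) sext"
  shows "eact A (psubst \<tau>) (ext j F) = lext (A j) (eact A (psubst \<tau>) F)"
proof -
  interpret anticomm escale "\<lambda>i. lext (A i) :: ('r, 'n, 'a) sext \<Rightarrow> _" by (rule anticomm_lext)
  have basis: "eact A (psubst \<tau>) (ext j (basis I)) = lext (A j) (eact A (psubst \<tau>) (basis I))" for I
  proof (cases "j \<in> I")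
    case True
    then show ?thesis using dup[of j "sorted_list_of_set I" eone]
      by (simp add: ext_basis eact_basis lin_zero[OF lin_eact])
  next
    case False
    then have s: "sorted_list_of_set (insert j I) = insort j (sorted_list_of_set I)" by simp
    show ?thesis using False
      by (simp add: ext_basis nsg_lin[OF lin_eact] eact_basis s anticomm_insort[OF anticomm_lext]
          length_takeWhile_sorted nsg_nsg del: sorted_list_of_set_insert) (simp add: nsg_def)
  qed
  have pl: "pm f (lext c X) = lext c (pm f X)" for f c and X :: "('r, 'n, 'a) sext"
    by (simp add: lext_def pm_sum_right lin_scale[OF lin_pm] pm_ext)
  show ?thesis
    by (subst (1 2) sext_sum_basis[of F])
      (simp add: lin_sum[OF lin_ext] lin_sum[OF lin_eact] lin_sum[OF lin_lext] pm_ext[symmetric] eact_pm basis pl)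
qed

lemma eact_eone: "eact A (psubst \<tau>) eone = eone"
  by (simp add: eone_basis eact_basis)

lemma sum_sum_type: "(\<Sum>b\<in>UNIV. h b) = (\<Sum>i\<in>UNIV. h (Inl i)) + (\<Sum>j\<in>UNIV. h (Inr j))"
  for h :: "'n::finite + 'r::finite \<Rightarrow> 'b::comm_monoid_add"
  unfolding UNIV_Plus_UNIV[symmetric] by (subst sum.Plus) auto

definition blk :: "('n \<Rightarrow> 'n \<Rightarrow> 'a::comm_ring_1) \<Rightarrow> ('r \<Rightarrow> 'r \<Rightarrow> 'a) \<Rightarrow> 'n + 'r \<Rightarrow> 'n + 'r \<Rightarrow> 'a" where
  "blk P Q a b = (case a of Inl i \<Rightarrow> (case b of Inl j \<Rightarrow> P i j | Inr _ \<Rightarrow> 0)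
     | Inr i \<Rightarrow> (case b of Inl _ \<Rightarrow> 0 | Inr j \<Rightarrow> Q i j))"

lemma blk_simps [simp]: "blk P Q (Inl i) (Inl i') = P i i'" "blk P Q (Inl i) (Inr j) = 0"
  "blk P Q (Inr j) (Inl i) = 0" "blk P Q (Inr j) (Inr j') = Q j j'"
  by (auto simp: blk_def)

lemma blk_odd: "blk P Q a b \<noteq> 0 \<Longrightarrow> odd_letter a = odd_letter b"
  by (cases a; cases b) auto

lemma blk_mult: "(\<Sum>c\<in>UNIV. blk P Q a c * blk P' Q' c b)
    = blk (\<lambda>i j. \<Sum>k\<in>UNIV. P i k * P' k j) (\<lambda>i j. \<Sum>k\<in>UNIV. Q i k * Q' k j) a b"
  for a b :: "'n::finite + 'r::finite"
  by (cases a; cases b) (simp_all add: sum_sum_type)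

text \<open>Together with \<open>eact_eone\<close> and linearity this determines the action; later
  arguments use it only through letters and their block matrix.\<close>

lemma eact_zl:
  fixes X :: "('r::{finite,linorder}, 'n::finite, 'a::field_char_0) sext"
  shows "eact A (psubst (\<lambda>i. \<Sum>j\<in>UNIV. pconst (P i j) * pvar j)) (zl a X)
    = (\<Sum>b\<in>UNIV. escale (blk P A a b) (zl b (eact A (psubst (\<lambda>i. \<Sum>j\<in>UNIV. pconst (P i j) * pvar j)) X)))"
  by (cases a) (simp_all add: sum_sum_type eact_pm eact_ext pm_sum_left pm_pm[symmetric] pm_pconst lext_def)

subsection \<open>The ideal of invariants in terms of words\<close>

lemma lookup_pconst_mult: "lookup (pconst c * f) m = c * lookup f m"
  for f :: "('n, 'a::comm_ring_1) pol"
  by (induction f rule: pol_monom_induct)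
    (auto simp: pconst_mult_single lookup_single distrib_left lookup_add when_def)

lemma ehomog_lookup: "ehomog d F \<longleftrightarrow> (\<forall>I m. lookup (F I) m \<noteq> 0 \<longrightarrow> mdeg m + card I = d)"
  by (auto simp: ehomog_def in_keys_iff)

lemma ehomog_add: "ehomog d F \<Longrightarrow> ehomog d H \<Longrightarrow> ehomog d (F + H)"
  unfolding ehomog_lookup plus_fun_apply lookup_add by (metis add.right_neutral)

lemma ehomog_zero: "ehomog d 0"
  by (simp add: ehomog_lookup)

lemma ehomog_escale: "ehomog d F \<Longrightarrow> ehomog d (escale c F)"
  by (auto simp: ehomog_lookup escale_def lookup_pconst_mult dest: mult_not_zero)

lemma ehomog_sum: "(\<And>i. i \<in> A \<Longrightarrow> ehomog d (f i)) \<Longrightarrow> ehomog d (sum f A)"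
  by (induction A rule: infinite_finite_induct) (simp_all add: ehomog_zero ehomog_add)

lemma ehomog_zl: "ehomog d F \<Longrightarrow> ehomog (Suc d) (zl a F)"
  for F :: "('r::{finite,linorder}, 'n::finite, 'a::comm_ring_1) sext"
proof (cases a)
  case (Inl i)
  assume F: "ehomog d F"
  show ?thesis unfolding ehomog_def
  proof (intro allI ballI)
    fix I m assume "m \<in> keys (zl a F I)"
    then have "m \<in> keys (pvar i * F I)" by (simp add: Inl pm_def)
    then obtain x y where "m = x + y" "x \<in> keys (pvar i :: ('n, 'a) pol)" "y \<in> keys (F I)"
      using keys_mult[of "pvar i" "F I"] by blast
    then show "mdeg m + card I = Suc d"
      using F by (auto simp: pvar_def mdeg_add ehomog_def split: if_splits)
  qed
next
  case (Inr j)
  assume F: "ehomog d F"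
  show ?thesis unfolding ehomog_lookup
  proof (intro allI impI)
    fix I m assume nz: "lookup (zl a F I) m \<noteq> 0"
    then have j: "j \<in> I" by (cases "j \<in> I") (simp_all add: Inr ext_def)
    then have "lookup (F (I - {j})) m \<noteq> 0" using nz by (auto simp: Inr ext_def nsg_def split: if_splits)
    then have "mdeg m + card (I - {j}) = d" using F unfolding ehomog_lookup by blast
    moreover have "card I = Suc (card (I - {j}))" by (rule card_Suc_Diff1[symmetric]) (simp_all add: j)
    ultimately show "mdeg m + card I = Suc d" by simp
  qed
qed

lemma ehomog_one: "ehomog 0 eone"
  by (auto simp: ehomog_def eone_def split: if_splits)

text \<open>The augmentation, that is, the coefficient of 1. For a homogeneous form of positive
  degree it vanishes.\<close>

definition cc :: "('r, 'n, 'a::comm_ring_1) sext \<Rightarrow> 'a" where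
  "cc X = lookup (X {}) 0"

lemma lin_cc: "lin escale (*) cc"
  by (auto simp: lin_def cc_def lookup_add escale_def lookup_pconst_mult)

lemma lookup_pvar_mult_0: "lookup (pvar i * f) 0 = 0" for f :: "('n, 'a::comm_ring_1) pol"
proof (rule ccontr)
  assume "lookup (pvar i * f) 0 \<noteq> 0"
  then have "0 \<in> keys (pvar i * f)" by (simp add: in_keys_iff)
  then obtain x y where xy: "(0 :: 'n \<Rightarrow>\<^sub>0 nat) = x + y" "x \<in> keys (pvar i :: ('n, 'a) pol)"
    using keys_mult[of "pvar i" f] by blast
  then have "lookup x i + lookup y i = 0" by (metis lookup_add lookup_zero)
  moreover have "x = single i 1" using xy(2) by (auto simp: pvar_def split: if_splits)
  ultimately show False by simp
qed

lemma cc_zl: "cc (zl a X) = 0"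
  by (cases a) (auto simp: cc_def pm_def ext_def lookup_pvar_mult_0)

abbreviation "zw \<equiv> foldr zl"

lemma lin_zw: "lin escale escale (zw w :: ('r::{finite,linorder}, 'n::finite, 'a::comm_ring_1) sext \<Rightarrow> _)"
  by (rule lin_foldr[OF lin_letter(1)])

text \<open>Every nonempty word lies in the kernel of \<open>cc\<close>, which identifies the
  multiple of \<open>eone\<close> left over when a form is written in words.\<close>

lemma words_span:
  fixes X :: "('r::{finite,linorder}, 'n::finite, 'a::field) sext"
  shows "X - escale (cc X) eone \<in> es.span {zw u eone | u. u \<noteq> []}"
proof -
  let ?S = "{zw u eone | u. u \<noteq> []} :: ('r, 'n, 'a) sext set"
  have zl_span: "zl a Y \<in> es.span ?S" if "Y \<in> es.span ?S" for a Y
    using that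
  proof (induction rule: es.span_induct_alt)
    case base
    then show ?case by (simp only: lin_zero[OF lin_letter(1)] es.span_zero)
  next
    case (step c x y)
    then obtain u where u: "x = zw u eone" by blast
    have "zl a x \<in> ?S" unfolding u by (rule CollectI, rule exI[of _ "a # u"]) simp
    then show ?case unfolding lin_add[OF lin_letter(1)] lin_scale[OF lin_letter(1)]
      by (intro es.span_add es.span_scale step) (rule es.span_base)
  qed
  have "\<exists>c. X - escale c eone \<in> es.span ?S"
  proof (induction X rule: letter_induct)
    case (const c)
    show ?case by (rule exI[of _ c]) (simp only: diff_self es.span_zero)
  next
    case (add F H)
    then obtain c d where cd: "F - escale c eone \<in> es.span ?S" "H - escale d eone \<in> es.span ?S" by blast
    have eq: "F + H - escale (c + d) eone = (F - escale c eone) + (H - escale d eone)"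
      by (simp add: es.scale_left_distrib)
    show ?case by (rule exI[of _ "c + d"]) (unfold eq, rule es.span_add[OF cd])
  next
    case (letter a F)
    then obtain c where c: "F - escale c eone \<in> es.span ?S" by blast
    have eq: "zl a F = escale c (zl a eone) + zl a (F - escale c eone)"
      by (simp add: lin_diff[OF lin_letter(1)] lin_scale[OF lin_letter(1)])
    have mem: "zl a eone \<in> ?S" by (rule CollectI, rule exI[of _ "[a]"]) simp
    have "zl a F \<in> es.span ?S"
      by (subst eq) (rule es.span_add[OF es.span_scale[OF es.span_base[OF mem]] zl_span[OF c]])
    then show ?case by (intro exI[of _ 0]) (simp only: escale_zero diff_zero)
  qed
  then obtain c where c: "X - escale c eone \<in> es.span ?S" ..
  have "cc Y = 0" if "Y \<in> es.span ?S" for Y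
    using that
  proof (induction rule: es.span_induct_alt)
    case base
    then show ?case by (rule lin_zero[OF lin_cc])
  next
    case (step d x y)
    then obtain u where "x = zw u eone" "u \<noteq> []" by blast
    then have "cc x = 0" by (cases u) (auto simp: cc_zl)
    then show ?case unfolding lin_add[OF lin_cc] lin_scale[OF lin_cc] using step by simp
  qed
  from this[OF c] have "cc X = c * cc (eone :: ('r, 'n, 'a) sext)"
    by (simp add: lin_diff[OF lin_cc] lin_scale[OF lin_cc])
  also have "cc (eone :: ('r, 'n, 'a) sext) = 1" by (simp add: cc_def eone_def)
  finally show ?thesis using c by simp
qed

lemma words_span_UNIV:
  fixes X :: "('r::{finite,linorder}, 'n::finite, 'a::field) sext"
  shows "X \<in> es.span {zw u eone | u. True}"
proof -
  have "X - escale (cc X) eone \<in> es.span {zw u eone | u. True}"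
    by (rule subsetD[OF es.span_mono words_span]) auto
  moreover have "escale (cc X) eone \<in> es.span {zw u eone | u. True}"
    by (intro es.span_scale es.span_base CollectI exI[of _ "[]"]) simp
  ultimately have "X - escale (cc X) eone + escale (cc X) eone \<in> es.span {zw u eone | u. True}"
    by (rule es.span_add)
  then show ?thesis by simp
qed

interpretation ft: vector_space "\<lambda>c (F :: 'g \<Rightarrow> ('r, 'n, 'a::field) sext) g. escale c (F g)"
  by (rule vector_space_fun) (rule es.vector_space_axioms)

text \<open>An invariant equals each of its translates, so the elements of the ideal of invariants
  are combinations of words whose nonempty initial part is translated by a group element g,
  with coefficients independent of g.\<close>

definition translates :: "('g \<Rightarrow> 'n + 'r \<Rightarrow> ('r::{finite,linorder}, 'n::finite, 'a::field) sext \<Rightarrow> ('r, 'n, 'a) sext)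
    \<Rightarrow> ('g \<Rightarrow> ('r, 'n, 'a) sext) set" where
  "translates zg = {\<lambda>g. foldr (zg g) u (zw w eone) | u w. u \<noteq> []}"

text \<open>The span of these families is stable under multiplication by fixed forms on both sides.
  On the right only the untranslated tail changes; on the left a letter passes the translated block
  at the cost of a sign given by parities, hence the same for all g. Generators fit because positive
  degree removes the empty word.\<close>

lemma inv_ideal_words:
  fixes G :: "('a::field, 'n::finite) sqmat set"
    and act :: "('a, 'n) sqmat \<Rightarrow> ('r::{finite,linorder}, 'n, 'a) sext \<Rightarrow> ('r, 'n, 'a) sext"
  assumes lin_act: "\<And>g. lin escale escale (act g)"
    and act_one: "\<And>g. act g eone = eone"
    and act_zl: "\<And>g a X. act g (zl a X) = zg g a (act g X)"
    and lin_zg: "\<And>g a. lin escale escale (zg g a)"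
    and comm: "\<And>g a b X. zl b (zg g a X) = escale (ssgn odd_letter b a) (zg g a (zl b X))"
    and emult_zg: "\<And>g a F H. emult (zg g a F) H = zg g a (emult F H)"
    and xi: "\<xi> \<in> inv_ideal G act"
  shows "\<exists>F\<in>ft.span (translates zg). \<forall>g\<in>G. F g = \<xi>"
proof -
  let ?S = "translates zg"
  note lin_fz = lin_foldr[OF lin_zg]
  have act_word: "act g (zw u X) = foldr (zg g) u (act g X)" for g u X
    by (induction u) (simp_all add: act_zl)
  have translate: "(\<lambda>g. foldr (zg g) u (zw w a)) \<in> ft.span ?S" if "u \<noteq> []" for u w a
    using words_span_UNIV[of a]
  proof (induction rule: es.span_induct_alt)
    case base
    have "(\<lambda>g. foldr (zg g) u (zw w 0)) = 0"
      by (simp add: lin_zero[OF lin_zw] lin_zero[OF lin_fz] fun_eq_iff)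
    then show ?case by (simp only: ft.span_zero)
  next
    case (step c x y)
    then obtain v where v: "x = zw v eone" by blast
    have eq: "(\<lambda>g. foldr (zg g) u (zw w (escale c x + y)))
      = (\<lambda>g. escale c (foldr (zg g) u (zw (w @ v) eone))) + (\<lambda>g. foldr (zg g) u (zw w y))"
      by (simp add: v lin_add[OF lin_zw] lin_scale[OF lin_zw] lin_add[OF lin_fz] lin_scale[OF lin_fz] fun_eq_iff)
    have mem: "(\<lambda>g. foldr (zg g) u (zw (w @ v) eone)) \<in> ?S"
      using that unfolding translates_def by blast
    show ?case unfolding eq by (rule ft.span_add[OF ft.span_scale[OF ft.span_base[OF mem]] step(2)])
  qed
  have right: "(\<lambda>g. emult (F g) a) \<in> ft.span ?S" if "F \<in> ft.span ?S" for F a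
    using that
  proof (induction rule: ft.span_induct_alt)
    case base
    have "(\<lambda>g. emult ((0 :: ('a, 'n) sqmat \<Rightarrow> ('r, 'n, 'a) sext) g) a) = 0" by (simp add: lin_zero[OF lin_emult(1)] fun_eq_iff)
    then show ?case by (simp only: ft.span_zero)
  next
    case (step c x y)
    then obtain u w where x: "x = (\<lambda>g. foldr (zg g) u (zw w eone))" "u \<noteq> []" unfolding translates_def by blast
    have m: "emult (foldr (zg g) us X) a = foldr (zg g) us (emult X a)"
      "emult (zw us X) a = zw us (emult X a)" for us g X
      by (induction us) (simp_all add: emult_zg emult_zl)
    have eq: "(\<lambda>g. emult (((\<lambda>g. escale c (x g)) + y) g) a) =
      (\<lambda>g. escale c (foldr (zg g) u (zw w a))) + (\<lambda>g. emult (y g) a)"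
      by (simp add: x m emult_eone lin_add[OF lin_emult(1)] lin_scale[OF lin_emult(1)] fun_eq_iff)
    show ?case unfolding eq by (rule ft.span_add[OF ft.span_scale[OF translate[OF x(2), of w a]] step(2)])
  qed
  have left_letter: "(\<lambda>g. zl b (F g)) \<in> ft.span ?S" if "F \<in> ft.span ?S" for F b
    using that
  proof (induction rule: ft.span_induct_alt)
    case base
    have "(\<lambda>g. zl b ((0 :: ('a, 'n) sqmat \<Rightarrow> ('r, 'n, 'a) sext) g)) = 0" by (simp add: lin_zero[OF lin_letter(1)] fun_eq_iff)
    then show ?case by (simp only: ft.span_zero)
  next
    case (step c x y)
    then obtain u w where x: "x = (\<lambda>g. foldr (zg g) u (zw w eone))" "u \<noteq> []" unfolding translates_def by blast
    obtain e where e: "\<And>g X. zl b (foldr (zg g) u X) = escale e (foldr (zg g) u (zl b X))"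
    proof -
      have "\<exists>e. \<forall>g X. zl b (foldr (zg g) us X) = escale e (foldr (zg g) us (zl b X))" for us
      proof (induction us)
        case Nil
        then show ?case by (intro exI[of _ 1]) simp
      next
        case (Cons a us)
        then obtain e where "\<forall>g X. zl b (foldr (zg g) us X) = escale e (foldr (zg g) us (zl b X))" ..
        then show ?case
          by (intro exI[of _ "ssgn odd_letter b a * e"]) (simp add: comm lin_scale[OF lin_zg])
      qed
      then show ?thesis using that by blast
    qed
    have eq: "(\<lambda>g. zl b (((\<lambda>g. escale c (x g)) + y) g)) =
      (\<lambda>g. escale (c * e) (foldr (zg g) u (zw (b # w) eone))) + (\<lambda>g. zl b (y g))"
      by (simp add: x e lin_add[OF lin_letter(1)] lin_scale[OF lin_letter(1)] fun_eq_iff)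
    have mem: "(\<lambda>g. foldr (zg g) u (zw (b # w) eone)) \<in> ?S"
      using x(2) unfolding translates_def by blast
    show ?case unfolding eq by (rule ft.span_add[OF ft.span_scale[OF ft.span_base[OF mem]] step(2)])
  qed
  have left: "(\<lambda>g. emult a (F g)) \<in> ft.span ?S" if "F \<in> ft.span ?S" for F a
  proof (induction a rule: letter_induct)
    case (const c)
    then show ?case unfolding emult_escale_left emult_eone using that by (rule ft.span_scale)
  next
    case (add A B)
    have eq: "(\<lambda>g. emult (A + B) (F g)) = (\<lambda>g. emult A (F g)) + (\<lambda>g. emult B (F g))"
      by (simp add: emult_add_left fun_eq_iff)
    show ?case unfolding eq by (rule ft.span_add[OF add])
  next
    case (letter b A)
    then show ?case using left_letter by (simp add: emult_zl)
  qed
  show ?thesis using xi unfolding inv_ideal_def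
  proof (induction rule: ideal_gen.induct)
    case (base x)
    then have inv: "\<forall>g\<in>G. act g x = x" and "cc x = 0"
      unfolding cc_def ehomog_lookup by fastforce+
    then have "x \<in> es.span {zw u eone | u. u \<noteq> []}" using words_span[of x] by simp
    then have "(\<lambda>g. act g x) \<in> ft.span ?S"
    proof (induction rule: es.span_induct_alt)
      case base
      have "(\<lambda>g. act g 0) = 0" by (simp add: lin_zero[OF lin_act] fun_eq_iff)
      then show ?case by (simp only: ft.span_zero)
    next
      case (step c y z)
      then obtain u where u: "y = zw u eone" "u \<noteq> []" by blast
      have eq: "(\<lambda>g. act g (escale c y + z)) = (\<lambda>g. escale c (foldr (zg g) u (zw [] eone))) + (\<lambda>g. act g z)"
        by (simp add: u act_word act_one lin_add[OF lin_act] lin_scale[OF lin_act] fun_eq_iff)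
      show ?case unfolding eq by (rule ft.span_add[OF ft.span_scale[OF translate[OF u(2), of "[]" eone]] step(2)])
    qed
    then show ?case using inv by (intro bexI[of _ "\<lambda>g. act g x"]) auto
  next
    case zero
    show ?case by (intro bexI[of _ 0]) (simp_all add: ezero_zero ft.span_zero)
  next
    case (add x y)
    then obtain F H where "F \<in> ft.span ?S" "H \<in> ft.span ?S" "\<forall>g\<in>G. F g = x" "\<forall>g\<in>G. H g = y" by blast
    then show ?case by (intro bexI[of _ "F + H"]) (simp_all add: eadd_plus ft.span_add)
  next
    case (lmult x a)
    then obtain F where "F \<in> ft.span ?S" "\<forall>g\<in>G. F g = x" by blast
    then show ?case using left[of F a] by (intro bexI[of _ "\<lambda>g. emult a (F g)"]) simp_all
  next
    case (rmult x a)
    then obtain F where "F \<in> ft.span ?S" "\<forall>g\<in>G. F g = x" by blast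
    then show ?case using right[of F a] by (intro bexI[of _ "\<lambda>g. emult (F g) a"]) simp_all
  qed
qed

subsection \<open>The two contragredient actions\<close>

lemma matrix_inv_id:
  fixes A :: "('a::field, 'n::finite) sqmat"
  assumes "invertible A"
  shows "A ** matrix_inv A = mat 1" "matrix_inv A ** A = mat 1"
  using assms unfolding invertible_def matrix_inv_def by (metis (mono_tags, lifting) someI_ex)+

lemma actSd_psubst: "actSd g = psubst (\<lambda>i. \<Sum>j\<in>UNIV. pconst (matrix_inv g $ i $ j) * pvar j)"
  and actS_psubst: "actS g = psubst (\<lambda>i. \<Sum>j\<in>UNIV. pconst (g $ j $ i) * pvar j)"
  by (auto simp: actSd_def actS_def)

definition blkm :: "('a::field, 'n::finite) sqmat \<Rightarrow> ('a, 'r::finite) sqmat \<Rightarrow> 'n + 'r \<Rightarrow> 'n + 'r \<Rightarrow> 'a" where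
  "blkm A B = blk (\<lambda>i j. A $ i $ j) (\<lambda>i j. B $ i $ j)"

lemma blkm_mult: "(\<Sum>c\<in>UNIV. blkm A B a c * blkm A' B' c b) = blkm (A ** A') (B ** B') a b"
  unfolding blkm_def blk_mult by (cases a; cases b) (simp_all add: matrix_matrix_mult_def)

lemma blkm_one: "blkm (mat 1) (mat 1) a b = (if a = b then 1 else 0)"
  by (cases a; cases b) (auto simp: blkm_def mat_def)

lemma blkm_simps [simp]: "blkm A B (Inl i) (Inl i') = A $ i $ i'" "blkm A B (Inl i) (Inr j) = 0"
  "blkm A B (Inr j) (Inl i) = 0" "blkm A B (Inr j) (Inr j') = B $ j $ j'"
  by (auto simp: blkm_def)

lemma blkm_odd: "blkm A B a b \<noteq> 0 \<Longrightarrow> odd_letter a = odd_letter b"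
  unfolding blkm_def by (rule blk_odd)

lemma epair_basis:
  "epair (basis I :: ('r::finite, 'n::{finite,linorder}, 'a::field_char_0) sext) (basis I) = 1"
proof -
  have "ppair (single 0 1) (single 0 1 :: ('n, 'a) pol) = 1"
    unfolding ppair_single pair_mon_eq by simp
  then have "epair (basis I :: ('r, 'n, 'a) sext) (basis I) = (\<Sum>J\<in>UNIV. if J = I then 1 else 0)"
    unfolding epair_ppair basis_def by (intro sum.cong) auto
  then show ?thesis by simp
qed

locale refl_rep =
  fixes G :: "('a::field_char_0, 'n::{finite,linorder}) sqmat set"
    and \<rho> :: "('a, 'n) sqmat \<Rightarrow> ('a, 'r::{finite,linorder}) sqmat"
  assumes finite_G: "finite G" and one_G: "mat 1 \<in> G"
    and mult_G: "g \<in> G \<Longrightarrow> h \<in> G \<Longrightarrow> g ** h \<in> G"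
    and inv_G: "g \<in> G \<Longrightarrow> matrix_inv g \<in> G"
    and invertible_G: "g \<in> G \<Longrightarrow> invertible g"
    and rho_mult: "g \<in> G \<Longrightarrow> h \<in> G \<Longrightarrow> \<rho> (g ** h) = \<rho> g ** \<rho> h"
    and rho_one: "\<rho> (mat 1) = mat 1"
begin

lemma inv_id: "g \<in> G \<Longrightarrow> g ** matrix_inv g = mat 1" "g \<in> G \<Longrightarrow> matrix_inv g ** g = mat 1"
  using matrix_inv_id invertible_G by auto

lemma rho_inv_id: "g \<in> G \<Longrightarrow> \<rho> g ** \<rho> (matrix_inv g) = mat 1" "g \<in> G \<Longrightarrow> \<rho> (matrix_inv g) ** \<rho> g = mat 1"
  using rho_mult[of g "matrix_inv g"] rho_mult[of "matrix_inv g" g] by (auto simp: inv_G inv_id rho_one)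

lemma inverse_unique:
  fixes A B C :: "('a, 'm::finite) sqmat"
  assumes "B ** A = mat 1" "A ** C = mat 1"
  shows "B = C"
  by (metis assms matrix_mul_assoc matrix_mul_lid matrix_mul_rid)

lemma rho_inv: "g \<in> G \<Longrightarrow> matrix_inv (\<rho> g) = \<rho> (matrix_inv g)"
  using rho_inv_id[of g] matrix_inv_id[of "\<rho> g"] inverse_unique unfolding invertible_def by blast

lemma inv_mult: "g \<in> G \<Longrightarrow> h \<in> G \<Longrightarrow> matrix_inv (g ** h) = matrix_inv h ** matrix_inv g"
proof -
  assume gh: "g \<in> G" "h \<in> G"
  have "(g ** h) ** (matrix_inv h ** matrix_inv g) = g ** (h ** matrix_inv h) ** matrix_inv g"
    by (simp only: matrix_mul_assoc)
  then have "(g ** h) ** (matrix_inv h ** matrix_inv g) = mat 1"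
    using gh by (simp add: inv_id)
  moreover have "matrix_inv (g ** h) ** (g ** h) = mat 1" by (rule inv_id) (simp add: gh mult_G)
  ultimately show ?thesis using inverse_unique by blast
qed

lemma inj_mult: "g \<in> G \<Longrightarrow> inj_on ((**) g) G"
  unfolding inj_on_def by (metis inv_id(2) matrix_mul_assoc matrix_mul_lid)

lemma bij_mult: "g \<in> G \<Longrightarrow> bij_betw ((**) g) G G"
  unfolding bij_betw_def using endo_inj_surj[OF finite_G _ inj_mult] inj_mult mult_G by (simp add: image_subset_iff)

lemma inv_mult_cancel: "k \<in> G \<Longrightarrow> g \<in> G \<Longrightarrow> h \<in> G \<Longrightarrow> matrix_inv (k ** g) ** (k ** h) = matrix_inv g ** h"
proof -
  assume *: "k \<in> G" "g \<in> G" "h \<in> G"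
  have "matrix_inv (k ** g) ** (k ** h) = matrix_inv g ** (matrix_inv k ** k) ** h"
    using * by (simp only: inv_mult matrix_mul_assoc)
  then show ?thesis using * by (simp add: inv_id)
qed

text \<open>Unprimed: g on V + M and, read by rows, on the dual space. In the primed pair the odd
  blocks of M and of its dual are exchanged, since in the second Fock space odd letters act by
  contraction, and it is M that contracts the exterior algebra of the dual of M.\<close>

definition Lm :: "('a, 'n) sqmat \<Rightarrow> 'n + 'r \<Rightarrow> 'n + 'r \<Rightarrow> 'a" where "Lm g = blkm g (\<rho> g)"
definition Lv :: "('a, 'n) sqmat \<Rightarrow> 'n + 'r \<Rightarrow> 'n + 'r \<Rightarrow> 'a" where "Lv g = blkm (matrix_inv g) (matrix_inv (\<rho> g))"
definition Lm' :: "('a, 'n) sqmat \<Rightarrow> 'n + 'r \<Rightarrow> 'n + 'r \<Rightarrow> 'a" where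
  "Lm' g = blkm g (transpose (matrix_inv (\<rho> g)))"
definition Lv' :: "('a, 'n) sqmat \<Rightarrow> 'n + 'r \<Rightarrow> 'n + 'r \<Rightarrow> 'a" where
  "Lv' g = blkm (matrix_inv g) (transpose (\<rho> g))"

lemma Lm_mult: "g \<in> G \<Longrightarrow> h \<in> G \<Longrightarrow> (\<Sum>c\<in>UNIV. Lm g a c * Lm h c b) = Lm (g ** h) a b"
  by (simp add: Lm_def blkm_mult rho_mult)

lemma Lv_Lm: "g \<in> G \<Longrightarrow> Lv g = Lm (matrix_inv g)"
  by (simp add: Lm_def Lv_def rho_inv)

lemma Lv_mult: "g \<in> G \<Longrightarrow> h \<in> G \<Longrightarrow> (\<Sum>c\<in>UNIV. Lv h a c * Lv g c b) = Lv (g ** h) a b"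
  by (simp add: Lv_Lm Lm_mult inv_G mult_G inv_mult)

lemma Lm_one: "Lm (mat 1) a b = (if a = b then 1 else 0)"
  by (simp add: Lm_def rho_one blkm_one)

lemma Lv_Lv: "k \<in> G \<Longrightarrow> g \<in> G \<Longrightarrow> h \<in> G \<Longrightarrow>
    (\<Sum>c\<in>UNIV. Lv (k ** g) a c * Lm (k ** h) c b) = (\<Sum>c\<in>UNIV. Lv g a c * Lm h c b)"
  by (simp add: Lv_Lm Lm_mult inv_G mult_G inv_mult_cancel)

lemma Lv_Lm_id: "g \<in> G \<Longrightarrow> (\<Sum>c\<in>UNIV. Lv g a c * Lm g c b) = (if a = b then 1 else 0)"
  "g \<in> G \<Longrightarrow> (\<Sum>c\<in>UNIV. Lm g a c * Lv g c b) = (if a = b then 1 else 0)"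
  by (simp_all add: Lv_Lm Lm_mult inv_G inv_id Lm_one)

lemma Lv'_Lv': "k \<in> G \<Longrightarrow> g \<in> G \<Longrightarrow> h \<in> G \<Longrightarrow>
    (\<Sum>c\<in>UNIV. Lv' (k ** g) a c * Lm' (k ** h) c b) = (\<Sum>c\<in>UNIV. Lv' g a c * Lm' h c b)"
proof -
  assume *: "k \<in> G" "g \<in> G" "h \<in> G"
  have "matrix_inv (k ** h) ** (k ** g) = matrix_inv h ** g" by (rule inv_mult_cancel) (use * in auto)
  then have "\<rho> (matrix_inv (k ** h)) ** \<rho> (k ** g) = \<rho> (matrix_inv h) ** \<rho> g"
    using * by (simp add: rho_mult[symmetric] inv_G mult_G)
  then have "transpose (\<rho> (k ** g)) ** transpose (\<rho> (matrix_inv (k ** h))) = transpose (\<rho> g) ** transpose (\<rho> (matrix_inv h))"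
    by (simp only: matrix_transpose_mul[symmetric])
  then show ?thesis using * by (simp add: Lv'_def Lm'_def blkm_mult inv_mult_cancel rho_inv mult_G)
qed

sublocale F1: super_fock escale odd_letter zl dl epair eone G "(**)" Lm Lv
proof (unfold_locales)
  show "epair X (zl a Y) = epair (dl a X) Y" for a and X Y :: "('r, 'n, 'a) sext"
    by (metis epair_swap epair_zl)
  show "epair (eone :: ('r, 'n, 'a) sext) eone = 1" by (simp add: eone_basis epair_basis)
  show "Lm g a b \<noteq> 0 \<Longrightarrow> odd_letter a = odd_letter b" "Lv g a b \<noteq> 0 \<Longrightarrow> odd_letter a = odd_letter b" for g a b
    unfolding Lm_def Lv_def by (rule blkm_odd, assumption)+
qed (rule lin_letter lin_epair zl_zl dl_zl dl_one epair_zl finite_G mult_G inj_mult Lv_Lv; assumption)+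

sublocale F2: super_fock escale odd_letter zt dt epair "basis UNIV" G "(**)" Lm' Lv'
proof (unfold_locales)
  show "epair X (zt a Y) = epair (dt a X) Y" for a and X Y :: "('r, 'n, 'a) sext"
    by (metis epair_swap epair_zt)
  show "Lm' g a b \<noteq> 0 \<Longrightarrow> odd_letter a = odd_letter b" "Lv' g a b \<noteq> 0 \<Longrightarrow> odd_letter a = odd_letter b" for g a b
    unfolding Lm'_def Lv'_def by (rule blkm_odd, assumption)+
qed (rule lin_letter lin_epair zt_zt dt_zt dt_top epair_zt finite_G mult_G inj_mult Lv'_Lv' epair_basis; assumption)+

lemma lin_actVd: "lin escale escale (actVd \<rho> g)" and lin_actV: "lin escale escale (actV \<rho> g)"
  by (simp_all add: actVd_def actV_def actSd_psubst actS_psubst lin_eact)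

lemma actVd_eone: "actVd \<rho> g eone = eone" and actV_eone: "actV \<rho> g eone = eone"
  by (simp_all add: actVd_def actV_def actSd_psubst actS_psubst eact_eone)

lemma actVd_zl: "actVd \<rho> g (zl a X) = F1.Yl (a, g) (actVd \<rho> g X)"
  by (simp add: actVd_def actSd_psubst eact_zl F1.Yl_def Lv_def blkm_def)

lemma actV_zl: "actV \<rho> g (zl a X) = F1.Zl (a, g) (actV \<rho> g X)"
proof -
  have "blk (\<lambda>i j. g $ j $ i) (\<lambda>j k. \<rho> g $ k $ j) a b = Lm g b a" for b
    by (cases a; cases b) (simp_all add: Lm_def)
  then show ?thesis by (simp add: actV_def actS_psubst eact_zl F1.Zl_def)
qed

lemma actVd_Yl: "h \<in> G \<Longrightarrow> g \<in> G \<Longrightarrow> actVd \<rho> h (F1.Yl (a, g) X) = F1.Yl (a, h ** g) (actVd \<rho> h X)"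
proof -
  assume gh: "h \<in> G" "g \<in> G"
  have "actVd \<rho> h (F1.Yl (a, g) X) = (\<Sum>b\<in>UNIV. \<Sum>c\<in>UNIV. escale (Lv g a b * Lv h b c) (zl c (actVd \<rho> h X)))"
    by (simp add: F1.Yl_def lin_sum[OF lin_actVd] lin_scale[OF lin_actVd] actVd_zl escale_sum escale_escale)
  also have "\<dots> = (\<Sum>c\<in>UNIV. escale (\<Sum>b\<in>UNIV. Lv g a b * Lv h b c) (zl c (actVd \<rho> h X)))"
    by (subst sum.swap) (simp add: es.scale_sum_left)
  finally show ?thesis using gh by (simp add: Lv_mult F1.Yl_def)
qed

lemma actV_Zl: "h \<in> G \<Longrightarrow> g \<in> G \<Longrightarrow> actV \<rho> h (F1.Zl (a, g) X) = F1.Zl (a, h ** g) (actV \<rho> h X)"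
proof -
  assume gh: "h \<in> G" "g \<in> G"
  have "actV \<rho> h (F1.Zl (a, g) X) = (\<Sum>b\<in>UNIV. \<Sum>c\<in>UNIV. escale (Lm h c b * Lm g b a) (zl c (actV \<rho> h X)))"
    by (simp add: F1.Zl_def lin_sum[OF lin_actV] lin_scale[OF lin_actV] actV_zl escale_sum escale_escale mult.commute)
  also have "\<dots> = (\<Sum>c\<in>UNIV. escale (\<Sum>b\<in>UNIV. Lm h c b * Lm g b a) (zl c (actV \<rho> h X)))"
    by (subst sum.swap) (simp add: es.scale_sum_left)
  finally show ?thesis using gh by (simp add: Lm_mult F1.Zl_def)
qed

lemma actVd_words: "h \<in> G \<Longrightarrow> snd ` set W \<subseteq> G \<Longrightarrow>
    actVd \<rho> h (F1.Yw W X) = F1.Yw (map (\<lambda>v. (fst v, h ** snd v)) W) (actVd \<rho> h X)"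
  by (induction W) (auto simp: actVd_Yl)

lemma actV_words: "h \<in> G \<Longrightarrow> snd ` set W \<subseteq> G \<Longrightarrow>
    actV \<rho> h (F1.Zw W X) = F1.Zw (map (\<lambda>v. (fst v, h ** snd v)) W) (actV \<rho> h X)"
  by (induction W) (auto simp: actV_Zl)

lemma actVd_mult: "g \<in> G \<Longrightarrow> h \<in> G \<Longrightarrow> actVd \<rho> g (actVd \<rho> h X) = actVd \<rho> (g ** h) X"
proof (induction X rule: letter_induct)
  case (const c)
  then show ?case by (simp only: lin_scale[OF lin_actVd] actVd_eone)
next
  case (add F H)
  then show ?case by (simp only: lin_add[OF lin_actVd])
next
  case (letter a F)
  then show ?case by (simp add: actVd_zl actVd_Yl)
qed

lemma Zl_one: "F1.Zl (a, mat 1) X = zl a X"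
  by (simp add: F1.Zl_def Lm_one if_distrib if_distribR cong: if_cong)

lemma zl_Yl: "zl b (F1.Yl (a, g) X) = escale (ssgn odd_letter b a) (F1.Yl (a, g) (zl b X))"
proof -
  have "zl b (F1.Yl (a, g) X) = (\<Sum>c\<in>UNIV. escale (Lv g a c * ssgn odd_letter b c) (zl c (zl b X)))"
    unfolding F1.Yl_def by (simp add: lin_sum[OF lin_letter(1)] lin_scale[OF lin_letter(1)] zl_zl[of b] escale_escale)
  also have "\<dots> = (\<Sum>c\<in>UNIV. escale (ssgn odd_letter b a * Lv g a c) (zl c (zl b X)))"
    by (rule sum.cong) (use F1.Li_par[of g a] in \<open>auto simp: ssgn_def\<close>)
  finally show ?thesis by (simp add: F1.Yl_def escale_sum escale_escale)
qed

lemma zl_Zl: "zl b (F1.Zl (a, g) X) = escale (ssgn odd_letter b a) (F1.Zl (a, g) (zl b X))"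
proof -
  have "zl b (F1.Zl (a, g) X) = (\<Sum>c\<in>UNIV. escale (Lm g c a * ssgn odd_letter b c) (zl c (zl b X)))"
    unfolding F1.Zl_def by (simp add: lin_sum[OF lin_letter(1)] lin_scale[OF lin_letter(1)] zl_zl[of b] escale_escale)
  also have "\<dots> = (\<Sum>c\<in>UNIV. escale (ssgn odd_letter b a * Lm g c a) (zl c (zl b X)))"
    by (rule sum.cong) (use F1.L_par[of g _ a] in \<open>auto simp: ssgn_def\<close>)
  finally show ?thesis by (simp add: F1.Zl_def escale_sum escale_escale)
qed

lemma emult_Yl: "emult (F1.Yl v F) H = F1.Yl v (emult F H)" and emult_Zl: "emult (F1.Zl v F) H = F1.Zl v (emult F H)"
  by (simp_all add: F1.Yl_def F1.Zl_def lin_sum[OF lin_emult(1)] lin_scale[OF lin_emult(1)] emult_zl)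

lemma inv_ideal_actVd: "\<xi> \<in> inv_ideal G (actVd \<rho>) \<Longrightarrow>
    \<exists>F\<in>ft.span (translates (\<lambda>g a. F1.Yl (a, g))). \<forall>g\<in>G. F g = \<xi>"
  by (rule inv_ideal_words[of "actVd \<rho>"])
    (simp_all add: lin_actVd actVd_eone actVd_zl F1.lin_Yl zl_Yl emult_Yl)

lemma inv_ideal_actV: "\<xi> \<in> inv_ideal G (actV \<rho>) \<Longrightarrow>
    \<exists>F\<in>ft.span (translates (\<lambda>g a. F1.Zl (a, g))). \<forall>g\<in>G. F g = \<xi>"
  by (rule inv_ideal_words[of "actV \<rho>"])
    (simp_all add: lin_actV actV_eone actV_zl F1.lin_Zl zl_Zl emult_Zl)

lemma ehomog_Zl: "ehomog d X \<Longrightarrow> ehomog (Suc d) (F1.Zl v X)" and ehomog_Yl: "ehomog d X \<Longrightarrow> ehomog (Suc d) (F1.Yl v X)"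
  unfolding F1.Zl_def F1.Yl_def by (auto intro!: ehomog_sum ehomog_escale ehomog_zl)

lemma ehomog_Zw: "ehomog (length W) (F1.Zw W eone)" and ehomog_Yw: "ehomog (length W) (F1.Yw W eone)"
  by (induction W) (auto intro: ehomog_one ehomog_Zl ehomog_Yl)

lemma orbit_sum_invariant:
  assumes lin: "lin escale escale (act h)" and h: "h \<in> G" and W: "snd ` set W \<subseteq> G"
    and act: "\<And>V. snd ` set V \<subseteq> G \<Longrightarrow> act h (w V) = w (map (\<lambda>v. (fst v, h ** snd v)) V)"
  shows "act h (\<Sum>g\<in>G. w (map (\<lambda>v. (fst v, g ** snd v)) W)) = (\<Sum>g\<in>G. w (map (\<lambda>v. (fst v, g ** snd v)) W))"
proof -
  have "act h (\<Sum>g\<in>G. w (map (\<lambda>v. (fst v, g ** snd v)) W)) = (\<Sum>g\<in>G. w (map (\<lambda>v. (fst v, (h ** g) ** snd v)) W))"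
    unfolding lin_sum[OF lin]
  proof (rule sum.cong[OF refl])
    fix g assume "g \<in> G"
    then have "snd ` set (map (\<lambda>v. (fst v, g ** snd v)) W) \<subseteq> G" using W mult_G by auto
    then show "act h (w (map (\<lambda>v. (fst v, g ** snd v)) W)) = w (map (\<lambda>v. (fst v, (h ** g) ** snd v)) W)"
      by (simp add: act comp_def matrix_mul_assoc)
  qed
  also have "\<dots> = (\<Sum>g\<in>G. w (map (\<lambda>v. (fst v, g ** snd v)) W))"
    by (rule sum.reindex_bij_betw[OF bij_mult[OF h]])
  finally show ?thesis .
qed

lemma sum_Zw_invariant:
  "snd ` set W \<subseteq> G \<Longrightarrow> h \<in> G \<Longrightarrow> actV \<rho> h (\<Sum>g\<in>G. F1.Zw (map (\<lambda>v. (fst v, g ** snd v)) W) eone)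
    = (\<Sum>g\<in>G. F1.Zw (map (\<lambda>v. (fst v, g ** snd v)) W) eone)"
  by (rule orbit_sum_invariant[where w = "\<lambda>W. F1.Zw W eone"]) (simp_all add: lin_actV actV_words actV_eone)

lemma sum_Yw_invariant:
  "snd ` set W \<subseteq> G \<Longrightarrow> h \<in> G \<Longrightarrow> actVd \<rho> h (\<Sum>g\<in>G. F1.Yw (map (\<lambda>v. (fst v, g ** snd v)) W) eone)
    = (\<Sum>g\<in>G. F1.Yw (map (\<lambda>v. (fst v, g ** snd v)) W) eone)"
  by (rule orbit_sum_invariant[where w = "\<lambda>W. F1.Yw W eone"]) (simp_all add: lin_actVd actVd_words actVd_eone)

lemma invariant_in_ideal:
  "0 < d \<Longrightarrow> ehomog d \<xi> \<Longrightarrow> (\<And>g. g \<in> G \<Longrightarrow> act g \<xi> = \<xi>) \<Longrightarrow> \<xi> \<in> inv_ideal G act"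
  unfolding inv_ideal_def by (rule ideal_gen.base) auto

end

section \<open>Harmonics meet the ideal of invariants in zero\<close>

context refl_rep
begin

lemma inv_one: "matrix_inv (mat 1) = (mat 1 :: ('a, 'n) sqmat)"
  using inv_id(1)[OF one_G] by simp

lemma Yl_one: "F1.Yl (a, mat 1) X = zl a X"
  by (simp add: F1.Yl_def Lv_Lm[OF one_G] inv_one Lm_one if_distrib if_distribR cong: if_cong)

lemma emult_Zw: "emult (F1.Zw W X) H = F1.Zw W (emult X H)"
  by (induction W) (simp_all add: emult_Zl)

lemma plain_Zw: "F1.Zw (map (\<lambda>a. (a, mat 1)) u) X = zw u X"
  by (induction u) (simp_all add: Zl_one)

lemma epair_words_zero:
  assumes "\<And>u. epair f (zw u eone) = 0"
  shows "f = (0 :: ('r, 'n, 'a) sext)"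
proof (rule epair_nondegenerate)
  fix X :: "('r, 'n, 'a) sext"
  show "epair f X = 0" using words_span_UNIV[of X]
  proof (induction rule: es.span_induct_alt)
    case base
    then show ?case by (rule lin_zero[OF lin_epair(2)])
  next
    case (step c x y)
    then show ?case unfolding lin_add[OF lin_epair(2)] lin_scale[OF lin_epair(2)] using assms by auto
  qed
qed

text \<open>As an element of the ideal, \<open>f\<close> is a constant value of a family of partly
  translated dual words; as a harmonic form, it is orthogonal to the corresponding sums of words on
  the other side. \<open>F1.orthogonal_to_dual_family\<close> turns these facts into orthogonality
  to every word.\<close>

theorem harmonic_inter_ideal:
  assumes harm: "f \<in> harmonics (inv_ideal G (actV \<rho>))" and ideal: "f \<in> inv_ideal G (actVd \<rho>)"
  shows "f = 0"
proof -
  \<comment> \<open>Letters labelled \<open>True\<close> come from the invariant factor and are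
    translated by \<open>g\<close>; those labelled \<open>False\<close> belong to the cofactor and
    stay fixed.\<close>
  define \<gamma> where "\<gamma> g = (\<lambda>l. if l then g else mat 1)" for g :: "('a, 'n) sqmat"
  define P where "P = {map (\<lambda>b. (b, True)) us @ map (\<lambda>b. (b, False)) ws | us ws :: bool list. us \<noteq> []}"
  let ?N = "{\<lambda>\<gamma>. F1.Yw (map (F1.act \<gamma>) V) eone | V. F1.labelled V \<and> F1.pat V \<in> P}"
  have inj: "inj \<gamma>" by (auto simp: inj_on_def \<gamma>_def fun_eq_iff)
  obtain F where F: "F \<in> ft.span (translates (\<lambda>g a. F1.Yl (a, g)))" "\<forall>g\<in>G. F g = f"
    using inv_ideal_actVd[OF ideal] by blast
  have "\<exists>F'\<in>ft.span ?N. \<forall>g. F' (\<gamma> g) = F g" using F(1)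
  proof (induction rule: ft.span_induct_alt)
    case base
    show ?case by (rule bexI[OF _ ft.span_zero]) simp
  next
    case (step c x y)
    then obtain u w where x: "x = (\<lambda>g. foldr (\<lambda>a. F1.Yl (a, g)) u (zw w eone))" "u \<noteq> []"
      unfolding translates_def by blast
    obtain F' where F': "F' \<in> ft.span ?N" "\<forall>g. F' (\<gamma> g) = y g" using step by blast
    define V where "V = map (\<lambda>a. ((a, mat 1 :: ('a, 'n) sqmat), True)) u @ map (\<lambda>a. ((a, mat 1), False)) w"
    have "F1.labelled V" by (auto simp: F1.labelled_def V_def F1.A_def one_G)
    moreover have "F1.pat V = map (\<lambda>b. (b, True)) (map odd_letter u) @ map (\<lambda>b. (b, False)) (map odd_letter w)"
      by (simp add: V_def F1.pat_def)
    then have "F1.pat V \<in> P" unfolding P_def using x(2) by blast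
    ultimately have V: "(\<lambda>\<gamma>. F1.Yw (map (F1.act \<gamma>) V) eone) \<in> ?N" by blast
    have "F1.Yw (map (F1.act (\<gamma> g)) V) eone = x g" for g
    proof -
      have 1: "F1.Yw (map (\<lambda>a. (a, mat 1)) w) X = zw w X" for X by (induction w) (simp_all add: Yl_one)
      have 2: "F1.Yw (map (\<lambda>a. (a, g)) u) X = foldr (\<lambda>a. F1.Yl (a, g)) u X" for X by (induction u) simp_all
      have "map (F1.act (\<gamma> g)) V = map (\<lambda>a. (a, g)) u @ map (\<lambda>a. (a, mat 1)) w"
        by (simp add: V_def F1.act_def \<gamma>_def)
      then show ?thesis by (simp add: x(1) 1 2)
    qed
    then show ?case using F'(2)
      by (intro bexI[OF _ ft.span_add[OF ft.span_scale[OF ft.span_base[OF V], of c] F'(1)]]) simp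
  qed
  then obtain F' where F': "F' \<in> ft.span ?N" "\<And>g. F' (\<gamma> g) = F g" by blast
  have zero: "epair f (F1.Zw W eone) = 0" if W: "set W \<subseteq> F1.A" for W
  proof (rule F1.orthogonal_to_dual_family[of "\<gamma> ` G" F' P f W])
    show "finite (\<gamma> ` G)" "\<gamma> ` G \<noteq> {}" using finite_G one_G by auto
    show "\<And>\<delta> l. \<delta> \<in> \<gamma> ` G \<Longrightarrow> \<delta> l \<in> G" using one_G by (auto simp: \<gamma>_def)
    show "\<And>\<delta>. \<delta> \<in> \<gamma> ` G \<Longrightarrow> F' \<delta> = f" using F'(2) F(2) by auto
    show "F' \<in> ft.span ?N" by (rule F')
    show "set W \<subseteq> F1.A" by (rule W)
    fix C assume C: "F1.labelled C" "F1.pat C \<in> P"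
    then obtain us ws :: "bool list" where uw: "F1.pat C = map (\<lambda>b. (b, True)) us @ map (\<lambda>b. (b, False)) ws" "us \<noteq> []"
      unfolding P_def by blast
    define C1 where "C1 = take (length us) C"
    define C2 where "C2 = drop (length us) C"
    have "map snd C1 = take (length us) (map snd (F1.pat C))" "map snd C2 = drop (length us) (map snd (F1.pat C))"
      by (simp_all add: C1_def C2_def F1.pat_def take_map drop_map comp_def)
    then have ms: "map snd C1 = map (\<lambda>_. True) us" "map snd C2 = map (\<lambda>_. False) ws"
      by (simp_all add: uw comp_def)
    have len: "length C1 = length us" using arg_cong[OF ms(1), of length] by simp
    have lab: "\<forall>v\<in>set C1. snd v" "\<forall>v\<in>set C2. \<not> snd v"
    proof -
      have "snd v \<in> set (map snd C1)" if "v \<in> set C1" for v using that by simp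
      then show "\<forall>v\<in>set C1. snd v" unfolding ms by fastforce
      have "snd v \<in> set (map snd C2)" if "v \<in> set C2" for v using that by simp
      then show "\<forall>v\<in>set C2. \<not> snd v" unfolding ms by fastforce
    qed
    have CC: "C = C1 @ C2" by (simp add: C1_def C2_def)
    have lG: "snd ` set (map fst C1) \<subseteq> G" using C(1) by (auto simp: F1.labelled_def F1.A_def CC)
    have m: "map (F1.act (\<gamma> g)) C = map (\<lambda>v. (fst v, g ** snd v)) (map fst C1) @ map fst C2" for g
      using lab by (auto simp: CC F1.act_def \<gamma>_def prod_eq_iff)
    \<comment> \<open>The orbit sum of a nonempty word is a homogeneous invariant of positive
      degree. Its product with the fixed word of \<open>C2\<close> is the sum of the translates of
      \<open>C\<close>, so harmonicity gives the required orthogonality.\<close>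
    define \<xi> where "\<xi> = (\<Sum>g\<in>G. F1.Zw (map (\<lambda>v. (fst v, g ** snd v)) (map fst C1)) eone)"
    have "\<xi> \<in> inv_ideal G (actV \<rho>)"
    proof (rule invariant_in_ideal)
      show "0 < length C1" using uw(2) len by simp
      show "ehomog (length C1) \<xi>" unfolding \<xi>_def
      proof (rule ehomog_sum)
        fix g
        show "ehomog (length C1) (F1.Zw (map (\<lambda>v. (fst v, g ** snd v)) (map fst C1)) (eone :: ('r, 'n, 'a) sext))"
          using ehomog_Zw[of "map (\<lambda>v. (fst v, g ** snd v)) (map fst C1)"] by simp
      qed
      show "actV \<rho> g \<xi> = \<xi>" if "g \<in> G" for g
        unfolding \<xi>_def by (rule sum_Zw_invariant[OF lG that])
    qed
    then have "emult \<xi> (F1.Zw (map fst C2) eone) \<in> inv_ideal G (actV \<rho>)"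
      unfolding inv_ideal_def by (rule ideal_gen.rmult)
    then have "epair f (emult \<xi> (F1.Zw (map fst C2) eone)) = 0"
      using harm by (auto simp: harmonics_def)
    moreover have "emult \<xi> (F1.Zw (map fst C2) eone) = (\<Sum>g\<in>G. F1.Zw (map (F1.act (\<gamma> g)) C) eone)"
      unfolding \<xi>_def lin_sum[OF lin_emult(1)] m by (simp add: emult_Zw emult_eone)
    ultimately have "(\<Sum>g\<in>G. epair f (F1.Zw (map (F1.act (\<gamma> g)) C) eone)) = 0"
      by (simp add: lin_sum[OF lin_epair(2)])
    then show "(\<Sum>\<delta>\<in>\<gamma> ` G. epair f (F1.Zw (map (F1.act \<delta>) C) eone)) = 0"
      using inj by (subst sum.reindex) (auto simp: inj_on_def)
  qed
  show ?thesis
  proof (rule epair_words_zero)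
    fix u
    show "epair f (zw u eone) = 0"
      using zero[of "map (\<lambda>a. (a, mat 1)) u"] one_G by (auto simp: plain_Zw F1.A_def)
  qed
qed

end

subsection \<open>Harmonicity\<close>

definition dst :: "('r \<Rightarrow> ('n, 'a) pol) \<Rightarrow> ('r::{finite,linorder}, 'n::{finite,linorder}, 'a::comm_ring_1) sext \<Rightarrow> ('r, 'n, 'a) sext" where
  "dst s X = (\<Sum>j\<in>UNIV. ext j (pD (s j) X))"

lemma sum_delta_mult: "(\<Sum>j\<in>UNIV. (if j = k then 1 else 0) * f j) = f k"
  for f :: "'r::finite \<Rightarrow> 'b::comm_ring_1"
proof -
  have "(\<Sum>j\<in>UNIV. (if j = k then 1 else 0) * f j) = (\<Sum>j\<in>UNIV. if j = k then f j else 0)"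
    by (rule sum.cong) auto
  then show ?thesis by simp
qed

lemma sum_delta_escale: "(\<Sum>j\<in>UNIV. escale (if j = k then 1 else 0) (f j)) = f k"
  for f :: "'i::finite \<Rightarrow> ('r, 'n, 'a::comm_ring_1) sext"
proof -
  have "(\<Sum>j\<in>UNIV. escale (if j = k then 1 else 0) (f j)) = (\<Sum>j\<in>UNIV. if j = k then f j else 0)"
    by (rule sum.cong) auto
  then show ?thesis by simp
qed

lemma dstar_dst:
  fixes s :: "'r::{finite,linorder} \<Rightarrow> ('n::{finite,linorder}, 'a::comm_ring_1) pol"
  shows "dstar s = dst s"
proof
  fix F :: "('r, 'n, 'a) sext"
  have "lext (\<lambda>k. if k = j then 1 else 0) X = ext j X" for j and X :: "('r, 'n, 'a) sext"
    by (simp add: lext_def if_distribR if_distrib cong: if_cong)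
  then show "dstar s F = dst s F"
    by (simp add: dstar_def esum_sum emult_elin dst_def pD_def)
qed

lemma lin_dst: "lin escale escale (dst s)"
proof -
  have "lin escale escale (\<lambda>X. ext j (pD (s j) X))" for j
    by (rule lin_comp[OF lin_pD lin_ext])
  then show ?thesis using lin_sum_escale[of UNIV "\<lambda>j X. ext j (pD (s j) X)" "\<lambda>_. 1"]
    by (simp add: dst_def[abs_def])
qed

lemma dst_dst: "dst s (dst t X) = - dst t (dst s X)"
proof -
  have "dst s (dst t X) = (\<Sum>j\<in>UNIV. \<Sum>k\<in>UNIV. ext j (ext k (pD (s j) (pD (t k) X))))"
    by (simp add: dst_def lin_sum[OF lin_ext] lin_sum[OF lin_pD] pD_ext)
  also have "\<dots> = (\<Sum>j\<in>UNIV. \<Sum>k\<in>UNIV. - ext k (ext j (pD (t k) (pD (s j) X))))"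
    by (intro sum.cong refl) (subst ext_ext, subst pD_commute, rule refl)
  also have "\<dots> = - dst t (dst s X)"
    by (subst sum.swap) (simp add: dst_def lin_sum[OF lin_ext] lin_sum[OF lin_pD] pD_ext sum_negf)
  finally show ?thesis .
qed

lemma eq_neg_self_zero: "X = - X \<Longrightarrow> X = 0"
  for X :: "('r, 'n, 'a::field_char_0) sext"
proof -
  assume "X = - X"
  then have "X + X = 0" by (metis add.right_inverse)
  then have "escale 2 X = 0" by (simp add: es.scale_left_distrib[of 1 1, simplified])
  then show ?thesis by (simp only: es.scale_eq_0_iff) simp
qed

lemma dst_sq: "dst s (dst s X) = 0"
  for X :: "('r::{finite,linorder}, 'n::{finite,linorder}, 'a::field_char_0) sext"
  by (rule eq_neg_self_zero) (rule dst_dst)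

lemma anticomm_dst: "anticomm escale (\<lambda>i. dst (tw i) ::
    ('r::{finite,linorder}, 'n::{finite,linorder}, 'a::field_char_0) sext \<Rightarrow> _)"
  by unfold_locales (rule lin_dst dst_dst dst_sq)+

lemma dstar_seq_foldr: "dstar_seq tw I X = foldr (\<lambda>i. dst (tw i)) (sorted_list_of_set I) X"
proof -
  have "foldr (\<lambda>i h. dstar (tw i) \<circ> h) xs id X = foldr (\<lambda>i. dst (tw i)) xs X" for xs
    by (induction xs) (simp_all add: dstar_dst)
  then show ?thesis by (simp add: dstar_seq_def)
qed

lemma pd_pD: "pd i (pD s X) = pD s (pd i X)"
  by (simp only: pD_pvar[symmetric] pD_commute)

text \<open>Contraction by the k-th basis vector anticommutes with every \<open>ext j\<close> except
  \<open>ext k\<close>, which leaves behind the k-th coefficient as a differential operator.\<close>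

lemma dl_dst: "dl (Inl i) (dst s X) = dst s (dl (Inl i) X)"
  "dl (Inr k) (dst s X) = pD (s k) X - dst s (dl (Inr k) X)"
proof -
  show "dl (Inl i) (dst s X) = dst s (dl (Inl i) X)"
    by (simp add: dst_def lin_sum[OF lin_pd] pd_ext pd_pD)
  have "dl (Inr k) (dst s X) = (\<Sum>j\<in>UNIV. (if j = k then pD (s k) X else 0) - ext j (pD (s j) (ctr k X)))"
    unfolding dst_def letter_simps lin_sum[OF lin_ctr] by (rule sum.cong) (auto simp: ctr_ext pD_ctr)
  then show "dl (Inr k) (dst s X) = pD (s k) X - dst s (dl (Inr k) X)"
    by (simp add: sum_subtractf dst_def)
qed

text \<open>Total degree d - k, written additively: for k > d it forces the form to be zero instead
  of truncating the subtraction.\<close>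

definition lowers :: "nat \<Rightarrow> nat \<Rightarrow> ('r, 'n::finite, 'a::comm_ring_1) sext \<Rightarrow> bool" where
  "lowers d k F \<longleftrightarrow> (\<forall>I m. lookup (F I) m \<noteq> 0 \<longrightarrow> mdeg m + card I + k = d)"

lemma lowers_add: "lowers d k F \<Longrightarrow> lowers d k H \<Longrightarrow> lowers d k (F + H)"
  unfolding lowers_def plus_fun_apply lookup_add by (metis add.right_neutral)

lemma lowers_sum_escale: "(\<And>i. i \<in> A \<Longrightarrow> lowers d k (f i)) \<Longrightarrow> lowers d k (\<Sum>i\<in>A. escale (c i) (f i))"
proof (induction A rule: infinite_finite_induct)
  case (insert x A)
  have "lowers d k (escale (c x) (f x))" using insert.prems[of x]
    by (auto simp: lowers_def escale_def lookup_pconst_mult dest: mult_not_zero)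
  then show ?case unfolding sum.insert[OF insert.hyps]
    by (rule lowers_add) (rule insert.IH, rule insert.prems, simp)
qed (auto simp: lowers_def)

lemma keys_pderiv_var: "m \<in> keys (pderiv_var i f) \<Longrightarrow> \<exists>m'\<in>keys f. mdeg m' = Suc (mdeg m)"
  for f :: "('n::finite, 'a::comm_ring_1) pol"
proof -
  assume "m \<in> keys (pderiv_var i f)"
  then have "(\<Sum>m'\<in>keys f. lookup (single (m' - single i 1) (of_nat (lookup m' i) * lookup f m')) m) \<noteq> 0"
    by (simp add: pderiv_var_def in_keys_iff lookup_sum)
  then obtain m' where m': "m' \<in> keys f" "lookup (single (m' - single i 1) (of_nat (lookup m' i) * lookup f m')) m \<noteq> 0"
    by (meson sum.not_neutral_contains_not_neutral)
  then have "m = m' - single i 1" "lookup m' i > 0"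
    by (auto simp: lookup_single when_def split: if_splits intro: gr0I)
  then have "m' = single i 1 + m" using monom_split by metis
  then have "mdeg m' = Suc (mdeg m)" by (simp add: mdeg_add)
  then show ?thesis using m'(1) by blast
qed

lemma lowers_dl: "lowers d k F \<Longrightarrow> lowers d (Suc k) (dl a F)"
  for F :: "('r::{finite,linorder}, 'n::finite, 'a::comm_ring_1) sext"
proof (cases a)
  case (Inl i)
  assume F: "lowers d k F"
  show ?thesis unfolding lowers_def
  proof (intro allI impI)
    fix I m assume "lookup (dl a F I) m \<noteq> 0"
    then have "m \<in> keys (pderiv_var i (F I))" by (simp add: Inl pd_def in_keys_iff)
    then obtain m' where "m' \<in> keys (F I)" "mdeg m' = Suc (mdeg m)" using keys_pderiv_var by blast
    then show "mdeg m + card I + Suc k = d" using F unfolding lowers_def in_keys_iff by fastforce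
  qed
next
  case (Inr j)
  assume F: "lowers d k F"
  show ?thesis unfolding lowers_def
  proof (intro allI impI)
    fix I m assume nz: "lookup (dl a F I) m \<noteq> 0"
    then have j: "j \<notin> I" by (cases "j \<in> I") (simp_all add: Inr ctr_def)
    then have "lookup (F (insert j I)) m \<noteq> 0" using nz by (auto simp: Inr ctr_def nsg_def split: if_splits)
    then show "mdeg m + card I + Suc k = d" using F j unfolding lowers_def by fastforce
  qed
qed

definition scalar_form :: "('r, 'n, 'a::comm_ring_1) sext \<Rightarrow> bool" where
  "scalar_form F \<longleftrightarrow> (\<forall>I. I \<noteq> {} \<longrightarrow> F I = 0)"

lemma scalar_form_pm: "scalar_form F \<Longrightarrow> F = pm (F {}) eone"
  by (auto simp: scalar_form_def pm_def eone_def fun_eq_iff)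

lemma scalar_form_sum_escale: "(\<And>i. i \<in> A \<Longrightarrow> scalar_form (f i)) \<Longrightarrow> scalar_form (\<Sum>i\<in>A. escale (c i) (f i))"
  by (auto simp: scalar_form_def sum_fun_apply escale_def intro: sum.neutral)

lemma scalar_form_dl: "scalar_form F \<Longrightarrow> scalar_form (dl a F)"
  for F :: "('r::{finite,linorder}, 'n::finite, 'a::comm_ring_1) sext"
  by (cases a) (auto simp: scalar_form_def pd_def ctr_def)

section \<open>Averaged contractions and harmonicity\<close>

context refl_rep
begin

definition Dl :: "('n + 'r) \<times> ('a, 'n) sqmat \<Rightarrow> ('r, 'n, 'a) sext \<Rightarrow> ('r, 'n, 'a) sext" where
  "Dl v X = (\<Sum>b\<in>UNIV. escale (Lm (snd v) b (fst v)) (dl b X))"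

text \<open>The adjoint of a translated word; \<open>fold\<close> because taking adjoints reverses
  the order of the factors.\<close>

abbreviation "Dg g \<equiv> fold (\<lambda>a. Dl (a, g))"

lemma lin_Dl: "lin escale escale (Dl v)"
  unfolding Dl_def[abs_def] by (rule lin_sum_escale) (rule lin_letter)

lemma lin_Dg: "lin escale escale (Dg g u)"
proof (induction u)
  case Nil
  then show ?case by (simp add: lin_def)
next
  case (Cons a u)
  then show ?case using lin_comp[OF lin_Dl[of "(a, g)"] Cons] by (simp add: comp_def)
qed

lemma epair_Zl: "epair X (F1.Zl v Y) = epair (Dl v X) Y"
  by (simp add: F1.Zl_def Dl_def lin_sum[OF lin_epair(1)] lin_sum[OF lin_epair(2)] lin_scale[OF lin_epair(1)]
      lin_scale[OF lin_epair(2)] F1.adj2)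

lemma epair_Zg: "epair X (foldr (\<lambda>a. F1.Zl (a, g)) u Y) = epair (Dg g u X) Y"
  by (induction u arbitrary: X) (simp_all add: epair_Zl)

text \<open>Both sides vanish on constants and obey the same rule for passing a letter. Signs match
  since \<open>Lv\<close> does not mix parities.\<close>

lemma dl_actVd: "dl a (actVd \<rho> h X) = (\<Sum>b\<in>UNIV. escale (Lv h b a) (actVd \<rho> h (dl b X)))"
proof (induction X arbitrary: a rule: letter_induct)
  case (const c)
  show ?case
    by (simp only: lin_scale[OF lin_actVd] actVd_eone lin_scale[OF lin_letter(2)] dl_one lin_zero[OF lin_actVd]
        escale_0_right sum.neutral_const)
next
  case (add F H)
  then show ?case
    by (simp only: lin_add[OF lin_actVd] lin_add[OF lin_letter(2)] escale_add sum.distrib)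
next
  case (letter e X)
  let ?\<Phi> = "actVd \<rho> h"
  have par: "Lv h e f \<noteq> 0 \<Longrightarrow> odd_letter e = odd_letter f" for e f by (rule F1.Li_par)
  have "dl a (?\<Phi> (zl e X)) = (\<Sum>f\<in>UNIV. escale (Lv h e f) (dl a (zl f (?\<Phi> X))))"
    by (simp add: actVd_zl F1.Yl_def lin_sum[OF lin_letter(2)] lin_scale[OF lin_letter(2)])
  also have "\<dots> = (\<Sum>f\<in>UNIV. escale (Lv h e f * (if a = f then 1 else 0)) (?\<Phi> X))
     + (\<Sum>f\<in>UNIV. escale (Lv h e f * ssgn odd_letter a f) (zl f (dl a (?\<Phi> X))))"
    by (simp only: dl_zl escale_add escale_escale sum.distrib)
  also have "(\<Sum>f\<in>UNIV. escale (Lv h e f * (if a = f then 1 else 0)) (?\<Phi> X)) = escale (Lv h e a) (?\<Phi> X)"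
    by (simp add: if_distrib if_distribR cong: if_cong)
  also have "(\<Sum>f\<in>UNIV. escale (Lv h e f * ssgn odd_letter a f) (zl f (dl a (?\<Phi> X))))
    = (\<Sum>f\<in>UNIV. \<Sum>b\<in>UNIV. escale (Lv h e f * ssgn odd_letter a f * Lv h b a) (zl f (?\<Phi> (dl b X))))"
    unfolding letter lin_sum[OF lin_letter(1)] lin_scale[OF lin_letter(1)] escale_sum escale_escale ..
  also have "\<dots> = (\<Sum>b\<in>UNIV. \<Sum>f\<in>UNIV. escale (Lv h b a * ssgn odd_letter b e * Lv h e f) (zl f (?\<Phi> (dl b X))))"
  proof (subst sum.swap, intro sum.cong refl)
    fix b f
    have "Lv h e f * ssgn odd_letter a f * Lv h b a = Lv h b a * ssgn odd_letter b e * Lv h e f"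
      using par[of e f] par[of b a] by (cases "Lv h e f = 0 \<or> Lv h b a = 0") (auto simp: ssgn_def)
    then show "escale (Lv h e f * ssgn odd_letter a f * Lv h b a) (zl f (?\<Phi> (dl b X)))
      = escale (Lv h b a * ssgn odd_letter b e * Lv h e f) (zl f (?\<Phi> (dl b X)))" by simp
  qed
  also have "\<dots> = (\<Sum>b\<in>UNIV. escale (Lv h b a * ssgn odd_letter b e) (?\<Phi> (zl e (dl b X))))"
    by (simp add: actVd_zl F1.Yl_def escale_sum escale_escale)
  also have "escale (Lv h e a) (?\<Phi> X) = (\<Sum>b\<in>UNIV. escale (Lv h b a * (if b = e then 1 else 0)) (?\<Phi> X))"
    by (simp add: if_distrib if_distribR cong: if_cong)
  also have "(\<Sum>b\<in>UNIV. escale (Lv h b a * (if b = e then 1 else 0)) (?\<Phi> X)) +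
      (\<Sum>b\<in>UNIV. escale (Lv h b a * ssgn odd_letter b e) (?\<Phi> (zl e (dl b X))))
    = (\<Sum>b\<in>UNIV. escale (Lv h b a) (?\<Phi> (dl b (zl e X))))"
    by (simp only: dl_zl lin_add[OF lin_actVd] lin_scale[OF lin_actVd] escale_add escale_escale sum.distrib)
  finally show ?case .
qed

lemma actVd_dl: "h \<in> G \<Longrightarrow> actVd \<rho> h (dl b X) = (\<Sum>a\<in>UNIV. escale (Lm h a b) (dl a (actVd \<rho> h X)))"
proof -
  assume h: "h \<in> G"
  have "(\<Sum>a\<in>UNIV. escale (Lm h a b) (dl a (actVd \<rho> h X)))
    = (\<Sum>c\<in>UNIV. \<Sum>a\<in>UNIV. escale (Lv h c a * Lm h a b) (actVd \<rho> h (dl c X)))"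
    unfolding dl_actVd escale_sum escale_escale by (subst sum.swap) (simp add: mult.commute)
  also have "\<dots> = (\<Sum>c\<in>UNIV. escale (if c = b then 1 else 0) (actVd \<rho> h (dl c X)))"
    by (simp only: es.scale_sum_left[symmetric] Lv_Lm_id[OF h])
  also have "\<dots> = actVd \<rho> h (dl b X)" by (rule sum_delta_escale)
  finally show ?thesis by simp
qed

lemma actVd_Dl: "h \<in> G \<Longrightarrow> g \<in> G \<Longrightarrow> actVd \<rho> h (Dl (a, g) X) = Dl (a, h ** g) (actVd \<rho> h X)"
proof -
  assume gh: "h \<in> G" "g \<in> G"
  have "actVd \<rho> h (Dl (a, g) X) = (\<Sum>b\<in>UNIV. \<Sum>c\<in>UNIV. escale (Lm h c b * Lm g b a) (dl c (actVd \<rho> h X)))"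
    by (simp add: Dl_def lin_sum[OF lin_actVd] lin_scale[OF lin_actVd] actVd_dl[OF gh(1)] escale_sum escale_escale mult.commute)
  also have "\<dots> = (\<Sum>c\<in>UNIV. escale (\<Sum>b\<in>UNIV. Lm h c b * Lm g b a) (dl c (actVd \<rho> h X)))"
    by (subst sum.swap) (simp add: es.scale_sum_left)
  finally show ?thesis using gh by (simp add: Lm_mult Dl_def)
qed

lemma actVd_Dg: "h \<in> G \<Longrightarrow> g \<in> G \<Longrightarrow> actVd \<rho> h (Dg g u X) = Dg (h ** g) u (actVd \<rho> h X)"
  by (induction u arbitrary: X) (simp_all add: actVd_Dl)

text \<open>Annihilation by the contractions with the averages of all nonempty words.\<close>

definition Kill :: "('r, 'n, 'a) sext \<Rightarrow> bool" where
  "Kill X \<longleftrightarrow> (\<forall>u. u \<noteq> [] \<longrightarrow> (\<Sum>g\<in>G. Dg g u X) = 0)"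

text \<open>An element of the ideal is the common value on \<open>G\<close> of a family of words
  whose initial block is translated. Averaging over \<open>G\<close> and moving that block to the
  left as its adjoint produces exactly the sums that \<open>Kill\<close> annihilates.\<close>

lemma Kill_harmonic:
  assumes "Kill X"
  shows "X \<in> harmonics (inv_ideal G (actV \<rho>))"
  unfolding harmonics_def
proof (safe)
  fix \<xi> assume "\<xi> \<in> inv_ideal G (actV \<rho>)"
  then obtain F where F: "F \<in> ft.span (translates (\<lambda>g a. F1.Zl (a, g)))" "\<forall>g\<in>G. F g = \<xi>"
    using inv_ideal_actV by blast
  have "(\<Sum>g\<in>G. epair X (F g)) = 0" using F(1)
  proof (induction rule: ft.span_induct_alt)
    case base
    show "(\<Sum>g\<in>G. epair X ((0 :: ('a, 'n) sqmat \<Rightarrow> ('r, 'n, 'a) sext) g)) = 0"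
      by (simp add: lin_zero[OF lin_epair(2)])
  next
    case (step c x y)
    then obtain u w where x: "x = (\<lambda>g. foldr (\<lambda>a. F1.Zl (a, g)) u (zw w eone))" "u \<noteq> []"
      unfolding translates_def by blast
    have "(\<Sum>g\<in>G. epair X (x g)) = epair (\<Sum>g\<in>G. Dg g u X) (zw w eone)"
      unfolding x(1) epair_Zg lin_sum[OF lin_epair(1)] ..
    also have "\<dots> = 0" using assms x(2) by (simp add: Kill_def lin_zero[OF lin_epair(1)])
    finally have "(\<Sum>g\<in>G. epair X (x g)) = 0" .
    then show "(\<Sum>g\<in>G. epair X (((\<lambda>g. escale c (x g)) + y) g)) = 0"
      using step(2) by (simp add: lin_add[OF lin_epair(2)] lin_scale[OF lin_epair(2)]
        sum.distrib sum_distrib_left[symmetric])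
  qed
  then have "of_nat (card G) * epair X \<xi> = 0" using F(2) by simp
  then show "epair X \<xi> = 0" using finite_G one_G by auto
qed

lemma pD_actS_pvar: "pD (actS g (pvar i)) X = Dl (Inl i, g) X"
proof -
  have "pD (\<Sum>j\<in>A. pconst (g $ j $ i) * pvar j) X = (\<Sum>j\<in>A. escale (g $ j $ i) (pd j X))" for A
    by (induction A rule: infinite_finite_induct) (simp_all add: pD_add pD_mult pD_pconst pD_pvar)
  then show ?thesis by (simp add: actS_psubst Dl_def sum_sum_type Lm_def)
qed

text \<open>Each variable of \<open>s\<close> acts as one more translated letter between
  \<open>u\<close> and \<open>u'\<close>. Every monomial but the constant one thus yields an
  averaged contraction by a nonempty word, which vanishes.\<close>

lemma Kill_pD:
  assumes X: "Kill X"
  shows "(\<Sum>g\<in>G. Dg g u' (pD (actS g s) (Dg g u X))) = escale (lookup s 0) (\<Sum>g\<in>G. Dg g (u @ u') X)"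
proof (induction s arbitrary: u rule: pol_induct)
  case (const c)
  have "lookup (pconst c :: ('n, 'a) pol) 0 = c" by (simp add: pconst_def)
  then show ?case by (simp add: actS_psubst pD_pconst lin_scale[OF lin_Dg] escale_sum)
next
  case (add f g)
  then show ?case
    by (simp del: plus_fun_apply add: actS_psubst psubst_add pD_add lin_add[OF lin_Dg] sum.distrib lookup_add es.scale_left_distrib)
next
  case (var i s)
  have "(\<Sum>g\<in>G. Dg g u' (pD (actS g (pvar i * s)) (Dg g u X))) =
      (\<Sum>g\<in>G. Dg g u' (pD (actS g s) (Dg g (u @ [Inl i]) X)))"
  proof (intro sum.cong refl)
    fix g
    have "actS g (pvar i * s) = actS g s * actS g (pvar i)"
      by (simp only: actS_psubst psubst_mult mult.commute)
    then show "Dg g u' (pD (actS g (pvar i * s)) (Dg g u X)) = Dg g u' (pD (actS g s) (Dg g (u @ [Inl i]) X))"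
      by (simp add: pD_mult pD_actS_pvar)
  qed
  also have "\<dots> = escale (lookup s 0) (\<Sum>g\<in>G. Dg g ((u @ [Inl i]) @ u') X)" by (rule var)
  also have "\<dots> = 0" using X unfolding Kill_def by (metis append_is_Nil_conv escale_0_right not_Cons_self2)
  finally show ?case by (simp add: lookup_pvar_mult_0)
qed

text \<open>Invariance of the sum of the \<open>s b\<close> tensored with the dual basis, evaluated
  at g times the k-th basis vector of M.\<close>

lemma actSMd_contract:
  assumes "g \<in> G" "actSMd \<rho> g s = s"
  shows "(\<Sum>b\<in>UNIV. pconst (\<rho> g $ b $ k) * s b) = actS g (s k)"
proof -
  have s: "s b = (\<Sum>j\<in>UNIV. pconst (matrix_inv (\<rho> g) $ j $ b) * actS g (s j))" for b
    using fun_cong[OF assms(2), of b] by (simp add: actSMd_def)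
  have "(\<Sum>b\<in>UNIV. pconst (\<rho> g $ b $ k) * s b) =
    (\<Sum>b\<in>UNIV. \<Sum>j\<in>UNIV. pconst (\<rho> g $ b $ k) * (pconst (matrix_inv (\<rho> g) $ j $ b) * actS g (s j)))"
    by (subst s) (simp add: sum_distrib_left)
  also have "\<dots> = (\<Sum>j\<in>UNIV. \<Sum>b\<in>UNIV. pconst (matrix_inv (\<rho> g) $ j $ b * \<rho> g $ b $ k) * actS g (s j))"
    by (subst sum.swap) (simp add: pconst_mult mult_ac)
  also have "\<dots> = (\<Sum>j\<in>UNIV. pconst ((matrix_inv (\<rho> g) ** \<rho> g) $ j $ k) * actS g (s j))"
    by (simp add: sum_distrib_right[symmetric] pconst_sum matrix_matrix_mult_def)
  also have "\<dots> = (\<Sum>j\<in>UNIV. (if j = k then 1 else 0) * actS g (s j))"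
    using assms(1) by (simp add: rho_inv rho_inv_id mat_def if_distrib cong: if_cong)
  also have "\<dots> = actS g (s k)" by (rule sum_delta_mult)
  finally show ?thesis .
qed

lemma pD_sum_left: "pD (\<Sum>i\<in>A. f i) X = (\<Sum>i\<in>A. pD (f i) X)"
  by (induction A rule: infinite_finite_induct) (simp_all add: pD_add)

lemma Dl_dst:
  assumes "g \<in> G" "actSMd \<rho> g s = s"
  shows "Dl (Inl i, g) (dst s X) = dst s (Dl (Inl i, g) X)"
    "Dl (Inr k, g) (dst s X) = pD (actS g (s k)) X - dst s (Dl (Inr k, g) X)"
proof -
  show "Dl (Inl i, g) (dst s X) = dst s (Dl (Inl i, g) X)"
    by (simp add: Dl_def sum_sum_type Lm_def dl_dst(1)[unfolded letter_simps] lin_sum[OF lin_dst] lin_scale[OF lin_dst])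
  have "Dl (Inr k, g) (dst s X) = (\<Sum>b\<in>UNIV. escale (\<rho> g $ b $ k) (pD (s b) X - dst s (ctr b X)))"
    by (simp add: Dl_def sum_sum_type Lm_def dl_dst(2)[unfolded letter_simps])
  also have "\<dots> = pD (\<Sum>b\<in>UNIV. pconst (\<rho> g $ b $ k) * s b) X - dst s (\<Sum>b\<in>UNIV. escale (\<rho> g $ b $ k) (ctr b X))"
    by (simp add: es.scale_right_diff_distrib sum_subtractf pD_sum_left pD_mult pD_pconst lin_sum[OF lin_dst] lin_scale[OF lin_dst])
  also have "(\<Sum>b\<in>UNIV. escale (\<rho> g $ b $ k) (ctr b X)) = Dl (Inr k, g) X"
    by (simp add: Dl_def sum_sum_type Lm_def)
  finally show "Dl (Inr k, g) (dst s X) = pD (actS g (s k)) X - dst s (Dl (Inr k, g) X)"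
    by (simp only: actSMd_contract[OF assms])
qed

text \<open>Translated letters are moved past \<open>dst s\<close> one by one. An even letter
  commutes with it; an odd letter anticommutes up to the operator of a translated coefficient, which
  \<open>Kill_pD\<close> reduces to its constant term. That constant term must be zero when the word
  is a single odd letter, where \<open>Kill X\<close> gives nothing.\<close>

lemma Kill_dst:
  assumes X: "Kill X" and s: "\<And>g. g \<in> G \<Longrightarrow> actSMd \<rho> g s = s" and s0: "\<And>k. lookup (s k) 0 = 0"
  shows "Kill (dst s X)"
proof -
  \<comment> \<open>The induction is on the letters \<open>u'\<close> still outside
    \<open>dst s\<close>; those of \<open>u\<close> have already been moved inside.\<close>
  have "u @ u' \<noteq> [] \<Longrightarrow> (\<Sum>g\<in>G. Dg g u' (dst s (Dg g u X))) = 0" for u u'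
  proof (induction u' arbitrary: u)
    case Nil
    then show ?case using X by (simp add: lin_sum[OF lin_dst, symmetric] Kill_def lin_zero[OF lin_dst])
  next
    case (Cons a u')
    have IH: "(\<Sum>g\<in>G. Dg g u' (dst s (Dl (a, g) (Dg g u X)))) = 0"
      using Cons.IH[of "u @ [a]"] by (simp del: zero_fun_apply)
    show ?case
    proof (cases a)
      case (Inl i)
      have "(\<Sum>g\<in>G. Dg g (a # u') (dst s (Dg g u X))) = (\<Sum>g\<in>G. Dg g u' (dst s (Dl (a, g) (Dg g u X))))"
        by (rule sum.cong[OF refl]) (simp add: Inl Dl_dst s)
      also note IH
      finally show ?thesis .
    next
      case (Inr k)
      have "(\<Sum>g\<in>G. Dg g (a # u') (dst s (Dg g u X))) =
        (\<Sum>g\<in>G. Dg g u' (pD (actS g (s k)) (Dg g u X)) - Dg g u' (dst s (Dl (a, g) (Dg g u X))))"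
        by (rule sum.cong[OF refl]) (simp add: Inr Dl_dst s lin_diff[OF lin_Dg])
      also have "\<dots> = escale (lookup (s k) 0) (\<Sum>g\<in>G. Dg g (u @ u') X)"
        unfolding sum_subtractf Kill_pD[OF X] IH by (rule diff_zero)
      also have "\<dots> = 0" unfolding s0 by (rule escale_zero)
      finally show ?thesis .
    qed
  qed
  from this[of "[]"] show ?thesis by (simp add: Kill_def)
qed

lemma actVd_pm: "actVd \<rho> h (pm f F) = pm (actSd h f) (actVd \<rho> h F)"
  by (simp add: actVd_def actSd_psubst eact_pm)

text \<open>An averaged contraction of \<Delta> is again a semiinvariant polynomial, hence a
  multiple of \<Delta>; but a nonempty word makes its degree smaller than that of \<Delta>, so it is
  zero.\<close>

lemma Kill_semiinvariant:
  assumes chi: "\<And>g. g \<in> G \<Longrightarrow> actSd g \<Delta> = pconst (chi g) * \<Delta>"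
    and gen: "\<And>f. (\<And>g. g \<in> G \<Longrightarrow> actSd g f = pconst (chi g) * f) \<Longrightarrow> \<exists>a. f = a * \<Delta>"
    and homog: "phomog d \<Delta>"
  shows "Kill (embS \<Delta>)"
  unfolding Kill_def
proof (intro allI impI)
  fix u :: "('n + 'r) list" assume u: "u \<noteq> []"
  define Y where "Y = (\<Sum>g\<in>G. Dg g u (embS \<Delta>))"
  have sD: "scalar_form (Dg g v F)" if "scalar_form F" for g v F
    using that
  proof (induction v arbitrary: F)
    case (Cons a v)
    have "scalar_form (Dl (a, g) F)" unfolding Dl_def
      by (intro scalar_form_sum_escale scalar_form_dl Cons.prems)
    from Cons.IH[OF this] show ?case by simp
  qed simp
  have lD: "lowers d (k + length v) (Dg g v F)" if "lowers d k F" for g v F k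
    using that
  proof (induction v arbitrary: F k)
    case (Cons a v)
    have "lowers d (Suc k) (Dl (a, g) F)" unfolding Dl_def by (intro lowers_sum_escale lowers_dl Cons.prems)
    from Cons.IH[OF this] show ?case by simp
  qed simp
  have "scalar_form (embS \<Delta> :: ('r, 'n, 'a) sext)" by (simp add: scalar_form_def embS_def)
  then have Ys: "scalar_form Y" unfolding Y_def
    using scalar_form_sum_escale[of G "\<lambda>g. Dg g u (embS \<Delta>)" "\<lambda>_. 1"] sD by simp
  have "lowers d 0 (embS \<Delta> :: ('r, 'n, 'a) sext)"
    using homog by (auto simp: lowers_def embS_def phomog_def in_keys_iff)
  then have Yl: "lowers d (length u) Y" unfolding Y_def
    using lowers_sum_escale[of G d "length u" "\<lambda>g. Dg g u (embS \<Delta>)" "\<lambda>_. 1"] lD[of 0] by simp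
  have act: "actVd \<rho> h Y = escale (chi h) Y" if h: "h \<in> G" for h
  proof -
    have e: "actVd \<rho> h (embS \<Delta>) = escale (chi h) (embS \<Delta>)"
      by (simp add: embS_pm actVd_pm actVd_eone chi[OF h] pm_pconst pm_pm[symmetric])
    have "actVd \<rho> h Y = (\<Sum>g\<in>G. Dg (h ** g) u (escale (chi h) (embS \<Delta>)))"
      unfolding Y_def lin_sum[OF lin_actVd] by (rule sum.cong) (simp_all add: actVd_Dg h e)
    also have "\<dots> = (\<Sum>g\<in>G. Dg g u (escale (chi h) (embS \<Delta>)))"
      by (rule sum.reindex_bij_betw[OF bij_mult[OF h]])
    finally show ?thesis by (simp add: Y_def lin_scale[OF lin_Dg] escale_sum)
  qed
  have "actSd h (Y {}) = pconst (chi h) * Y {}" if h: "h \<in> G" for h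
  proof -
    have "pm (actSd h (Y {})) eone = actVd \<rho> h Y"
      by (subst scalar_form_pm[OF Ys]) (simp add: actVd_pm actVd_eone)
    also have "\<dots> = escale (chi h) Y" by (rule act[OF h])
    finally have eq: "pm (actSd h (Y {})) eone = escale (chi h) Y" .
    show ?thesis using fun_cong[OF eq, of "{}"] by (simp add: pm_def eone_def escale_def)
  qed
  then obtain a where a: "Y {} = a * \<Delta>" using gen by blast
  have "Y {} = 0"
  proof (rule ccontr)
    assume "Y {} \<noteq> 0"
    then obtain m where m: "m \<in> keys (Y {})" by (metis keys_eq_empty equals0I)
    then have "mdeg m + card ({} :: 'r set) + length u = d" using Yl unfolding lowers_def in_keys_iff by blast
    then have "mdeg m + length u = d" by simp
    moreover obtain x y where "m = x + y" "y \<in> keys \<Delta>" using m keys_mult[of a \<Delta>] unfolding a by blast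
    then have "mdeg m \<ge> d" using homog by (simp add: mdeg_add phomog_def)
    moreover have "length u > 0" using u by simp
    ultimately show False by linarith
  qed
  then show "(\<Sum>g\<in>G. Dg g u (embS \<Delta>)) = 0"
    using scalar_form_pm[OF Ys] by (simp add: Y_def)
qed

lemma actVd_pD: "h \<in> G \<Longrightarrow> actVd \<rho> h (pD s X) = pD (actS h s) (actVd \<rho> h X)"
proof (induction s arbitrary: X rule: pol_induct)
  case (const c)
  then show ?case by (simp add: pD_pconst actS_psubst lin_scale[OF lin_actVd])
next
  case (add f g)
  then show ?case by (simp only: pD_add actS_psubst psubst_add lin_add[OF lin_actVd])
next
  case (var i s)
  have "actVd \<rho> h (pd i Y) = pD (actS h (pvar i)) (actVd \<rho> h Y)" for Y
    using actVd_dl[OF var.prems, of "Inl i" Y] by (simp add: pD_actS_pvar Dl_def)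
  then have "actVd \<rho> h (pD (pvar i * s) X) = pD (actS h (pvar i)) (pD (actS h s) (actVd \<rho> h X))"
    using var by (simp add: pD_mult pD_pvar)
  also have "\<dots> = pD (actS h (pvar i * s)) (actVd \<rho> h X)"
    by (simp only: actS_psubst psubst_mult pD_mult)
  finally show ?case .
qed

lemma actVd_dst:
  assumes "h \<in> G" "actSMd \<rho> h s = s"
  shows "actVd \<rho> h (dst s X) = dst s (actVd \<rho> h X)"
proof -
  have e: "actVd \<rho> h (ext j Y) = (\<Sum>k\<in>UNIV. escale (matrix_inv (\<rho> h) $ j $ k) (ext k (actVd \<rho> h Y)))" for j Y
    using actVd_zl[of h "Inr j" Y] by (simp add: F1.Yl_def sum_sum_type Lv_def)
  have "actVd \<rho> h (dst s X) = (\<Sum>j\<in>UNIV. \<Sum>k\<in>UNIV. ext k (pD (pconst (matrix_inv (\<rho> h) $ j $ k) * actS h (s j)) (actVd \<rho> h X)))"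
    by (simp add: dst_def lin_sum[OF lin_actVd] e actVd_pD[OF assms(1)] pD_mult pD_pconst lin_scale[OF lin_ext])
  also have "\<dots> = (\<Sum>k\<in>UNIV. ext k (pD (actSMd \<rho> h s k) (actVd \<rho> h X)))"
    by (subst sum.swap) (simp add: actSMd_def pD_sum_left lin_sum[OF lin_ext])
  finally show ?thesis by (simp add: assms(2) dst_def)
qed

text \<open>The constant terms form an invariant linear form \<open>t\<close> on M. Its k-th
  coordinate is, up to the order of \<open>G\<close>, its value on the orbit sum of the k-th basis
  vector, and that sum is an invariant vector, hence zero.\<close>

lemma constant_term_zero:
  assumes M: "\<And>v. (\<forall>g\<in>G. \<rho> g *v v = v) \<Longrightarrow> v = 0" and s: "\<And>g. g \<in> G \<Longrightarrow> actSMd \<rho> g s = s"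
  shows "lookup (s k) 0 = 0"
proof -
  define t where "t = (\<chi> k. lookup (s k) 0)"
  have c0: "lookup (actS g f) 0 = lookup f 0" for g and f :: "('n, 'a) pol"
  proof (induction f rule: pol_induct)
    case (var i f)
    have "lookup ((\<Sum>j\<in>A. pconst (g $ j $ i) * pvar j) * h) 0 = 0" for A and h :: "('n, 'a) pol"
      by (induction A rule: infinite_finite_induct)
        (simp_all add: distrib_right lookup_add mult.assoc lookup_pconst_mult lookup_pvar_mult_0)
    then show ?case by (simp add: actS_psubst psubst_pvar_mult lookup_pvar_mult_0)
  qed (simp_all add: actS_psubst psubst_add lookup_add)
  have t: "t v* (\<rho> g) = t" if g: "g \<in> G" for g
  proof -
    have "(\<Sum>b\<in>UNIV. \<rho> g $ b $ k * t $ b) = t $ k" for k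
    proof -
      have "(\<Sum>b\<in>UNIV. \<rho> g $ b $ k * t $ b) = lookup (\<Sum>b\<in>UNIV. pconst (\<rho> g $ b $ k) * s b) 0"
        by (simp add: lookup_sum lookup_pconst_mult t_def)
      also have "\<dots> = lookup (actS g (s k)) 0" by (simp only: actSMd_contract[OF g s[OF g]])
      finally show ?thesis by (simp add: c0 t_def)
    qed
    then show ?thesis by (simp add: vec_eq_iff vector_matrix_mult_def mult.commute)
  qed
  define v where "v = (\<Sum>g\<in>G. \<rho> g *v axis k 1)"
  have "\<rho> h *v v = v" if h: "h \<in> G" for h
  proof -
    have "\<rho> h *v v = (\<Sum>g\<in>G. \<rho> h *v (\<rho> g *v axis k 1))"
      unfolding v_def by (induction G rule: infinite_finite_induct) (simp_all add: matrix_vector_right_distrib)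
    also have "\<dots> = (\<Sum>g\<in>G. \<rho> (h ** g) *v axis k 1)"
      by (rule sum.cong) (simp_all add: matrix_vector_mul_assoc rho_mult h)
    also have "\<dots> = v" unfolding v_def by (rule sum.reindex_bij_betw[OF bij_mult[OF h]])
    finally show ?thesis .
  qed
  then have "v = 0" using M by blast
  define ip where "ip x y = (\<Sum>i\<in>UNIV. x $ i * y $ i)" for x y :: "('a, 'r) vec"
  have "ip t (\<rho> g *v axis k 1) = t $ k" if g: "g \<in> G" for g
  proof -
    have "ip t (\<rho> g *v axis k 1) = (\<Sum>i\<in>UNIV. \<rho> g $ i $ k * t $ i)"
      by (simp add: ip_def matrix_vector_mult_def axis_def if_distrib mult.commute cong: if_cong)
    also have "\<dots> = (t v* \<rho> g) $ k" by (simp add: vector_matrix_mult_def mult.commute)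
    finally show ?thesis using t[OF g] by simp
  qed
  then have "ip t v = of_nat (card G) * t $ k"
    unfolding v_def ip_def sum_component sum_distrib_left by (subst sum.swap) simp
  moreover have "ip t v = 0" using \<open>v = 0\<close> by (simp add: ip_def)
  ultimately have "t $ k = 0" using finite_G one_G by auto
  then show ?thesis by (simp add: t_def)
qed

end

subsection \<open>Contractions, determinants and semiinvariant forms\<close>

definition th :: "('r \<Rightarrow> ('n, 'a) pol) \<Rightarrow> ('r::{finite,linorder}, 'n::{finite,linorder}, 'a::comm_ring_1) sext \<Rightarrow> ('r, 'n, 'a) sext" where
  "th w X = (\<Sum>k\<in>UNIV. pm (w k) (ctr k X))"

lemma th_pm: "th w (pm f X) = pm f (th w X)"
  by (simp add: th_def pm_ctr[symmetric] pm_pm pm_sum_right mult.commute)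

lemma lin_th: "lin escale escale (th w)"
proof -
  have "th w (X + Y) = th w X + th w Y" for X Y
    by (simp add: th_def lin_add[OF lin_ctr] lin_add[OF lin_pm] sum.distrib)
  moreover have "th w (escale c X) = escale c (th w X)" for c X
    using th_pm[of w "pconst c" X] by (simp add: pm_pconst)
  ultimately show ?thesis by (simp add: lin_def)
qed

lemma th_th: "th w (th v X) = - th v (th w X)"
proof -
  have "th w (th v X) = (\<Sum>j\<in>UNIV. \<Sum>k\<in>UNIV. pm (w j * v k) (ctr j (ctr k X)))"
    by (simp add: th_def lin_sum[OF lin_ctr] pm_sum_right pm_ctr[symmetric] pm_pm)
  also have "\<dots> = (\<Sum>j\<in>UNIV. \<Sum>k\<in>UNIV. - pm (v k * w j) (ctr k (ctr j X)))"
    by (intro sum.cong refl) (subst ctr_ctr, simp only: lin_minus[OF lin_pm] mult.commute)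
  also have "\<dots> = - th v (th w X)"
    by (subst sum.swap) (simp add: th_def lin_sum[OF lin_ctr] pm_sum_right pm_ctr[symmetric] pm_pm sum_negf)
  finally show ?thesis .
qed

lemma th_sq: "th w (th w X) = 0"
  for X :: "('r::{finite,linorder}, 'n::{finite,linorder}, 'a::field_char_0) sext"
  by (rule eq_neg_self_zero) (rule th_th)

lemma anticomm_th: "anticomm escale (\<lambda>i. th (w i) ::
    ('r::{finite,linorder}, 'n::{finite,linorder}, 'a::field_char_0) sext \<Rightarrow> _)"
  by unfold_locales (rule lin_th th_th th_sq)+

lemma sum_PiE_insert:
  assumes "x \<notin> S"
  shows "(\<Sum>p\<in>Pi\<^sub>E (insert x S) T. h p) = (\<Sum>y\<in>T x. \<Sum>p\<in>Pi\<^sub>E S T. h (p(x := y)))"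
  unfolding PiE_insert_eq
  by (subst sum.reindex[OF inj_combinator[OF assms]]) (simp add: sum.cartesian_product case_prod_unfold)

lemma foldr_th_expand:
  "distinct xs \<Longrightarrow> foldr (\<lambda>i. th (w i)) xs X =
    (\<Sum>p\<in>Pi\<^sub>E (set xs) (\<lambda>_. UNIV). pm (\<Prod>i\<in>set xs. w i (p i)) (foldr ctr (map p xs) X))"
proof (induction xs)
  case Nil
  then show ?case by simp
next
  case (Cons x xs)
  then have x: "x \<notin> set xs" "distinct xs" by auto
  have upd: "(\<Prod>i\<in>set xs. w i ((p(x := y)) i)) = (\<Prod>i\<in>set xs. w i (p i))"
    "map (p(x := y)) xs = map p xs" for p y
    using x by (auto intro!: prod.cong)
  have "foldr (\<lambda>i. th (w i)) (x # xs) X =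
    (\<Sum>y\<in>UNIV. \<Sum>p\<in>Pi\<^sub>E (set xs) (\<lambda>_. UNIV). pm (w x y * (\<Prod>i\<in>set xs. w i (p i))) (ctr y (foldr ctr (map p xs) X)))"
    using Cons.IH[OF x(2)]
    by (simp add: th_def[of "w x"] lin_sum[OF lin_ctr] pm_sum_right pm_ctr[symmetric] pm_pm)
  also have "\<dots> = (\<Sum>y\<in>UNIV. \<Sum>p\<in>Pi\<^sub>E (set xs) (\<lambda>_. UNIV).
      pm (\<Prod>i\<in>set (x # xs). w i ((p(x := y)) i)) (foldr ctr (map (p(x := y)) (x # xs)) X))"
    using x by (simp add: upd del: fun_upd_apply) simp
  also have "\<dots> = (\<Sum>p\<in>Pi\<^sub>E (set (x # xs)) (\<lambda>_. UNIV). pm (\<Prod>i\<in>set (x # xs). w i (p i)) (foldr ctr (map p (x # xs)) X))"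
    by (simp only: list.set sum_PiE_insert[OF x(1)])
  finally show ?case .
qed

lemma pm_minus_left: "pm (- f) Y = - pm f Y"
  by (auto simp: pm_def)

lemma foldr_ctr_perm:
  assumes "p permutes (UNIV :: 'r set)"
  shows "foldr ctr (map p (sorted_list_of_set UNIV)) X =
    pm (of_int (sign p)) (foldr ctr (sorted_list_of_set (UNIV :: 'r::{finite,linorder} set)) X)"
  using assms finite[of UNIV]
proof (induction rule: permutes_induct)
  case id
  show ?case by (simp add: sign_id)
next
  case (swap a b p)
  have perm: "permutation p" using swap.hyps by (meson finite permutation_permutes)
  have "distinct (map p (sorted_list_of_set UNIV))"
    using permutes_inj[OF swap.hyps(4)] by (simp add: distinct_map inj_on_def)
  moreover have "a \<in> set (map p (sorted_list_of_set UNIV))" "b \<in> set (map p (sorted_list_of_set UNIV))"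
    using permutes_surj[OF swap.hyps(4)] by auto
  ultimately have f: "foldr ctr (map (Transposition.transpose a b) (map p (sorted_list_of_set UNIV))) X
     = - foldr ctr (map p (sorted_list_of_set UNIV)) X"
    using swap.hyps(3) by (rule ctrs.swap_transpose)
  have sgn: "sign (Transposition.transpose a b \<circ> p) = - sign p"
    using sign_compose[OF permutation_swap_id perm, of a b] swap.hyps(3) by (simp add: sign_swap_id)
  show ?case unfolding map_map[symmetric] f sgn swap.IH of_int_minus pm_minus_left ..
qed

lemma ctr_basis:
  "ctr j (basis I :: ('r::{finite,linorder}, 'n, 'a::comm_ring_1) sext) =
    (if j \<in> I then nsg (nb j I) (basis (I - {j})) else 0)"
proof
  fix K
  show "ctr j (basis I :: ('r, 'n, 'a) sext) K = (if j \<in> I then nsg (nb j I) (basis (I - {j})) else 0) K"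
  proof (cases "j \<notin> K \<and> insert j K = I")
    case True
    then have K: "K = I - {j}" "j \<in> I" by auto
    have n: "nb j I = nb j K" using nb_insert[of j j K] True by simp
    have "ctr j (basis I :: ('r, 'n, 'a) sext) K = nsg (nb j K) 1" using True by (simp add: ctr_def basis_def)
    moreover have "nsg (nb j I) (basis (I - {j}) :: ('r, 'n, 'a) sext) K = nsg (nb j I) 1"
      using K(1) by (simp add: basis_def nsg_def)
    ultimately show ?thesis using K(2) n by simp
  next
    case False
    have l: "ctr j (basis I :: ('r, 'n, 'a) sext) K = 0"
    proof (cases "j \<in> K")
      case True
      then show ?thesis by (simp add: ctr_def)
    next
      case notin: False
      then have "insert j K \<noteq> I" using False by simp
      then show ?thesis using notin by (simp add: ctr_def basis_def)
    qed
    show ?thesis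
    proof (cases "j \<in> I")
      case True
      then have "K \<noteq> I - {j}" using False by auto
      then have "nsg (nb j I) (basis (I - {j}) :: ('r, 'n, 'a) sext) K = 0" by (simp add: basis_def nsg_def)
      then show ?thesis unfolding l if_P[OF True] ..
    qed (simp add: l)
  qed
qed

lemma foldr_ctr_basis:
  "distinct xs \<Longrightarrow> A \<inter> set xs = {} \<Longrightarrow> 
    \<exists>n. foldr ctr xs (basis (set xs \<union> A) :: ('r::{finite,linorder}, 'n, 'a::comm_ring_1) sext) = nsg n (basis A)"
proof (induction xs arbitrary: A)
  case Nil
  show ?case by (rule exI[of _ 0]) simp
next
  case (Cons x xs)
  then obtain n where "foldr ctr xs (basis (set xs \<union> insert x A) :: ('r, 'n, 'a) sext) = nsg n (basis (insert x A))"
    using Cons.IH[of "insert x A"] Cons.prems by auto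
  moreover have "set xs \<union> insert x A = set (x # xs) \<union> A" "insert x A - {x} = A" using Cons.prems by auto
  ultimately have "foldr ctr (x # xs) (basis (set (x # xs) \<union> A) :: ('r, 'n, 'a) sext) = nsg (n + nb x (insert x A)) (basis A)"
    by (simp add: nsg_lin[OF lin_ctr] ctr_basis nsg_nsg)
  then show ?case by blast
qed

text \<open>Leibniz expansion: a choice of indices that is not injective repeats a contraction and
  vanishes, and a permutation contributes its sign. The remaining sign is that of contracting the
  top form down to 1.\<close>

lemma foldr_th_top:
  fixes w :: "'r::{finite,linorder} \<Rightarrow> 'r \<Rightarrow> ('n::{finite,linorder}, 'a::comm_ring_1) pol"
  shows "\<exists>n. foldr (\<lambda>i. th (w i)) (sorted_list_of_set UNIV) (basis UNIV) = nsg n (embS (pdet w))"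
proof -
  let ?U = "sorted_list_of_set (UNIV :: 'r set)"
  let ?Y = "foldr ctr ?U (basis UNIV) :: ('r, 'n, 'a) sext"
  obtain n where n: "?Y = nsg n eone"
    using foldr_ctr_basis[of ?U "{}"] by (auto simp: eone_basis)
  have "foldr (\<lambda>i. th (w i)) ?U (basis UNIV) = (\<Sum>p\<in>UNIV. pm (\<Prod>i\<in>UNIV. w i (p i)) (foldr ctr (map p ?U) (basis UNIV)))"
    using foldr_th_expand[of ?U w "basis UNIV"] by (simp add: PiE_UNIV_domain)
  also have "\<dots> = (\<Sum>p\<in>{p. p permutes UNIV}. pm (\<Prod>i\<in>UNIV. w i (p i)) (foldr ctr (map p ?U) (basis UNIV)))"
  proof (rule sum.mono_neutral_right)
    show "\<forall>p\<in>UNIV - {p. p permutes UNIV}. pm (\<Prod>i\<in>UNIV. w i (p i)) (foldr ctr (map p ?U) (basis UNIV :: ('r, 'n, 'a) sext)) = 0"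
    proof
      fix p :: "'r \<Rightarrow> 'r" assume "p \<in> UNIV - {p. p permutes UNIV}"
      then have "\<not> bij p" by (auto simp: permutes_def bij_iff)
      then have "\<not> inj p" using finite_UNIV_inj_surj[of p] unfolding bij_def by simp
      then have "\<not> distinct (map p ?U)" by (simp add: distinct_map)
      then show "pm (\<Prod>i\<in>UNIV. w i (p i)) (foldr ctr (map p ?U) (basis UNIV :: ('r, 'n, 'a) sext)) = 0"
        by (simp add: ctrs.not_distinct lin_zero[OF lin_pm])
    qed
  qed auto
  also have "\<dots> = (\<Sum>p\<in>{p. p permutes UNIV}. pm (of_int (sign p) * (\<Prod>i\<in>UNIV. w i (p i))) ?Y)"
    by (rule sum.cong[OF refl]) (simp add: foldr_ctr_perm pm_pm mult.commute)
  also have "\<dots> = pm (pdet w) ?Y" by (simp add: pm_sum_left pdet_def)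
  also have "\<dots> = nsg n (embS (pdet w))" by (simp add: n nsg_lin[OF lin_pm] embS_pm)
  finally show ?thesis by blast
qed

definition card_supp :: "nat \<Rightarrow> ('r, 'n, 'a::comm_ring_1) sext \<Rightarrow> bool" where
  "card_supp c X \<longleftrightarrow> (\<forall>I. X I \<noteq> 0 \<longrightarrow> card I = c)"

lemma card_supp_th: "card_supp (Suc c) X \<Longrightarrow> card_supp c (th w X)"
  unfolding card_supp_def
proof (intro allI impI)
  fix I assume X: "\<forall>I. X I \<noteq> 0 \<longrightarrow> card I = Suc c" and "th w X I \<noteq> 0"
  then obtain k where k: "w k * ctr k X I \<noteq> 0"
    unfolding th_def sum_fun_apply pm_def by (meson sum.not_neutral_contains_not_neutral)
  then have "k \<notin> I" "X (insert k I) \<noteq> 0" by (auto simp: ctr_def split: if_splits)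
  then show "card I = c" using X by fastforce
qed

lemma card_supp_foldr: "card_supp (c + length xs) X \<Longrightarrow> card_supp c (foldr (\<lambda>i. th (w i)) xs X)"
proof (induction xs arbitrary: c)
  case (Cons x xs)
  then have "card_supp (Suc c) (foldr (\<lambda>i. th (w i)) xs X)" by simp
  then show ?case by (simp add: card_supp_th)
qed simp

lemma common_denominator:
  fixes S :: "'b::idom fract set"
  assumes "finite S"
  shows "\<exists>d. d \<noteq> 0 \<and> (\<forall>x\<in>S. \<exists>a. Fract d 1 * x = Fract a 1)"
  using assms
proof (induction S rule: finite_induct)
  case empty
  show ?case by (rule exI[of _ 1]) simp
next
  case (insert x S)
  then obtain d where d: "d \<noteq> 0" "\<forall>x\<in>S. \<exists>a. Fract d 1 * x = Fract a 1" by blast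
  obtain a b where x: "x = Fract a b" "b \<noteq> 0" by (cases x) auto
  have "\<exists>a. Fract (d * b) 1 * y = Fract a 1" if "y \<in> insert x S" for y
  proof (cases "y = x")
    case True
    have "Fract (d * b) 1 * y = Fract (d * a) 1" using x True by (simp add: eq_fract algebra_simps)
    then show ?thesis by blast
  next
    case False
    then have "y \<in> S" using that by simp
    from bspec[OF d(2) this] obtain e where "Fract d 1 * y = Fract e 1" ..
    then have "Fract b 1 * (Fract d 1 * y) = Fract (b * e) 1" by simp
    moreover have "Fract (d * b) 1 = Fract b 1 * Fract d 1" by (simp add: mult.commute)
    ultimately have "Fract (d * b) 1 * y = Fract (b * e) 1" by (simp only: mult.assoc)
    then show ?thesis by blast
  qed
  then show ?case using d x by (intro exI[of _ "d * b"]) simp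
qed

text \<open>Invert the matrix over the fraction field and clear denominators; \<open>d\<close> is
  any common denominator of the entries of the inverse.\<close>

lemma pdet_left_inverse:
  fixes w :: "'r::finite \<Rightarrow> 'r \<Rightarrow> ('n::linorder, 'a::field) pol"
  assumes "pdet w \<noteq> 0"
  shows "\<exists>d N. d \<noteq> 0 \<and> (\<forall>k l. (\<Sum>j\<in>UNIV. N k j * w j l) = (if k = l then d else 0))"
proof -
  define \<iota> where "\<iota> f = Fract f 1" for f :: "('n, 'a) pol"
  have hom: "\<iota> (f + g) = \<iota> f + \<iota> g" "\<iota> (f * g) = \<iota> f * \<iota> g" "\<iota> 0 = 0" "\<iota> 1 = 1" "\<iota> (- f) = - \<iota> f" for f g
    by (simp_all add: \<iota>_def Zero_fract_def One_fract_def)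
  have inj: "\<iota> f = \<iota> g \<longleftrightarrow> f = g" for f g by (simp add: \<iota>_def eq_fract)
  have sum: "\<iota> (\<Sum>i\<in>A. f i) = (\<Sum>i\<in>A. \<iota> (f i))" and prod: "\<iota> (\<Prod>i\<in>A. f i) = (\<Prod>i\<in>A. \<iota> (f i))" for A :: "'i set" and f
    by (induction A rule: infinite_finite_induct) (simp_all add: hom)
  have sgn: "\<iota> (of_int (sign p)) = of_int (sign p)" for p :: "'r \<Rightarrow> 'r" by (simp add: sign_def hom)
  define A where "A = (\<chi> i j. \<iota> (w i j))"
  have "det A = \<iota> (pdet w)"
    by (simp add: det_def A_def pdet_def sum prod hom sgn)
  then have "det A \<noteq> 0" using assms inj[of _ 0] by (simp add: hom)
  then obtain B where B: "B ** A = mat 1" using invertible_det_nz[of A] unfolding invertible_def by blast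
  obtain d where d: "d \<noteq> 0" "\<forall>x\<in>range (\<lambda>(k, j). B $ k $ j). \<exists>a. \<iota> d * x = \<iota> a"
    using common_denominator[of "range (\<lambda>(k, j). B $ k $ j)"] unfolding \<iota>_def by auto
  then have "\<forall>k j. \<exists>a. \<iota> d * B $ k $ j = \<iota> a" by auto
  then obtain N where N: "\<And>k j. \<iota> d * B $ k $ j = \<iota> (N k j)" by metis
  have "(\<Sum>j\<in>UNIV. N k j * w j l) = (if k = l then d else 0)" for k l
  proof -
    have "\<iota> (\<Sum>j\<in>UNIV. N k j * w j l) = \<iota> d * (B ** A) $ k $ l"
      by (simp add: sum hom N[symmetric] matrix_matrix_mult_def A_def sum_distrib_left mult.assoc)
    also have "\<dots> = \<iota> (if k = l then d else 0)" by (simp add: B mat_def hom)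
    finally show ?thesis by (simp add: inj)
  qed
  then show ?thesis using d(1) by blast
qed

text \<open>Up to the nonzero factor \<open>d\<close>, contractions by basis letters are polynomial
  combinations of the \<open>th (w j)\<close>. So the scalar part of every iterated basis
  contraction of \<open>y\<close> vanishes, and up to sign these are all the coefficients of
  \<open>y\<close>.\<close>

lemma th_nondegenerate:
  fixes y :: "('r::{finite,linorder}, 'n::{finite,linorder}, 'a::field_char_0) sext"
  assumes det: "pdet w \<noteq> 0" and y: "\<And>xs. foldr (\<lambda>i. th (w i)) xs y {} = 0"
  shows "y = 0"
proof -
  obtain d N where dN: "d \<noteq> 0" "\<And>k l. (\<Sum>j\<in>UNIV. N k j * w j l) = (if k = l then d else 0)"
    using pdet_left_inverse[OF det] by blast
  have pm_foldr: "foldr (\<lambda>i. th (w i)) xs (pm f Y) = pm f (foldr (\<lambda>i. th (w i)) xs Y)" for xs f Y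
    by (induction xs) (simp_all add: th_pm)
  have lin: "lin escale escale (foldr (\<lambda>i. th (w i)) xs)" for xs by (rule lin_foldr[OF lin_th])
  have ctr: "foldr (\<lambda>i. th (w i)) xs (ctr k Y) {} = 0" if Y: "\<And>xs. foldr (\<lambda>i. th (w i)) xs Y {} = 0" for xs k Y
  proof -
    have "(\<Sum>j\<in>UNIV. pm (N k j) (th (w j) Y)) = (\<Sum>l\<in>UNIV. pm (\<Sum>j\<in>UNIV. N k j * w j l) (ctr l Y))"
      unfolding th_def pm_sum_right pm_pm pm_sum_left by (rule sum.swap)
    also have "\<dots> = (\<Sum>l\<in>UNIV. if l = k then pm d (ctr k Y) else 0)"
      by (rule sum.cong) (auto simp: dN(2))
    also have "\<dots> = pm d (ctr k Y)" by simp
    finally have eq: "pm d (ctr k Y) = (\<Sum>j\<in>UNIV. pm (N k j) (th (w j) Y))" ..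
    have "d * foldr (\<lambda>i. th (w i)) xs (ctr k Y) {} = foldr (\<lambda>i. th (w i)) xs (pm d (ctr k Y)) {}"
      by (simp add: pm_foldr) (simp add: pm_def)
    also have "\<dots> = (\<Sum>j\<in>UNIV. N k j * foldr (\<lambda>i. th (w i)) (xs @ [j]) Y {})"
      unfolding eq lin_sum[OF lin] pm_foldr sum_fun_apply by (simp add: pm_def)
    also have "\<dots> = 0" using Y[of "xs @ [_]"] by (simp del: foldr_append)
    finally show ?thesis using dN(1) by simp
  qed
  have "Y I = 0" if "\<And>xs. foldr (\<lambda>i. th (w i)) xs Y {} = 0" for Y I
    using finite[of I] that
  proof (induction I arbitrary: Y rule: finite_induct)
    case empty
    show ?case using empty[of "[]"] by simp
  next
    case (insert j A)
    have "ctr j Y A = 0" by (rule insert.IH) (rule ctr, rule insert.prems)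
    then show ?case using insert.hyps by (simp add: ctr_def nsg_eq_0)
  qed
  then show ?thesis using y by (auto simp: fun_eq_iff)
qed

section \<open>Semiinvariant forms modulo the ideal\<close>

context refl_rep
begin

lemma actVd_ctr: "h \<in> G \<Longrightarrow> actVd \<rho> h (ctr k X) = (\<Sum>j\<in>UNIV. escale (\<rho> h $ j $ k) (ctr j (actVd \<rho> h X)))"
  using actVd_dl[of h "Inr k" X] by (simp add: sum_sum_type Lm_def)

lemma actVd_th:
  assumes "h \<in> G" "actSdM \<rho> h w = w"
  shows "actVd \<rho> h (th w X) = th w (actVd \<rho> h X)"
proof -
  have "actVd \<rho> h (th w X) = (\<Sum>k\<in>UNIV. \<Sum>j\<in>UNIV. pm (pconst (\<rho> h $ j $ k) * actSd h (w k)) (ctr j (actVd \<rho> h X)))"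
    by (simp add: th_def lin_sum[OF lin_actVd] actVd_pm actVd_ctr[OF assms(1)] pm_sum_right pm_pconst[symmetric] pm_pm mult.commute)
  also have "\<dots> = (\<Sum>j\<in>UNIV. pm (actSdM \<rho> h w j) (ctr j (actVd \<rho> h X)))"
    by (subst sum.swap) (simp add: actSdM_def pm_sum_left)
  finally show ?thesis by (simp add: assms(2) th_def)
qed

lemma actVd_scalar_part: "actVd \<rho> h X {} = actSd h (X {})"
proof (induction X rule: sext_induct)
  case (const f)
  show ?case by (simp add: actVd_pm actVd_eone) (simp add: pm_def eone_def)
next
  case (add F H)
  then show "actVd \<rho> h (F + H) {} = actSd h ((F + H) {})"
    by (simp add: lin_add[OF lin_actVd] actSd_psubst psubst_add)
next
  case (ext j F)
  show ?case using actVd_zl[of h "Inr j" F]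
    by (simp add: F1.Yl_def sum_sum_type Lv_def sum_fun_apply escale_def ext_def actSd_psubst)
qed

lemma ideal_subspace: "es.subspace (inv_ideal G act)"
proof (rule es.subspaceI)
  show "0 \<in> inv_ideal G act" unfolding inv_ideal_def ezero_zero[symmetric] by (rule ideal_gen.zero)
  show "x + y \<in> inv_ideal G act" if "x \<in> inv_ideal G act" "y \<in> inv_ideal G act" for x y
    using that unfolding inv_ideal_def eadd_plus[symmetric] by (rule ideal_gen.add)
  show "escale c x \<in> inv_ideal G act" if "x \<in> inv_ideal G act" for c x
  proof -
    have "emult (escale c eone) x \<in> inv_ideal G act"
      using that unfolding inv_ideal_def by (rule ideal_gen.lmult)
    then show ?thesis by (simp add: emult_escale_left emult_eone)
  qed
qed

text \<open>\<xi> may be inhomogeneous. Averaging its expansion in nonempty words over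
  \<open>G\<close> writes it as a combination of orbit sums of words, each of which is a homogeneous
  invariant of positive degree.\<close>

lemma invariant_no_constant_in_ideal:
  assumes inv: "\<And>g. g \<in> G \<Longrightarrow> actVd \<rho> g \<xi> = \<xi>" and "cc \<xi> = 0"
  shows "\<xi> \<in> inv_ideal G (actVd \<rho>)"
proof -
  have "\<xi> \<in> es.span {zw u eone | u. u \<noteq> []}" using words_span[of \<xi>] assms(2) by simp
  then have "(\<Sum>g\<in>G. actVd \<rho> g \<xi>) \<in> inv_ideal G (actVd \<rho>)"
  proof (induction rule: es.span_induct_alt)
    case base
    show ?case unfolding lin_zero[OF lin_actVd] sum.neutral_const by (rule es.subspace_0[OF ideal_subspace])
  next
    case (step c x y)
    then obtain u where u: "x = zw u eone" "u \<noteq> []" by blast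
    let ?W = "map (\<lambda>a. (a, mat 1 :: ('a, 'n) sqmat)) u"
    let ?\<xi> = "\<Sum>g\<in>G. F1.Yw (map (\<lambda>v. (fst v, g ** snd v)) ?W) eone"
    have G: "snd ` set ?W \<subseteq> G" using one_G by auto
    have "x = F1.Yw ?W eone" unfolding u(1) by (induction u) (simp_all add: Yl_one)
    then have "(\<Sum>g\<in>G. actVd \<rho> g x) = ?\<xi>"
      using actVd_words[OF _ G] by (simp add: actVd_eone)
    moreover have "?\<xi> \<in> inv_ideal G (actVd \<rho>)"
    proof (rule invariant_in_ideal)
      show "0 < length ?W" using u(2) by simp
      show "ehomog (length ?W) ?\<xi>"
      proof (rule ehomog_sum)
        fix g
        show "ehomog (length ?W) (F1.Yw (map (\<lambda>v. (fst v, g ** snd v)) ?W) (eone :: ('r, 'n, 'a) sext))"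
          using ehomog_Yw[of "map (\<lambda>v. (fst v, g ** snd v)) ?W"] by simp
      qed
      show "actVd \<rho> g ?\<xi> = ?\<xi>" if "g \<in> G" for g by (rule sum_Yw_invariant[OF G that])
    qed
    ultimately have "(\<Sum>g\<in>G. actVd \<rho> g x) \<in> inv_ideal G (actVd \<rho>)" by simp
    then show ?case unfolding lin_add[OF lin_actVd] lin_scale[OF lin_actVd] sum.distrib escale_sum[symmetric]
      by (intro es.subspace_add[OF ideal_subspace] es.subspace_scale[OF ideal_subspace] step(2))
  qed
  moreover have "(\<Sum>g\<in>G. actVd \<rho> g \<xi>) = escale (of_nat (card G)) \<xi>"
    unfolding es.sum_constant_scale[symmetric] by (rule sum.cong) (simp_all only: inv)
  ultimately have "escale (of_nat (card G)) \<xi> \<in> inv_ideal G (actVd \<rho>)" by (simp only:)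
  then have "escale (inverse (of_nat (card G))) (escale (of_nat (card G)) \<xi>) \<in> inv_ideal G (actVd \<rho>)"
    by (rule es.subspace_scale[OF ideal_subspace])
  moreover have "card G \<noteq> 0" using finite_G one_G by auto
  ultimately show ?thesis by simp
qed

text \<open>This turns a generating set over the invariants into a spanning set over F modulo the
  ideal.\<close>

lemma invariant_times_in_ideal:
  assumes "\<And>g. g \<in> G \<Longrightarrow> actSd g r = r"
  shows "pm r E - escale (lookup r 0) E \<in> inv_ideal G (actVd \<rho>)"
proof -
  let ?q = "r - pconst (lookup r 0)"
  have "pm ?q eone \<in> inv_ideal G (actVd \<rho>)"
  proof (rule invariant_no_constant_in_ideal)
    fix g assume "g \<in> G"
    have "psubst \<sigma> (f - h) = psubst \<sigma> f - psubst \<sigma> h" for \<sigma> and f h :: "('n, 'a) pol"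
      using psubst_add[of \<sigma> "f - h" h] by (simp add: algebra_simps)
    then have "actSd g ?q = ?q" using assms[OF \<open>g \<in> G\<close>] by (simp add: actSd_psubst)
    then show "actVd \<rho> g (pm ?q eone) = pm ?q eone" by (simp add: actVd_pm actVd_eone)
  next
    show "cc (pm ?q eone :: ('r, 'n, 'a) sext) = 0" by (simp add: cc_def pm_def eone_def lookup_minus pconst_def)
  qed
  then have "emult (pm ?q eone) E \<in> inv_ideal G (actVd \<rho>)"
    unfolding inv_ideal_def by (rule ideal_gen.rmult)
  moreover have "emult (pm ?q eone) E = pm r E - escale (lookup r 0) E"
    unfolding emult_pm emult_eone pm_pconst[symmetric] by (auto simp: pm_def algebra_simps)
  ultimately show ?thesis by simp
qed

text \<open>The scalar parts of the contractions of \<open>F\<close> by subfamilies of \<omega> are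
  semiinvariant polynomials, hence invariant multiples of \<Delta>, and they determine
  \<open>F\<close>. The form \<open>E K\<close> is \<open>b\<close> times the contraction of the top
  form by the complementary indices, so the family dual to these contractions is known
  explicitly.\<close>

lemma semiinvariant_mod_ideal:
  fixes \<omega> :: "'r \<Rightarrow> 'r \<Rightarrow> ('n, 'a) pol"
  assumes omega: "\<And>i g. g \<in> G \<Longrightarrow> actSdM \<rho> g (\<omega> i) = \<omega> i"
    and \<Delta>: "\<Delta> = pdet \<omega> * b" "\<Delta> \<noteq> 0"
    and gen: "\<And>f. (\<And>g. g \<in> G \<Longrightarrow> actSd g f = pconst (chi g) * f) \<Longrightarrow>
      \<exists>a. (\<forall>g\<in>G. actSd g a = a) \<and> f = a * \<Delta>"
  shows "\<exists>E :: 'r set \<Rightarrow> ('r, 'n, 'a) sext. \<forall>F. (\<forall>g\<in>G. actVd \<rho> g F = escale (chi g) F) \<longrightarrow>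
    (\<exists>c. F - (\<Sum>K\<in>UNIV. escale (c K) (E K)) \<in> inv_ideal G (actVd \<rho>))"
proof -
  let ?T = "\<lambda>xs. foldr (\<lambda>i. th (\<omega> i)) xs"
  let ?s = "sorted_list_of_set :: 'r set \<Rightarrow> 'r list"
  let ?top = "basis UNIV :: ('r, 'n, 'a) sext"
  let ?D = "pdet \<omega>"
  interpret an: anticomm escale "\<lambda>i. th (\<omega> i) :: ('r, 'n, 'a) sext \<Rightarrow> _" by (rule anticomm_th)
  have D: "?D \<noteq> 0" using \<Delta> by auto
  obtain n where n: "?T (?s UNIV) ?top = nsg n (embS ?D)" using foldr_th_top by blast
  have "\<exists>e. \<forall>X. ?T (?s K @ ?s (- K)) X = nsg e (?T (?s UNIV) X)" for K
  proof (rule an.perm_sign)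
    have "distinct (?s K @ ?s (- K))" "set (?s K @ ?s (- K)) = set (?s UNIV)" by auto
    then show "mset (?s K @ ?s (- K)) = mset (?s UNIV)"
      by (metis distinct_sorted_list_of_set set_eq_iff_mset_eq_distinct)
  qed
  then obtain e where e: "\<And>K X. ?T (?s K @ ?s (- K)) X = nsg (e K) (?T (?s UNIV) X)" by metis
  have pmT: "?T xs (pm f Y) = pm f (?T xs Y)" for xs f Y
    by (induction xs) (simp_all add: th_pm)
  have linT: "lin escale escale (?T xs)" for xs by (rule an.foldr_lin)
  \<comment> \<open>If \<open>L\<close> is properly contained in \<open>K\<close>, fewer than r
    contractions reach the top form and leave no scalar part; if \<open>L\<close> is not contained
    in \<open>K\<close>, an index is repeated. Only \<open>L = K\<close> uses every index
    once.\<close>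
  have dual: "?T (?s L) (?T (?s (- K)) ?top) {} = (if L = K then nsg (e K) (nsg n ?D) else 0)" for L K
  proof (cases "L = K")
    case True
    have "?T (?s K) (?T (?s (- K)) ?top) = nsg (e K) (nsg n (embS ?D))"
      using e[of K ?top] n by simp
    then show ?thesis using True by (auto simp: embS_def nsg_def)
  next
    case False
    show ?thesis
    proof (cases "L \<subseteq> K")
      case True
      have "card L < card K" using True False by (simp add: psubset_card_mono psubset_eq)
      moreover have "card (- K) + card K = CARD('r)"
        unfolding Compl_eq_Diff_UNIV by (simp add: card_Diff_subset card_mono)
      ultimately have "length (?s L @ ?s (- K)) < CARD('r)" by simp
      then obtain c where c: "CARD('r) = Suc c + length (?s L @ ?s (- K))"
        by (metis add.commute add_Suc_right less_iff_Suc_add)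
      have "card_supp (CARD('r)) ?top" by (simp add: card_supp_def basis_def)
      then have "card_supp (Suc c) (?T (?s L @ ?s (- K)) ?top)" unfolding c by (rule card_supp_foldr)
      then have "?T (?s L @ ?s (- K)) ?top {} = 0" unfolding card_supp_def by (metis card.empty nat.distinct(1))
      then show ?thesis using False by simp
    next
      case notsub: False
      then have "\<not> distinct (?s L @ ?s (- K))" by auto
      from an.not_distinct[OF this] have "?T (?s L @ ?s (- K)) ?top = 0" .
      then show ?thesis using False by simp
    qed
  qed
  define E where "E K = pm b (?T (?s (- K)) ?top)" for K
  have "\<exists>c. F - (\<Sum>K\<in>UNIV. escale (c K) (E K)) \<in> inv_ideal G (actVd \<rho>)"
    if F: "\<forall>g\<in>G. actVd \<rho> g F = escale (chi g) F" for F
  proof -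
    have semi: "actSd h (?T xs F {}) = pconst (chi h) * ?T xs F {}" if h: "h \<in> G" for h xs
    proof -
      have "actVd \<rho> h (?T xs X) = ?T xs (actVd \<rho> h X)" for X
        by (induction xs) (simp_all add: actVd_th h omega)
      then have "actVd \<rho> h (?T xs F) = escale (chi h) (?T xs F)"
        using F h by (simp add: lin_scale[OF linT])
      then show ?thesis using actVd_scalar_part[of h "?T xs F"] by (simp add: escale_def)
    qed
    have "\<exists>r. (\<forall>g\<in>G. actSd g r = r) \<and> ?T (?s K) F {} = r * \<Delta>" for K
      by (rule gen) (rule semi)
    then obtain r where r: "\<And>K g. g \<in> G \<Longrightarrow> actSd g (r K) = r K" "\<And>K. ?T (?s K) F {} = r K * \<Delta>"
      by metis
    define F' where "F' = (\<Sum>K\<in>UNIV. pm (nsg (e K) (nsg n (r K))) (E K))"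
    \<comment> \<open>It suffices to compare scalar parts after contraction by sorted lists: a
      repeated index gives zero, and any other list can be sorted at the cost of a sign.\<close>
    have "F - F' = 0"
    proof (rule th_nondegenerate[OF D])
      have diff: "?T (?s L) (F - F') {} = 0" for L
      proof -
        have "?T (?s L) F' {} = (\<Sum>K\<in>UNIV. nsg (e K) (nsg n (r K)) * (b * ?T (?s L) (?T (?s (- K)) ?top) {}))"
          unfolding F'_def E_def lin_sum[OF linT] pmT sum_fun_apply by (simp add: pm_def)
        also have "\<dots> = (\<Sum>K\<in>UNIV. if K = L then r L * \<Delta> else 0)"
          by (rule sum.cong) (auto simp: dual \<Delta>(1) nsg_def)
        also have "\<dots> = ?T (?s L) F {}" by (simp add: r(2))
        finally show ?thesis by (simp add: lin_diff[OF linT])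
      qed
      fix xs
      show "?T xs (F - F') {} = 0"
      proof (cases "distinct xs")
        case True
        then have "mset xs = mset (?s (set xs))"
          by (metis distinct_sorted_list_of_set finite_set set_eq_iff_mset_eq_distinct set_sorted_list_of_set)
        from an.perm_sign[OF this] obtain m where "\<And>X. ?T xs X = nsg m (?T (?s (set xs)) X)" by blast
        then show ?thesis using diff[of "set xs"] by (simp add: nsg_def)
      next
        case False
        show ?thesis unfolding an.not_distinct[OF False] by simp
      qed
    qed
    then have FF': "F = F'" by simp
    define c where "c K = lookup (nsg (e K) (nsg n (r K))) 0" for K
    have "(\<Sum>K\<in>UNIV. pm (nsg (e K) (nsg n (r K))) (E K) - escale (c K) (E K)) \<in> inv_ideal G (actVd \<rho>)"
    proof (rule es.subspace_sum[OF ideal_subspace])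
      fix K
      have "actSd g (nsg m f) = nsg m (actSd g f)" for g :: "('a, 'n) sqmat" and m and f :: "('n, 'a) pol"
        unfolding actSd_psubst by (rule nsg_lin_fun) (rule psubst_add)
      then show "pm (nsg (e K) (nsg n (r K))) (E K) - escale (c K) (E K) \<in> inv_ideal G (actVd \<rho>)"
        unfolding c_def by (intro invariant_times_in_ideal) (simp add: r(1))
    qed
    then have "F - (\<Sum>K\<in>UNIV. escale (c K) (E K)) \<in> inv_ideal G (actVd \<rho>)"
      by (simp only: FF' F'_def sum_subtractf)
    then show ?thesis by blast
  qed
  then show ?thesis by blast
qed

end

subsection \<open>Nonvanishing of the top product\<close>

text \<open>The patterns of the words occurring in a product of invariant contractions, which has one block
  of letters for each factor.\<close>

inductive blockpat :: "'r list \<Rightarrow> (bool \<times> 'r option) list \<Rightarrow> bool" where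
  nil: "blockpat [] []"
| tail: "blockpat [] w \<Longrightarrow> blockpat [] ((False, None) # w)"
| odd: "blockpat xs w \<Longrightarrow> blockpat (i # xs) ((True, Some i) # w)"
| even: "blockpat (i # xs) w \<Longrightarrow> blockpat (i # xs) ((False, Some i) # w)"

lemma blockpat_labels: "blockpat xs w \<Longrightarrow> snd ` set w \<subseteq> insert None (Some ` set xs)"
  by (induction rule: blockpat.induct) auto

lemma blockpat_block:
  "blockpat ys w \<Longrightarrow> ys = i # xs \<Longrightarrow> \<exists>m w'. w = replicate m (False, Some i) @ (True, Some i) # w' \<and> blockpat xs w'"
proof (induction rule: blockpat.induct)
  case (odd xs' w' i')
  then show ?case by (intro exI[of _ 0]) auto
next
  case (even i' xs' w)
  then obtain m w' where "w = replicate m (False, Some i) @ (True, Some i) # w'" "blockpat xs w'" by auto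
  then show ?case using even.prems by (intro exI[of _ "Suc m"]) auto
qed simp_all

lemma actS_mult: "actS (g ** h) f = actS g (actS h f)"
  for f :: "('n::finite, 'a::field) pol"
proof (induction f rule: pol_induct)
  case (const c)
  show ?case by (simp add: actS_psubst)
next
  case (add f f')
  then show ?case by (simp add: actS_psubst psubst_add)
next
  case (var i f)
  have sum: "psubst \<sigma> (sum k A) = (\<Sum>j\<in>A. psubst \<sigma> (k j))"
    for \<sigma> :: "'n \<Rightarrow> ('n, 'a) pol" and k :: "'n \<Rightarrow> ('n, 'a) pol" and A
    by (induction A rule: infinite_finite_induct) (simp_all add: psubst_add)
  have "actS (g ** h) (pvar i) = (\<Sum>j\<in>UNIV. \<Sum>k\<in>UNIV. pconst (g $ j $ k * h $ k $ i) * pvar j)"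
    by (simp add: actS_psubst matrix_matrix_mult_def pconst_sum sum_distrib_right)
  also have "\<dots> = (\<Sum>k\<in>UNIV. pconst (h $ k $ i) * (\<Sum>j\<in>UNIV. pconst (g $ j $ k) * pvar j))"
    by (subst sum.swap) (simp add: sum_distrib_left pconst_mult mult_ac)
  also have "\<dots> = actS g (actS h (pvar i))"
    by (simp add: actS_psubst sum psubst_pconst_mult)
  finally have "actS (g ** h) (pvar i) = actS g (actS h (pvar i))" .
  then show ?case using var by (simp add: actS_psubst psubst_mult)
qed

lemma epair_pm: "epair F (pm a X) = epair (pD a F) X"
  for F X :: "('r::{finite,linorder}, 'n::{finite,linorder}, 'a::field_char_0) sext"
proof (induction a arbitrary: F rule: pol_induct)
  case (const c)
  show ?case by (simp add: pm_pconst pD_pconst lin_scale[OF lin_epair(1)] lin_scale[OF lin_epair(2)])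
next
  case (add f g)
  show "epair F (pm (f + g) X) = epair (pD (f + g) F) X"
    unfolding pm_add_left pD_add lin_add[OF lin_epair(1)] lin_add[OF lin_epair(2)] add ..
next
  case (var i f)
  have "epair F (pm (pvar i * f) X) = epair (pm f X) (pd i F) "
    by (metis epair_pm_pvar epair_swap pm_pm)
  also have "\<dots> = epair (pD f (pd i F)) X" by (metis epair_swap var)
  also have "\<dots> = epair (pD (pvar i * f) F) X" by (simp only: pD_mult pD_pvar pd_pD)
  finally show ?case .
qed

lemma epair_th: "epair F (th w X) = epair (dst w F) X"
  for F X :: "('r::{finite,linorder}, 'n::{finite,linorder}, 'a::field_char_0) sext"
  by (simp add: th_def dst_def lin_sum[OF lin_epair(1)] lin_sum[OF lin_epair(2)] epair_pm epair_ext)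

lemma pD_dst: "pD a (dst s X) = dst s (pD a X)"
  by (simp add: dst_def lin_sum[OF lin_pD] pD_ext pD_commute[of a])

section \<open>Block words in the second Fock space\<close>

context refl_rep
begin

lemma Yl'_even: "F2.Yl (Inl i, g) X = pm (actSd g (pvar i)) X"
  by (simp add: F2.Yl_def sum_sum_type Lv'_def actSd_psubst pm_sum_left pm_pm[symmetric] pm_pconst)

lemma Yl'_odd: "F2.Yl (Inr k, g) X = (\<Sum>j\<in>UNIV. escale (\<rho> g $ j $ k) (ctr j X))"
  by (simp add: F2.Yl_def sum_sum_type Lv'_def transpose_def)

lemma Zl'_even: "F2.Zl (Inl i, g) X = pm (actS g (pvar i)) X"
  by (simp add: F2.Zl_def sum_sum_type Lm'_def actS_psubst pm_sum_left pm_pm[symmetric] pm_pconst)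

lemma Zl'_odd: "F2.Zl (Inr k, g) X = (\<Sum>j\<in>UNIV. escale (matrix_inv (\<rho> g) $ k $ j) (ctr j X))"
  by (simp add: F2.Zl_def sum_sum_type Lm'_def transpose_def)

lemma Zl'_one: "F2.Zl (a, mat 1) X = zt a X"
proof (cases a)
  case (Inl i)
  have "actS (mat 1) (pvar i) = (\<Sum>j\<in>UNIV. (if j = i then 1 else 0) * pvar j :: ('n, 'a) pol)"
    unfolding actS_psubst psubst_pvar by (rule sum.cong) (auto simp: mat_def)
  then have "actS (mat 1) (pvar i) = (pvar i :: ('n, 'a) pol)" by (simp only: sum_delta_mult)
  then show ?thesis by (simp add: Inl Zl'_even)
next
  case (Inr k)
  have "matrix_inv (\<rho> (mat 1)) = mat 1" using rho_inv[OF one_G] by (simp add: inv_one rho_one)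
  then have "F2.Zl (Inr k, mat 1) X = (\<Sum>j\<in>UNIV. escale (if j = k then 1 else 0) (ctr j X))"
    unfolding Zl'_odd by (intro sum.cong refl) (auto simp: mat_def)
  then show ?thesis by (simp add: Inr sum_delta_escale)
qed

lemma actSd_mat1: "actSd (mat 1) f = (f :: ('n, 'a) pol)"
proof (induction f rule: pol_induct)
  case (var i f)
  have "actSd (mat 1) (pvar i) = (\<Sum>j\<in>UNIV. (if j = i then 1 else 0) * pvar j :: ('n, 'a) pol)"
    unfolding actSd_psubst psubst_pvar inv_one by (rule sum.cong) (auto simp: mat_def)
  then have "actSd (mat 1) (pvar i) = (pvar i :: ('n, 'a) pol)" by (simp only: sum_delta_mult)
  then show ?case using var by (simp add: actSd_psubst psubst_mult)
qed (simp_all add: actSd_psubst psubst_add)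

text \<open>The label \<open>None\<close> marks the letters of the cofactor of the determinant,
  which need not be invariant and is therefore not translated; \<open>Some i\<close> marks the
  letters of the i-th invariant factor.\<close>

definition ext1 :: "('r \<Rightarrow> ('a, 'n) sqmat) \<Rightarrow> 'r option \<Rightarrow> ('a, 'n) sqmat" where
  "ext1 p l = (case l of None \<Rightarrow> mat 1 | Some i \<Rightarrow> p i)"

definition block_fams :: "'r list \<Rightarrow> (('r option \<Rightarrow> ('a, 'n) sqmat) \<Rightarrow> ('r, 'n, 'a) sext) set" where
  "block_fams xs = {\<lambda>\<gamma>. F2.Yw (map (F2.act \<gamma>) V) (basis UNIV) | V. F2.labelled V \<and> blockpat xs (F2.pat V)}"

lemma block_fams_cons:
  assumes H: "H \<in> ft.span (block_fams xs)"
    and step: "\<And>w. blockpat xs w \<Longrightarrow> blockpat ys ((odd_letter a, l) # w)"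
  shows "(\<lambda>\<gamma>. F2.Yl (a, \<gamma> l) (H \<gamma>)) \<in> ft.span (block_fams ys)"
  using H
proof (induction rule: ft.span_induct_alt)
  case base
  have "(\<lambda>\<gamma>. F2.Yl (a, \<gamma> l) ((0 :: ('r option \<Rightarrow> ('a, 'n) sqmat) \<Rightarrow> ('r, 'n, 'a) sext) \<gamma>)) = 0"
    by (simp add: lin_zero[OF F2.lin_Yl] fun_eq_iff)
  then show ?case by (simp only: ft.span_zero)
next
  case (step c x y)
  then obtain V where V: "x = (\<lambda>\<gamma>. F2.Yw (map (F2.act \<gamma>) V) (basis UNIV))" "F2.labelled V" "blockpat xs (F2.pat V)"
    unfolding block_fams_def by blast
  let ?V = "((a, mat 1), l) # V"
  have "F2.labelled ?V" using V(2) one_G by (auto simp: F2.labelled_def F2.A_def)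
  moreover have "blockpat ys (F2.pat ?V)" using assms(2)[OF V(3)] by (simp add: F2.pat_def)
  ultimately have mem: "(\<lambda>\<gamma>. F2.Yw (map (F2.act \<gamma>) ?V) (basis UNIV)) \<in> block_fams ys"
    unfolding block_fams_def by blast
  have eq: "(\<lambda>\<gamma>. F2.Yl (a, \<gamma> l) (((\<lambda>\<gamma>. escale c (x \<gamma>)) + y) \<gamma>)) =
    (\<lambda>\<gamma>. escale c (F2.Yw (map (F2.act \<gamma>) ?V) (basis UNIV))) + (\<lambda>\<gamma>. F2.Yl (a, \<gamma> l) (y \<gamma>))"
    by (simp add: V(1) F2.act_def lin_add[OF F2.lin_Yl] lin_scale[OF F2.lin_Yl] fun_eq_iff)
  show ?case unfolding eq by (rule ft.span_add[OF ft.span_scale[OF ft.span_base[OF mem]] step(2)])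
qed

lemma block_fams_pm:
  assumes H: "H \<in> ft.span (block_fams xs)" and step: "\<And>w. blockpat xs w \<Longrightarrow> blockpat xs ((False, l) # w)"
  shows "(\<lambda>\<gamma>. pm (actSd (\<gamma> l) f) (H \<gamma>)) \<in> ft.span (block_fams xs)"
proof (induction f rule: pol_induct)
  case (const c)
  have eq: "(\<lambda>\<gamma>. pm (actSd (\<gamma> l) (pconst c)) (H \<gamma>)) = (\<lambda>\<gamma>. escale c (H \<gamma>))"
    by (simp add: actSd_psubst pm_pconst)
  show ?case unfolding eq by (rule ft.span_scale[OF H])
next
  case (add f g)
  have eq: "(\<lambda>\<gamma>. pm (actSd (\<gamma> l) (f + g)) (H \<gamma>)) = (\<lambda>\<gamma>. pm (actSd (\<gamma> l) f) (H \<gamma>)) + (\<lambda>\<gamma>. pm (actSd (\<gamma> l) g) (H \<gamma>))"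
    by (simp add: actSd_psubst psubst_add pm_add_left fun_eq_iff)
  show ?case unfolding eq by (rule ft.span_add[OF add])
next
  case (var i f)
  have eq: "(\<lambda>\<gamma>. pm (actSd (\<gamma> l) (pvar i * f)) (H \<gamma>)) = (\<lambda>\<gamma>. F2.Yl (Inl i, \<gamma> l) (pm (actSd (\<gamma> l) f) (H \<gamma>)))"
    by (simp add: Yl'_even pm_pm actSd_psubst psubst_mult)
  show ?case unfolding eq by (rule block_fams_cons[OF var]) (simp add: step)
qed

text \<open>The span of all forms obtained by \<open>length xs\<close> successive contractions by
  members of \<open>tw\<close>, with polynomial multiplications in between.\<close>

fun contracted :: "('r \<Rightarrow> 'r \<Rightarrow> ('n, 'a) pol) \<Rightarrow> 'r list \<Rightarrow> ('r, 'n, 'a) sext set" where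
  "contracted tw [] = UNIV"
| "contracted tw (i # xs) = es.span {pm a (th (tw l) Y) | a l Y. Y \<in> contracted tw xs}"

text \<open>Under the pairing a contraction \<open>th (tw l)\<close> moves to \<open>f\<close> as
  \<open>dst (tw l)\<close> and a polynomial factor as a differential operator. The latter commutes
  with every \<open>dst\<close>, so what acts on \<open>f\<close> is a product of
  \<open>length xs\<close> of the given operators.\<close>

lemma epair_contracted:
  "(\<And>p. length p = length xs \<Longrightarrow> foldr (\<lambda>i. dst (tw i)) p f = 0) \<Longrightarrow> Y \<in> contracted tw xs \<Longrightarrow> epair f Y = 0"
proof (induction xs arbitrary: f Y)
  case Nil
  have "f = 0" using Nil.prems(1)[of "[]"] by (simp del: zero_fun_apply)
  then show ?case by (simp only: lin_zero[OF lin_epair(1)])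
next
  case (Cons i xs)
  have base: "epair f (pm a (th (tw l) Z)) = 0" if Z: "Z \<in> contracted tw xs" for a l Z
  proof -
    have pDf: "foldr (\<lambda>i. dst (tw i)) p (pD a X) = pD a (foldr (\<lambda>i. dst (tw i)) p X)" for p X
      by (induction p) (simp_all add: pD_dst)
    have "epair (dst (tw l) (pD a f)) Z = 0"
    proof (rule Cons.IH[OF _ Z])
      fix p :: "'r list" assume "length p = length xs"
      then have z: "foldr (\<lambda>i. dst (tw i)) (p @ [l]) f = 0" by (intro Cons.prems(1)) simp
      have "foldr (\<lambda>i. dst (tw i)) p (dst (tw l) (pD a f)) = pD a (foldr (\<lambda>i. dst (tw i)) (p @ [l]) f)"
        by (simp add: pD_dst[symmetric] pDf)
      then show "foldr (\<lambda>i. dst (tw i)) p (dst (tw l) (pD a f)) = 0" unfolding z lin_zero[OF lin_pD] .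
    qed
    then show ?thesis by (simp add: epair_pm epair_th)
  qed
  from Cons.prems(2) have "Y \<in> es.span {pm a (th (tw l) Z) | a l Z. Z \<in> contracted tw xs}" by simp
  then show ?case
  proof (induction rule: es.span_induct_alt)
    case base
    show ?case by (rule lin_zero[OF lin_epair(2)])
  next
    case (step c x y)
    then show ?case unfolding lin_add[OF lin_epair(2)] lin_scale[OF lin_epair(2)] using base by auto
  qed
qed

text \<open>The average is the contraction by an element \<open>t\<close> of S(V) tensor the dual of
  M. Being an orbit sum, \<open>t\<close> is invariant and hence a polynomial combination of the
  \<open>tw l\<close>.\<close>

lemma averaged_contraction:
  assumes tw_span: "\<And>F. (\<And>g. g \<in> G \<Longrightarrow> actSMd \<rho> g F = F) \<Longrightarrow> \<exists>a. F = (\<lambda>j. \<Sum>i\<in>UNIV. a i * tw i j)"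
    and h: "h \<in> G" and Y: "Y \<in> contracted tw xs"
  shows "(\<Sum>g\<in>G. pm (actS g e) (F2.Zl (Inr k, g ** h) Y)) \<in> contracted tw (i # xs)"
proof -
  define t where "t = (\<lambda>j. \<Sum>g\<in>G. pconst (matrix_inv (\<rho> (g ** h)) $ k $ j) * actS g e)"
  have "(\<Sum>g\<in>G. pm (actS g e) (F2.Zl (Inr k, g ** h) Y)) =
    (\<Sum>g\<in>G. \<Sum>j\<in>UNIV. pm (pconst (matrix_inv (\<rho> (g ** h)) $ k $ j) * actS g e) (ctr j Y))"
    by (simp add: Zl'_odd pm_sum_right pm_pconst[symmetric] pm_pm mult.commute)
  also have "\<dots> = th t Y"
    by (subst sum.swap) (simp add: th_def t_def pm_sum_left)
  finally have eq: "(\<Sum>g\<in>G. pm (actS g e) (F2.Zl (Inr k, g ** h) Y)) = th t Y" .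
  have "actSMd \<rho> g' t = t" if g': "g' \<in> G" for g'
  proof
    fix k'
    have actS_sum: "actS g' (sum f A) = (\<Sum>g\<in>A. actS g' (f g))" for f and A :: "('a, 'n) sqmat set"
      by (induction A rule: infinite_finite_induct) (simp_all add: actS_psubst psubst_add)
    have actS_const: "actS g' (pconst c * f) = pconst c * actS g' f" for c f
      by (simp add: actS_psubst psubst_pconst_mult)
    have "actSMd \<rho> g' t k' = (\<Sum>j\<in>UNIV. \<Sum>g\<in>G. pconst (matrix_inv (\<rho> (g ** h)) $ k $ j * matrix_inv (\<rho> g') $ j $ k') * actS (g' ** g) e)"
      unfolding actSMd_def t_def actS_sum sum_distrib_left
      by (intro sum.cong refl) (simp add: actS_mult actS_const pconst_mult mult.assoc mult.left_commute)
    also have "\<dots> = (\<Sum>g\<in>G. pconst ((matrix_inv (\<rho> (g ** h)) ** matrix_inv (\<rho> g')) $ k $ k') * actS (g' ** g) e)"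
      by (subst sum.swap) (simp add: sum_distrib_right[symmetric] pconst_sum matrix_matrix_mult_def)
    also have "\<dots> = (\<Sum>g\<in>G. pconst (matrix_inv (\<rho> ((g' ** g) ** h)) $ k $ k') * actS (g' ** g) e)"
    proof (rule sum.cong[OF refl])
      fix g assume "g \<in> G"
      then have "matrix_inv (\<rho> (g ** h)) ** matrix_inv (\<rho> g') = matrix_inv (\<rho> ((g' ** g) ** h))"
        using g' h by (simp add: rho_inv rho_mult[symmetric] inv_mult[symmetric] mult_G inv_G matrix_mul_assoc)
      then show "pconst ((matrix_inv (\<rho> (g ** h)) ** matrix_inv (\<rho> g')) $ k $ k') * actS (g' ** g) e
        = pconst (matrix_inv (\<rho> ((g' ** g) ** h)) $ k $ k') * actS (g' ** g) e" by simp
    qed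
    also have "\<dots> = t k'" unfolding t_def by (rule sum.reindex_bij_betw[OF bij_mult[OF g']])
    finally show "actSMd \<rho> g' t k' = t k'" .
  qed
  then obtain a where a: "t = (\<lambda>j. \<Sum>l\<in>UNIV. a l * tw l j)" using tw_span by blast
  have "th t Y = (\<Sum>l\<in>UNIV. pm (a l) (th (tw l) Y))"
    unfolding a th_def pm_sum_left pm_sum_right pm_pm by (rule sum.swap)
  then show ?thesis unfolding eq contracted.simps using Y
    by (simp only:) (intro es.span_sum es.span_base, blast)
qed

text \<open>The letters labelled \<open>Some i\<close> form one block and see only the value
  \<open>p i\<close>. Summing over that value averages the block independently of the rest, and the
  average is a contraction of the kind handled by \<open>averaged_contraction\<close>.\<close>

lemma sum_block_words:
  assumes tw_span: "\<And>F. (\<And>g. g \<in> G \<Longrightarrow> actSMd \<rho> g F = F) \<Longrightarrow> \<exists>a. F = (\<lambda>j. \<Sum>i\<in>UNIV. a i * tw i j)"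
  shows "distinct xs \<Longrightarrow> blockpat xs (F2.pat C) \<Longrightarrow> F2.labelled C \<Longrightarrow>
    (\<Sum>p\<in>Pi\<^sub>E (set xs) (\<lambda>_. G). F2.Zw (map (F2.act (ext1 p)) C) (basis UNIV)) \<in> contracted tw xs"
proof (induction xs arbitrary: C)
  case Nil
  then show ?case by simp
next
  case (Cons i xs)
  from blockpat_block[OF Cons.prems(2) refl] obtain m w' where
    w: "F2.pat C = replicate m (False, Some i) @ (True, Some i) # w'" "blockpat xs w'" by blast
  define E where "E = take m C"
  have lenC: "length C > m" using arg_cong[OF w(1), of length] by (simp add: F2.pat_def)
  obtain v C' where C: "C = E @ v # C'" using lenC id_take_nth_drop[of m C] unfolding E_def by blast
  have lenE: "length E = m" using lenC by (simp add: E_def)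
  have "F2.pat E @ F2.pat (v # C') = replicate m (False, Some i) @ (True, Some i) # w'"
    using w(1) by (simp add: C F2.pat_def)
  then have pats: "F2.pat E = replicate m (False, Some i)" "F2.pat (v # C') = (True, Some i) # w'"
    using lenE by (auto simp: append_eq_append_conv F2.pat_def)
  obtain k h where v: "v = ((Inr k, h), Some i)"
  proof -
    have "odd_letter (fst (fst v))" "snd v = Some i" using pats(2) by (auto simp: F2.pat_def)
    moreover from this obtain k where "fst (fst v) = Inr k" by (cases "fst (fst v)") auto
    ultimately show ?thesis using that[of k "snd (fst v)"] by (metis prod.collapse)
  qed
  have C': "blockpat xs (F2.pat C')" "F2.labelled C'" "h \<in> G"
    using pats(2) w(2) Cons.prems(3) by (auto simp: F2.pat_def F2.labelled_def C v F2.A_def)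
  have i: "i \<notin> set xs" "distinct xs" using Cons.prems(1) by auto
  \<comment> \<open>The even letters at the head of a block multiply by the translate of a single
    polynomial \<open>e\<close>, chosen before g and p.\<close>
  have E: "\<exists>e. \<forall>g\<in>G. \<forall>p X. F2.Zw (map (F2.act (ext1 (p(i := g)))) E) X = pm (actS g e) X"
    if "F2.pat E = replicate m (False, Some i)" "F2.labelled E" for E m
    using that
  proof (induction E arbitrary: m)
    case Nil
    show ?case by (rule exI[of _ 1]) (simp add: actS_psubst)
  next
    case (Cons u E)
    then have u: "\<not> odd_letter (fst (fst u))" "snd u = Some i" and "\<exists>m'. F2.pat E = replicate m' (False, Some i)"
      by (auto simp: F2.pat_def Cons_replicate_eq)
    moreover have "F2.labelled E" using Cons.prems(2) by (simp add: F2.labelled_def)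
    ultimately obtain e where e: "\<forall>g\<in>G. \<forall>p X. F2.Zw (map (F2.act (ext1 (p(i := g)))) E) X = pm (actS g e) X"
      using Cons.IH by blast
    obtain j where j: "fst (fst u) = Inl j" using u(1) by (cases "fst (fst u)") auto
    show ?case
    proof (intro exI[of _ "actS (snd (fst u)) (pvar j) * e"] ballI allI)
      fix g p X assume "g \<in> G"
      then show "F2.Zw (map (F2.act (ext1 (p(i := g)))) (u # E)) X = pm (actS g (actS (snd (fst u)) (pvar j) * e)) X"
        using e by (simp add: F2.act_def ext1_def u(2) j Zl'_even actS_mult pm_pm)
          (simp add: actS_psubst psubst_mult)
    qed
  qed
  have "F2.labelled E" using Cons.prems(3) by (auto simp: F2.labelled_def C)
  then obtain e where e: "\<And>g p X. g \<in> G \<Longrightarrow> F2.Zw (map (F2.act (ext1 (p(i := g)))) E) X = pm (actS g e) X"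
    using E[OF pats(1)] by blast
  have same: "map (F2.act (ext1 (p(i := g)))) C' = map (F2.act (ext1 p)) C'" for p g
  proof (rule map_cong[OF refl])
    fix u assume "u \<in> set C'"
    then have "snd u \<in> insert None (Some ` set xs)"
      using blockpat_labels[OF C'(1)] by (force simp: F2.pat_def)
    then show "F2.act (ext1 (p(i := g))) u = F2.act (ext1 p) u"
      using i(1) by (auto simp: F2.act_def ext1_def)
  qed
  define Y where "Y = (\<Sum>p\<in>Pi\<^sub>E (set xs) (\<lambda>_. G). F2.Zw (map (F2.act (ext1 p)) C') (basis UNIV))"
  have Y: "Y \<in> contracted tw xs" unfolding Y_def by (rule Cons.IH[OF i(2) C'(1,2)])
  have "(\<Sum>g\<in>G. pm (actS g e) (F2.Zl (Inr k, g ** h) Y)) \<in> contracted tw (i # xs)"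
    by (rule averaged_contraction) (fact tw_span C'(3) Y)+
  moreover have "(\<Sum>p\<in>Pi\<^sub>E (set (i # xs)) (\<lambda>_. G). F2.Zw (map (F2.act (ext1 p)) C) (basis UNIV)) =
    (\<Sum>g\<in>G. \<Sum>p\<in>Pi\<^sub>E (set xs) (\<lambda>_. G). F2.Zw (map (F2.act (ext1 (p(i := g)))) C) (basis UNIV))"
    by (simp only: list.set sum_PiE_insert[OF i(1)])
  moreover have "\<dots> = (\<Sum>g\<in>G. pm (actS g e) (F2.Zl (Inr k, g ** h) Y))"
  proof (rule sum.cong[OF refl])
    fix g assume g: "g \<in> G"
    have "F2.Zw (map (F2.act (ext1 (p(i := g)))) C) (basis UNIV) =
      pm (actS g e) (F2.Zl (Inr k, g ** h) (F2.Zw (map (F2.act (ext1 p)) C') (basis UNIV)))" for p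
      unfolding C map_append foldr_append comp_def e[OF g] by (simp add: same) (simp add: v F2.act_def ext1_def)
    then show "(\<Sum>p\<in>Pi\<^sub>E (set xs) (\<lambda>_. G). F2.Zw (map (F2.act (ext1 (p(i := g)))) C) (basis UNIV)) =
      pm (actS g e) (F2.Zl (Inr k, g ** h) Y)"
      unfolding Y_def lin_sum[OF F2.lin_Zl] pm_sum_right by simp
  qed
  ultimately show ?case by simp
qed

text \<open>Up to sign, \<Delta> arises from \<open>b\<close> times the top form by contracting with
  all \<omega> i. Each of these r contractions may be translated by its own group element without
  changing the result, so \<Delta> is a constant value of a family of block words. If the product of
  all \<open>dst\<close> annihilated \<Delta>, it would be orthogonal to every averaged block word
  on the other side, hence to all words, and would vanish.\<close>

theorem top_nonzero:
  fixes \<omega> tw :: "'r \<Rightarrow> 'r \<Rightarrow> ('n, 'a) pol"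
  assumes omega: "\<And>i g. g \<in> G \<Longrightarrow> actSdM \<rho> g (\<omega> i) = \<omega> i"
    and tw_span: "\<And>F. (\<And>g. g \<in> G \<Longrightarrow> actSMd \<rho> g F = F) \<Longrightarrow> \<exists>a. F = (\<lambda>j. \<Sum>i\<in>UNIV. a i * tw i j)"
    and \<Delta>: "\<Delta> = pdet \<omega> * b" "\<Delta> \<noteq> 0"
  shows "foldr (\<lambda>i. dst (tw i)) (sorted_list_of_set UNIV) (embS \<Delta>) \<noteq> 0"
proof
  let ?U = "sorted_list_of_set (UNIV :: 'r set)"
  let ?top = "basis UNIV :: ('r, 'n, 'a) sext"
  assume zero: "foldr (\<lambda>i. dst (tw i)) ?U (embS \<Delta> :: ('r, 'n, 'a) sext) = 0"
  interpret an: anticomm escale "\<lambda>i. dst (tw i) :: ('r, 'n, 'a) sext \<Rightarrow> _" by (rule anticomm_dst)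
  \<comment> \<open>Products of r operators in any order also vanish: with a repeated index by
    anticommutation, otherwise as a rearrangement of the full product.\<close>
  have kill: "foldr (\<lambda>i. dst (tw i)) p (embS \<Delta> :: ('r, 'n, 'a) sext) = 0" if len: "length p = length ?U" for p
  proof (cases "distinct p")
    case True
    then have "set p = UNIV" using len distinct_card[OF True] by (simp add: card_eq_UNIV_imp_eq_UNIV)
    then have "mset p = mset ?U" using True by (subst set_eq_iff_mset_eq_distinct[symmetric]) auto
    from an.perm_sign[OF this] obtain m where
      "\<And>X. foldr (\<lambda>i. dst (tw i)) p X = nsg m (foldr (\<lambda>i. dst (tw i)) ?U X)" by blast
    then show ?thesis by (simp only: zero nsg_zero)
  qed (rule an.not_distinct)
  obtain n where n: "foldr (\<lambda>i. th (\<omega> i)) ?U ?top = nsg n (embS (pdet \<omega>))" using foldr_th_top by blast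
  \<comment> \<open>One free group element for each of the r factors, and the identity on the label
    \<open>None\<close>.\<close>
  define \<Gamma> where "\<Gamma> = ext1 ` (Pi\<^sub>E (UNIV :: 'r set) (\<lambda>_. G))"
  have \<Gamma>G: "\<gamma> l \<in> G" if \<gamma>: "\<gamma> \<in> \<Gamma>" for \<gamma> l
  proof -
    obtain p where p: "\<gamma> = ext1 p" "p \<in> Pi\<^sub>E UNIV (\<lambda>_. G)" using \<gamma> unfolding \<Gamma>_def by blast
    then have "p i \<in> G" for i using PiE_mem[OF p(2), of i] by simp
    then show ?thesis using one_G by (auto simp: p(1) ext1_def split: option.split)
  qed
  define f where "f = nsg n (embS \<Delta> :: ('r, 'n, 'a) sext)"
  \<comment> \<open>The expansion of the translate of \<open>th (\<omega> i)\<close> by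
    \<open>\<gamma> (Some i)\<close> has one odd letter preceded by even letters, all labelled
    \<open>Some i\<close>; invariance of \<omega> i makes this operator the same for all
    \<gamma>.\<close>
  have "\<exists>H\<in>ft.span (block_fams xs). \<forall>\<gamma>\<in>\<Gamma>. H \<gamma> = foldr (\<lambda>i. th (\<omega> i)) xs (pm b ?top)" for xs
  proof (induction xs)
    case Nil
    have "F2.labelled ([] :: (_ \<times> 'r option) list)" "blockpat [] (F2.pat ([] :: (_ \<times> 'r option) list))"
      by (simp_all add: F2.labelled_def F2.pat_def blockpat.nil)
    then have "(\<lambda>\<gamma>. F2.Yw (map (F2.act \<gamma>) []) ?top) \<in> block_fams []" unfolding block_fams_def by blast
    then have "(\<lambda>\<gamma>. ?top) \<in> ft.span (block_fams [])" by (intro ft.span_base) simp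
    from block_fams_pm[OF this blockpat.tail, of b]
    show ?case by (rule bexI[rotated]) (auto simp: \<Gamma>_def ext1_def actSd_mat1)
  next
    case (Cons i xs)
    then obtain H where H: "H \<in> ft.span (block_fams xs)" "\<And>\<gamma>. \<gamma> \<in> \<Gamma> \<Longrightarrow> H \<gamma> = foldr (\<lambda>i. th (\<omega> i)) xs (pm b ?top)"
      by blast
    define H' where "H' = (\<Sum>k\<in>UNIV. (\<lambda>\<gamma>. pm (actSd (\<gamma> (Some i)) (\<omega> i k)) (F2.Yl (Inr k, \<gamma> (Some i)) (H \<gamma>))))"
    have "H' \<in> ft.span (block_fams (i # xs))" unfolding H'_def
    proof (rule ft.span_sum)
      fix k
      have "(\<lambda>\<gamma>. F2.Yl (Inr k, \<gamma> (Some i)) (H \<gamma>)) \<in> ft.span (block_fams (i # xs))"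
        by (rule block_fams_cons[OF H(1)]) (simp add: blockpat.odd)
      from block_fams_pm[OF this blockpat.even]
      show "(\<lambda>\<gamma>. pm (actSd (\<gamma> (Some i)) (\<omega> i k)) (F2.Yl (Inr k, \<gamma> (Some i)) (H \<gamma>))) \<in> ft.span (block_fams (i # xs))" .
    qed
    moreover have "H' \<gamma> = foldr (\<lambda>i. th (\<omega> i)) (i # xs) (pm b ?top)" if \<gamma>: "\<gamma> \<in> \<Gamma>" for \<gamma>
    proof -
      let ?g = "\<gamma> (Some i)" and ?X = "foldr (\<lambda>i. th (\<omega> i)) xs (pm b ?top)"
      have "H' \<gamma> = (\<Sum>k\<in>UNIV. pm (actSd ?g (\<omega> i k)) (F2.Yl (Inr k, ?g) (H \<gamma>)))"
        unfolding H'_def by (rule sum_fun_apply)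
      also have "\<dots> = (\<Sum>k\<in>UNIV. \<Sum>j\<in>UNIV. pm (pconst (\<rho> ?g $ j $ k) * actSd ?g (\<omega> i k)) (ctr j ?X))"
        unfolding Yl'_odd H(2)[OF \<gamma>]
        by (simp add: pm_sum_right pm_pconst[symmetric] pm_pm mult.commute)
      also have "\<dots> = th (actSdM \<rho> ?g (\<omega> i)) ?X"
        by (subst sum.swap) (simp add: th_def actSdM_def pm_sum_left)
      finally show ?thesis by (simp add: omega[OF \<Gamma>G[OF \<gamma>]])
    qed
    ultimately show ?case by blast
  qed
  then obtain H where H: "H \<in> ft.span (block_fams ?U)" "\<And>\<gamma>. \<gamma> \<in> \<Gamma> \<Longrightarrow> H \<gamma> = foldr (\<lambda>i. th (\<omega> i)) ?U (pm b ?top)"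
    by blast
  have "foldr (\<lambda>i. th (\<omega> i)) xs (pm b X) = pm b (foldr (\<lambda>i. th (\<omega> i)) xs X)" for xs X
    by (induction xs) (simp_all add: th_pm)
  then have Hf: "H \<gamma> = f" if "\<gamma> \<in> \<Gamma>" for \<gamma>
    using H(2)[OF that] by (simp add: n f_def nsg_lin[OF lin_pm] embS_pm pm_pm \<Delta>(1) mult.commute)
  have words: "epair f (F2.Zw W ?top) = 0" if W: "set W \<subseteq> F2.A" for W
  proof (rule F2.orthogonal_to_dual_family[of \<Gamma> H "Collect (blockpat ?U)" f W])
    show "finite \<Gamma>" "\<Gamma> \<noteq> {}" using one_G finite_G by (auto simp: \<Gamma>_def PiE_eq_empty_iff intro!: finite_imageI finite_PiE)
    show "H \<in> ft.span {\<lambda>\<gamma>. F2.Yw (map (F2.act \<gamma>) V) ?top | V. F2.labelled V \<and> F2.pat V \<in> Collect (blockpat ?U)}"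
      using H(1) by (simp only: block_fams_def mem_Collect_eq)
    fix C :: "((('n + 'r) \<times> ('a, 'n) sqmat) \<times> 'r option) list"
    assume C: "F2.labelled C" "F2.pat C \<in> Collect (blockpat ?U)"
    have inj: "inj_on ext1 (Pi\<^sub>E (UNIV :: 'r set) (\<lambda>_. G))"
    proof (rule inj_onI)
      fix p q :: "'r \<Rightarrow> ('a, 'n) sqmat" assume eq: "ext1 p = ext1 q"
      have "p i = q i" for i using fun_cong[OF eq, of "Some i"] by (simp add: ext1_def)
      then show "p = q" by blast
    qed
    have "(\<Sum>\<gamma>\<in>\<Gamma>. epair f (F2.Zw (map (F2.act \<gamma>) C) ?top)) =
      epair f (\<Sum>p\<in>Pi\<^sub>E (set ?U) (\<lambda>_. G). F2.Zw (map (F2.act (ext1 p)) C) ?top)"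
      unfolding \<Gamma>_def sum.reindex[OF inj] lin_sum[OF lin_epair(2)] by simp
    also have "\<dots> = 0"
    proof (rule epair_contracted)
      show "(\<Sum>p\<in>Pi\<^sub>E (set ?U) (\<lambda>_. G). F2.Zw (map (F2.act (ext1 p)) C) ?top) \<in> contracted tw ?U"
        by (rule sum_block_words, fact tw_span) (use C in auto)
      show "foldr (\<lambda>i. dst (tw i)) p f = 0" if "length p = length ?U" for p
        unfolding f_def nsg_lin[OF an.foldr_lin] kill[OF that] by (rule nsg_zero)
    qed
    finally show "(\<Sum>\<gamma>\<in>\<Gamma>. epair f (F2.Zw (map (F2.act \<gamma>) C) ?top)) = 0" .
  qed (use \<Gamma>G Hf W in auto)
  let ?Wt = "es.span {foldr zt u ?top | u. True}"
  have prefix: "zt a X \<in> ?Wt" if "X \<in> ?Wt" for a X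
    using that
  proof (induction rule: es.span_induct_alt)
    case base
    then show ?case by (simp only: lin_zero[OF lin_letter(3)] es.span_zero)
  next
    case (step c x y)
    then obtain u where u: "x = foldr zt u ?top" by blast
    have mem: "zt a x \<in> {foldr zt u ?top | u. True}" unfolding u by (rule CollectI, rule exI[of _ "a # u"]) simp
    show ?case unfolding lin_add[OF lin_letter(3)] lin_scale[OF lin_letter(3)]
      by (rule es.span_add[OF es.span_scale[OF es.span_base[OF mem]] step(2)])
  qed
  have orth: "epair f X = 0" if "X \<in> ?Wt" for X
    using that
  proof (induction rule: es.span_induct_alt)
    case base
    show ?case by (rule lin_zero[OF lin_epair(2)])
  next
    case (step c x y)
    then obtain u where u: "x = foldr zt u ?top" by blast
    have "F2.Zw (map (\<lambda>a. (a, mat 1)) v) X = foldr zt v X" for v X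
      by (induction v) (simp_all add: Zl'_one)
    moreover have "set (map (\<lambda>a. (a, mat 1)) u) \<subseteq> F2.A" using one_G by (auto simp: F2.A_def)
    ultimately have "epair f x = 0" using words[of "map (\<lambda>a. (a, mat 1)) u"] by (simp add: u)
    then show ?case unfolding lin_add[OF lin_epair(2)] lin_scale[OF lin_epair(2)] using step by simp
  qed
  obtain m where m: "foldr ctr ?U ?top = nsg m eone"
    using foldr_ctr_basis[of ?U "{}"] by (auto simp: eone_basis)
  \<comment> \<open>Contracting the top form completely leaves a signed 1, so the words include
    every polynomial up to sign. This suffices, as only the scalar part of \<open>f\<close> is
    nonzero.\<close>
  have "pm s (foldr ctr ?U ?top) \<in> ?Wt" for s
  proof (induction s rule: pol_induct)
    case (const c)
    have "foldr zt (map Inr xs) X = foldr ctr xs X" for xs :: "'r list" and X :: "('r, 'n, 'a) sext"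
      by (induction xs) simp_all
    then have "foldr ctr ?U ?top \<in> {foldr zt u ?top | u. True}"
      by (intro CollectI exI[of _ "map Inr ?U"]) simp
    then show ?case unfolding pm_pconst by (intro es.span_scale es.span_base)
  next
    case (add s t)
    show ?case unfolding pm_add_left by (rule es.span_add[OF add])
  next
    case (var i s)
    show ?case using prefix[OF var, of "Inl i"] by (simp add: pm_pm)
  qed
  then have z: "epair f (pm s (foldr ctr ?U ?top)) = 0" for s by (rule orth)
  have "ppair \<Delta> s = 0" for s
  proof -
    have "nsg m (nsg n (epair (embS \<Delta> :: ('r, 'n, 'a) sext) (pm s eone))) = 0"
      using z[of s] unfolding m f_def
      by (simp add: nsg_lin[OF lin_pm] nsg_lin[OF lin_epair(1)] nsg_lin[OF lin_epair(2)])
    then have "epair (embS \<Delta> :: ('r, 'n, 'a) sext) (pm s eone) = 0" by (simp add: nsg_eq_0)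
    moreover have "epair (embS \<Delta> :: ('r, 'n, 'a) sext) (pm s eone) = (\<Sum>I\<in>(UNIV :: 'r set set). if I = {} then ppair \<Delta> s else 0)"
      unfolding epair_ppair by (rule sum.cong) (auto simp: embS_def pm_def eone_def)
    ultimately show ?thesis by simp
  qed
  then have "\<Delta> = 0" by (intro ppair_nondegenerate)
  then show False using \<Delta>(2) by simp
qed

end

section \<open>Independence, dimension count and the basis theorem\<close>

lemma refl_rep_of_group:
  assumes G: "finite_pseudo_reflection_group G"
    and "\<forall>g\<in>G. \<forall>h\<in>G. \<rho> (g ** h) = \<rho> g ** \<rho> h" and "\<rho> (mat 1) = mat 1"
  shows "refl_rep G \<rho>"
proof
  have gen: "G = gen_group {g\<in>G. pseudo_reflection g}"
    using G by (simp add: finite_pseudo_reflection_group_def)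
  show "finite G" "\<And>g. g \<in> G \<Longrightarrow> invertible g" using G by (auto simp: finite_pseudo_reflection_group_def)
  show "mat 1 \<in> G" by (subst gen) (rule gen_group.one)
  show "g ** h \<in> G" if "g \<in> G" "h \<in> G" for g h using that gen gen_group.mult by metis
  show "matrix_inv g \<in> G" if "g \<in> G" for g using that gen gen_group.inv by metis
qed (use assms in auto)

lemma foldr_dst_complement:
  fixes tw :: "'r::{finite,linorder} \<Rightarrow> 'r \<Rightarrow> ('n::{finite,linorder}, 'a::field_char_0) pol"
  defines "B \<equiv> \<lambda>I X. foldr (\<lambda>i. dst (tw i)) (sorted_list_of_set I) (X :: ('r, 'n, 'a) sext)"
  shows "J \<inter> K \<noteq> {} \<Longrightarrow> B J (B K X) = 0"
    and "\<exists>n. B (- K) (B K X) = nsg n (B UNIV X)"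
proof -
  interpret an: anticomm escale "\<lambda>i. dst (tw i) :: ('r, 'n, 'a) sext \<Rightarrow> _" by (rule anticomm_dst)
  let ?s = "sorted_list_of_set :: 'r set \<Rightarrow> 'r list"
  have B: "B J (B K X) = foldr (\<lambda>i. dst (tw i)) (?s J @ ?s K) X" for J K X by (simp add: B_def)
  show "B J (B K X) = 0" if "J \<inter> K \<noteq> {}"
    unfolding B by (rule an.not_distinct) (use that in auto)
  have "distinct (?s (- K) @ ?s K)" "set (?s (- K) @ ?s K) = set (?s UNIV)" by auto
  then have "mset (?s (- K) @ ?s K) = mset (?s UNIV)"
    by (metis distinct_sorted_list_of_set set_eq_iff_mset_eq_distinct)
  from an.perm_sign[OF this] obtain n where
    "\<And>X. foldr (\<lambda>i. dst (tw i)) (?s (- K) @ ?s K) X = nsg n (foldr (\<lambda>i. dst (tw i)) (?s UNIV) X)" by blast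
  then have "B (- K) (B K X) = nsg n (B UNIV X)" unfolding B by (simp only: B_def)
  then show "\<exists>n. B (- K) (B K X) = nsg n (B UNIV X)" by blast
qed

text \<open>Apply the product over \<open>- K\<close> to the relation. Terms with an index outside
  \<open>K\<close> repeat an operator and vanish, proper subsets of \<open>K\<close> have
  coefficient 0 by induction on the size, and \<open>K\<close> itself gives the nonzero top product
  up to sign.\<close>

lemma foldr_dst_independent:
  fixes tw :: "'r::{finite,linorder} \<Rightarrow> 'r \<Rightarrow> ('n::{finite,linorder}, 'a::field_char_0) pol"
  defines "B \<equiv> \<lambda>I X. foldr (\<lambda>i. dst (tw i)) (sorted_list_of_set I) (X :: ('r, 'n, 'a) sext)"
  assumes top: "B UNIV X \<noteq> 0" and sum: "(\<Sum>I\<in>UNIV. escale (c I) (B I X)) = 0"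
  shows "c K = 0"
proof (induction K rule: measure_induct_rule[where f = card])
  case (less K)
  have lin: "lin escale escale (B J)" for J
    unfolding B_def by (rule lin_foldr) (rule lin_dst)
  have "0 = B (- K) (\<Sum>I\<in>UNIV. escale (c I) (B I X))" unfolding sum lin_zero[OF lin] ..
  also have "\<dots> = (\<Sum>I\<in>UNIV. escale (c I) (B (- K) (B I X)))"
    by (simp only: lin_sum[OF lin] lin_scale[OF lin])
  also have "\<dots> = (\<Sum>I\<in>UNIV. if I = K then escale (c K) (B (- K) (B K X)) else 0)"
  proof (rule sum.cong[OF refl])
    fix I
    consider "I = K" | "- K \<inter> I \<noteq> {}" | "I \<subset> K" by blast
    then show "escale (c I) (B (- K) (B I X)) = (if I = K then escale (c K) (B (- K) (B K X)) else 0)"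
    proof cases
      case 2
      then have "B (- K) (B I X) = 0" unfolding B_def by (rule foldr_dst_complement(1))
      then show ?thesis using 2 by auto
    next
      case 3
      then have "c I = 0" by (intro less) (simp add: psubset_card_mono)
      then show ?thesis using 3 by auto
    qed auto
  qed
  also have "\<dots> = escale (c K) (B (- K) (B K X))" by simp
  finally have "escale (c K) (B (- K) (B K X)) = 0" by simp
  moreover obtain n where "B (- K) (B K X) = nsg n (B UNIV X)"
    using foldr_dst_complement(2)[of tw K X] unfolding B_def by blast
  ultimately show "c K = 0" using top by (simp only: es.scale_eq_0_iff nsg_eq_0) blast
qed

text \<open>The matrix of B with respect to E modulo J is invertible.\<close>

lemma basis_exchange_mod:
  fixes B E :: "'i::finite \<Rightarrow> ('r, 'n, 'a::field) sext"
  assumes J: "es.subspace J"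
    and ind: "\<And>c. (\<Sum>i\<in>UNIV. escale (c i) (B i)) \<in> J \<Longrightarrow> \<forall>i. c i = 0"
    and BE: "\<And>i. \<exists>a. B i - (\<Sum>j\<in>UNIV. escale (a j) (E j)) \<in> J"
    and F: "\<exists>c. F - (\<Sum>j\<in>UNIV. escale (c j) (E j)) \<in> J"
  shows "\<exists>c. F - (\<Sum>i\<in>UNIV. escale (c i) (B i)) \<in> J"
proof -
  obtain a where a: "\<And>i. B i - (\<Sum>j\<in>UNIV. escale (a i j) (E j)) \<in> J" using BE by metis
  obtain c where c: "F - (\<Sum>j\<in>UNIV. escale (c j) (E j)) \<in> J" using F by blast
  define A where "A = (\<chi> i j. a i j)"
  have comb: "(\<Sum>i\<in>UNIV. escale (d i) (B i)) - (\<Sum>j\<in>UNIV. escale ((vec_lambda d v* A) $ j) (E j)) \<in> J" for d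
  proof -
    have "(\<Sum>i\<in>UNIV. escale (d i) (B i - (\<Sum>j\<in>UNIV. escale (a i j) (E j)))) \<in> J"
      by (intro es.subspace_sum[OF J] es.subspace_scale[OF J] a)
    moreover have "(\<Sum>i\<in>UNIV. escale (d i) (\<Sum>j\<in>UNIV. escale (a i j) (E j)))
      = (\<Sum>j\<in>UNIV. escale ((vec_lambda d v* A) $ j) (E j))"
      unfolding escale_sum escale_escale
      by (subst sum.swap) (simp add: vector_matrix_mult_def A_def es.scale_sum_left mult.commute)
    ultimately show ?thesis by (simp only: es.scale_right_diff_distrib sum_subtractf)
  qed
  have "inj ((*v) (transpose A))"
  proof (rule injI)
    fix x y assume eq: "transpose A *v x = transpose A *v y"
    have "(x - y) v* A = 0"
      using eq by (simp add: matrix_vector_mult_diff_distrib flip: transpose_matrix_vector)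
    then have "(\<Sum>i\<in>UNIV. escale ((x - y) $ i) (B i)) \<in> J"
      using comb[of "\<lambda>i. (x - y) $ i"] by (simp only: vec_lambda_eta zero_index escale_zero sum.neutral_const diff_zero)
    then have "\<forall>i. (x - y) $ i = 0" by (rule ind)
    then show "x = y" by (simp add: vec_eq_iff)
  qed
  then obtain A' where "A' ** transpose A = mat 1"
    using matrix_left_invertible_injective by blast
  then have "transpose A ** A' = mat 1" by (simp add: matrix_left_right_inverse)
  then have "transpose A *v (A' *v vec_lambda c) = vec_lambda c"
    by (simp add: matrix_vector_mul_assoc)
  then have d: "(A' *v vec_lambda c) v* A = vec_lambda c" by (simp add: transpose_matrix_vector)
  define d where "d i = (A' *v vec_lambda c) $ i" for i
  have "vec_lambda d = A' *v vec_lambda c" unfolding d_def[abs_def] by (rule vec_lambda_eta)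
  then have "vec_lambda d v* A = vec_lambda c" using d by simp
  then have "(\<Sum>i\<in>UNIV. escale (d i) (B i)) - (\<Sum>j\<in>UNIV. escale (c j) (E j)) \<in> J"
    using comb[of d] by simp
  from es.subspace_diff[OF J c this] have "F - (\<Sum>i\<in>UNIV. escale (d i) (B i)) \<in> J" by (simp only: diff_diff_eq2 diff_add_cancel)
  then show ?thesis by blast
qed

text \<open>Averaging with the inverse character produces a genuinely semiinvariant form; each
  summand differs from \<open>F\<close> by an element of the ideal only.\<close>

lemma (in refl_rep) semiinvariant_projection:
  assumes chi_hom: "\<And>g h. g \<in> G \<Longrightarrow> h \<in> G \<Longrightarrow> chi (g ** h) = chi g * chi h"
    and chi_nz: "\<And>g. g \<in> G \<Longrightarrow> chi g \<noteq> 0"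
    and F: "\<And>g. g \<in> G \<Longrightarrow> actVd \<rho> g F - escale (chi g) F \<in> inv_ideal G (actVd \<rho>)"
  shows "\<exists>F'. (\<forall>g\<in>G. actVd \<rho> g F' = escale (chi g) F') \<and> F - F' \<in> inv_ideal G (actVd \<rho>)"
proof -
  let ?J = "inv_ideal G (actVd \<rho>)"
  let ?q = "inverse (of_nat (card G)) :: 'a"
  have q: "?q * of_nat (card G) = 1" using finite_G one_G by (auto intro: left_inverse)
  define S where "S = (\<Sum>g\<in>G. escale (inverse (chi g)) (actVd \<rho> g F))"
  have act: "actVd \<rho> h S = escale (chi h) S" if h: "h \<in> G" for h
  proof -
    have "actVd \<rho> h S = (\<Sum>g\<in>G. escale (chi h) (escale (inverse (chi (h ** g))) (actVd \<rho> (h ** g) F)))"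
      unfolding S_def lin_sum[OF lin_actVd] lin_scale[OF lin_actVd]
      by (intro sum.cong refl) (simp add: actVd_mult h chi_hom chi_nz escale_escale)
    also have "\<dots> = escale (chi h) S"
      unfolding S_def escale_sum by (rule sum.reindex_bij_betw[OF bij_mult[OF h]])
    finally show ?thesis .
  qed
  have "(\<Sum>g\<in>G. escale (inverse (chi g)) (actVd \<rho> g F - escale (chi g) F)) \<in> ?J"
    by (intro es.subspace_sum[OF ideal_subspace] es.subspace_scale[OF ideal_subspace] F)
  moreover have "(\<Sum>g\<in>G. escale (inverse (chi g)) (actVd \<rho> g F - escale (chi g) F)) = S - escale (of_nat (card G)) F"
  proof -
    have "(\<Sum>g\<in>G. escale (inverse (chi g)) (escale (chi g) F)) = (\<Sum>g\<in>G. F)"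
      by (rule sum.cong) (simp_all add: escale_escale chi_nz)
    then show ?thesis
      unfolding es.scale_right_diff_distrib sum_subtractf S_def by (simp only: es.sum_constant_scale)
  qed
  ultimately have "escale (- ?q) (S - escale (of_nat (card G)) F) \<in> ?J"
    by (intro es.subspace_scale[OF ideal_subspace]) (simp only:)
  moreover have "escale (- ?q) (S - escale (of_nat (card G)) F) = F - escale ?q S"
    unfolding es.scale_right_diff_distrib escale_escale using q by simp
  ultimately have "F - escale ?q S \<in> ?J" by (simp only:)
  moreover have "actVd \<rho> g (escale ?q S) = escale (chi g) (escale ?q S)" if "g \<in> G" for g
    unfolding lin_scale[OF lin_actVd] act[OF that] escale_escale by (simp only: mult.commute)
  ultimately show ?thesis by blast
qed

text \<open>Classes modulo \<open>Jd\<close> are given by representatives, so their semiinvariance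
  is required only modulo \<open>Jd\<close>. Independence is indexed by subsets \<open>I\<close>,
  which includes that different subsets give different elements.\<close>

theorem theorem5p7:
  fixes G :: "(('a::field_char_0, 'n::{finite,linorder}) sqmat) set"
    and \<rho> :: "('a, 'n) sqmat \<Rightarrow> ('a, 'r::{finite,linorder}) sqmat"
    and chi :: "('a, 'n) sqmat \<Rightarrow> 'a"
    and \<Delta> :: "('n, 'a) pol"
    and \<omega> :: "'r \<Rightarrow> 'r \<Rightarrow> ('n, 'a) pol"
    and tw :: "'r \<Rightarrow> 'r \<Rightarrow> ('n, 'a) pol"
  assumes G: "finite_pseudo_reflection_group G"
    and rho_hom: "\<forall>g\<in>G. \<forall>h\<in>G. \<rho> (g ** h) = \<rho> g ** \<rho> h"
    and rho_one: "\<rho> (mat 1) = mat 1"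
    and M_inv_zero: "\<forall>v. (\<forall>g\<in>G. \<rho> g *v v = v) \<longrightarrow> v = 0"
    and chi_hom: "\<forall>g\<in>G. \<forall>h\<in>G. chi (g ** h) = chi g * chi h"
    and chi_nz: "\<forall>g\<in>G. chi g \<noteq> 0"
    and Delta_homog: "\<exists>d. phomog d \<Delta>"
    and Delta_chi: "\<forall>g\<in>G. actSd g \<Delta> = pconst (chi g) * \<Delta>"
    and Delta_gen: "\<forall>f. (\<forall>g\<in>G. actSd g f = pconst (chi g) * f)
                     \<longrightarrow> (\<exists>a. (\<forall>g\<in>G. actSd g a = a) \<and> f = a * \<Delta>)"
    and Delta_free: "\<forall>a. (\<forall>g\<in>G. actSd g a = a) \<and> a * \<Delta> = 0 \<longrightarrow> a = 0"
    and omega_inv: "\<forall>i. \<forall>g\<in>G. actSdM \<rho> g (\<omega> i) = \<omega> i"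
    and omega_homog: "\<forall>i. \<exists>d. \<forall>j. phomog d (\<omega> i j)"
    and omega_span: "\<forall>F. (\<forall>g\<in>G. actSdM \<rho> g F = F) \<longrightarrow>
        (\<exists>a. (\<forall>i. \<forall>g\<in>G. actSd g (a i) = a i) \<and> F = (\<lambda>j. \<Sum>i\<in>UNIV. a i * \<omega> i j))"
    and omega_indep: "\<forall>a. (\<forall>i. \<forall>g\<in>G. actSd g (a i) = a i) \<and> (\<lambda>j. \<Sum>i\<in>UNIV. a i * \<omega> i j) = (\<lambda>j. 0)
        \<longrightarrow> (\<forall>i. a i = 0)"
    and tw_inv: "\<forall>i. \<forall>g\<in>G. actSMd \<rho> g (tw i) = tw i"
    and tw_homog: "\<forall>i. \<exists>d. \<forall>j. phomog d (tw i j)"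
    and tw_span: "\<forall>F. (\<forall>g\<in>G. actSMd \<rho> g F = F) \<longrightarrow>
        (\<exists>a. (\<forall>i. \<forall>g\<in>G. actS g (a i) = a i) \<and> F = (\<lambda>j. \<Sum>i\<in>UNIV. a i * tw i j))"
    and tw_indep: "\<forall>a. (\<forall>i. \<forall>g\<in>G. actS g (a i) = a i) \<and> (\<lambda>j. \<Sum>i\<in>UNIV. a i * tw i j) = (\<lambda>j. 0)
        \<longrightarrow> (\<forall>i. a i = 0)"
    and J_dvd: "pdet \<omega> dvd \<Delta>"
  shows
    "(let B = (\<lambda>I. dstar_seq tw I (embS \<Delta>));
          H = harmonics (inv_ideal G (actV \<rho>)) \<inter> {F. \<forall>g\<in>G. actVd \<rho> g F = escale (chi g) F};
          Jd = inv_ideal G (actVd \<rho>)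
      in (\<forall>I. B I \<in> H)
       \<and> (\<forall>c. esum (\<lambda>I. escale (c I) (B I)) UNIV = ezero \<longrightarrow> (\<forall>I. c I = 0))
       \<and> (\<forall>F\<in>H. \<exists>c. F = esum (\<lambda>I. escale (c I) (B I)) UNIV)
       \<and> (\<forall>I. \<forall>g\<in>G. eminus (actVd \<rho> g (B I)) (escale (chi g) (B I)) \<in> Jd)
       \<and> (\<forall>c. esum (\<lambda>I. escale (c I) (B I)) UNIV \<in> Jd \<longrightarrow> (\<forall>I. c I = 0))
       \<and> (\<forall>F. (\<forall>g\<in>G. eminus (actVd \<rho> g F) (escale (chi g) F) \<in> Jd)
              \<longrightarrow> (\<exists>c. eminus F (esum (\<lambda>I. escale (c I) (B I)) UNIV) \<in> Jd)))"
proof -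
  interpret refl_rep G \<rho> by (rule refl_rep_of_group[OF G rho_hom rho_one])
  define B where "B I = foldr (\<lambda>i. dst (tw i)) (sorted_list_of_set I) (embS \<Delta> :: ('r, 'n, 'a) sext)" for I
  let ?J = "inv_ideal G (actVd \<rho>)"
  let ?H = "harmonics (inv_ideal G (actV \<rho>)) \<inter> {F. \<forall>g\<in>G. actVd \<rho> g F = escale (chi g) F}"
  obtain d where homog: "phomog d \<Delta>" using Delta_homog by blast
  obtain b where b: "\<Delta> = pdet \<omega> * b" using J_dvd by (auto elim: dvdE)
  have "actSd g 1 = 1" for g :: "('a, 'n) sqmat" by (simp add: actSd_psubst)
  \<comment> \<open>If \<Delta> were zero, the invariant 1 would violate freeness.\<close>
  then have nz: "\<Delta> \<noteq> 0" using Delta_free[rule_format, of 1] by auto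
  have tw0: "lookup (tw i k) 0 = 0" for i k
    by (rule constant_term_zero) (use M_inv_zero tw_inv in auto)
  have kill0: "Kill (embS \<Delta>)"
    by (rule Kill_semiinvariant[OF _ _ homog, of chi]) (use Delta_chi Delta_gen in blast)+
  have kill: "Kill (foldr (\<lambda>i. dst (tw i)) xs (embS \<Delta>))" for xs
  proof (induction xs)
    case (Cons i xs)
    show ?case unfolding foldr.simps comp_def by (rule Kill_dst[OF Cons]) (use tw_inv tw0 in auto)
  qed (simp add: kill0)
  have semi: "actVd \<rho> g (foldr (\<lambda>i. dst (tw i)) xs (embS \<Delta>)) = escale (chi g) (foldr (\<lambda>i. dst (tw i)) xs (embS \<Delta>))"
    if g: "g \<in> G" for g xs
  proof (induction xs)
    case Nil
    show ?case using Delta_chi g by (simp add: embS_pm actVd_pm actVd_eone pm_pconst pm_pm[symmetric])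
  next
    case (Cons i xs)
    then show ?case using tw_inv g by (simp add: actVd_dst lin_scale[OF lin_dst])
  qed
  have BH: "B I \<in> ?H" for I using Kill_harmonic[OF kill] semi by (simp add: B_def)
  have subH: "es.subspace ?H"
  proof (rule es.subspaceI)
    show "0 \<in> ?H" by (simp add: harmonics_def lin_zero[OF lin_epair(1)] lin_zero[OF lin_actVd])
    show "x + y \<in> ?H" if "x \<in> ?H" "y \<in> ?H" for x y
      using that by (simp add: harmonics_def lin_add[OF lin_epair(1)] lin_add[OF lin_actVd] escale_add)
    show "escale c x \<in> ?H" if "x \<in> ?H" for c x
      using that by (simp add: harmonics_def lin_scale[OF lin_epair(1)] lin_scale[OF lin_actVd] escale_escale mult.commute)
  qed
  have combH: "(\<Sum>I\<in>UNIV. escale (c I) (B I)) \<in> ?H" for c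
    by (intro es.subspace_sum[OF subH] es.subspace_scale[OF subH] BH)
  have HJ: "F = 0" if "F \<in> ?H" "F \<in> ?J" for F using harmonic_inter_ideal that by blast
  have top: "B UNIV \<noteq> 0" unfolding B_def
    by (rule top_nonzero[OF _ _ b nz]) (use omega_inv tw_span in blast)+
  have ind: "\<forall>I. c I = 0" if "(\<Sum>I\<in>UNIV. escale (c I) (B I)) = 0" for c
    using foldr_dst_independent[OF top[unfolded B_def] that[unfolded B_def]] by blast
  have indJ: "\<forall>I. c I = 0" if "(\<Sum>I\<in>UNIV. escale (c I) (B I)) \<in> ?J" for c
    by (rule ind) (rule HJ[OF combH that])
  obtain E :: "'r set \<Rightarrow> ('r, 'n, 'a) sext" where E: "\<And>F. \<forall>g\<in>G. actVd \<rho> g F = escale (chi g) F \<Longrightarrow>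
      \<exists>c. F - (\<Sum>K\<in>UNIV. escale (c K) (E K)) \<in> ?J"
  proof -
    have "\<exists>E :: 'r set \<Rightarrow> ('r, 'n, 'a) sext. \<forall>F. (\<forall>g\<in>G. actVd \<rho> g F = escale (chi g) F) \<longrightarrow>
        (\<exists>c. F - (\<Sum>K\<in>UNIV. escale (c K) (E K)) \<in> ?J)"
      by (rule semiinvariant_mod_ideal[OF _ b nz]) (use omega_inv Delta_gen in blast)+
    then show ?thesis using that by blast
  qed
  \<comment> \<open>Dimension count: the \<open>B I\<close> are independent modulo the ideal and lie
    in the span of the equally many \<open>E K\<close>, so they span the same space.\<close>
  have spanJ: "\<exists>c. F - (\<Sum>I\<in>UNIV. escale (c I) (B I)) \<in> ?J"
    if F: "\<forall>g\<in>G. actVd \<rho> g F = escale (chi g) F" for F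
  proof (rule basis_exchange_mod[OF ideal_subspace indJ])
    show "\<exists>a. B i - (\<Sum>j\<in>UNIV. escale (a j) (E j)) \<in> ?J" for i by (rule E) (use BH in blast)
    show "\<exists>c. F - (\<Sum>j\<in>UNIV. escale (c j) (E j)) \<in> ?J" by (rule E[OF F])
  qed
  \<comment> \<open>The error term of \<open>spanJ\<close> is itself harmonic, so it lies in the
    trivial intersection and the congruence becomes an equality.\<close>
  have spanH: "\<exists>c. F = (\<Sum>I\<in>UNIV. escale (c I) (B I))" if F: "F \<in> ?H" for F
  proof -
    obtain c where c: "F - (\<Sum>I\<in>UNIV. escale (c I) (B I)) \<in> ?J" using spanJ F by blast
    have "F - (\<Sum>I\<in>UNIV. escale (c I) (B I)) = 0"
      by (rule HJ[OF es.subspace_diff[OF subH F combH] c])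
    then show ?thesis by (metis eq_iff_diff_eq_0)
  qed
  have spanQ: "\<exists>c. F - (\<Sum>I\<in>UNIV. escale (c I) (B I)) \<in> ?J"
    if F: "\<forall>g\<in>G. actVd \<rho> g F - escale (chi g) F \<in> ?J" for F
  proof -
    obtain F' where F': "\<forall>g\<in>G. actVd \<rho> g F' = escale (chi g) F'" "F - F' \<in> ?J"
      using semiinvariant_projection[of chi F] chi_hom chi_nz F by blast
    obtain c where "F' - (\<Sum>I\<in>UNIV. escale (c I) (B I)) \<in> ?J" using spanJ[OF F'(1)] by blast
    from es.subspace_add[OF ideal_subspace F'(2) this]
    have "F - F' + (F' - (\<Sum>I\<in>UNIV. escale (c I) (B I))) \<in> ?J" .
    moreover have "F - F' + (F' - X) = F - X" for X by simp
    ultimately show ?thesis by (intro exI[of _ c]) (simp only:)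
  qed
  have B_eq: "dstar_seq tw I (embS \<Delta>) = B I" for I by (simp only: dstar_seq_foldr B_def)
  have zeroJ: "actVd \<rho> g (B I) - escale (chi g) (B I) \<in> ?J" if "g \<in> G" for g I
    unfolding B_def semi[OF that] diff_self by (rule es.subspace_0[OF ideal_subspace])
  show ?thesis
    unfolding Let_def B_eq esum_sum ezero_zero eminus_minus
    by (intro conjI allI impI ballI) (rule BH, erule ind[rule_format], erule spanH, erule zeroJ, erule indJ[rule_format], erule spanQ)
qed

end
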